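(* Let $f:\mathbb{E}\to\mathbb{R}$ be convex and $p$-times differentiable, $p\ge2$, with $H_{f,p}(\nu)<+\infty$ for a known $\nu\in[0,1]$; let $\varphi:\mathbb{E}\to\mathbb{R}\cup\{+\infty\}$ be a closed convex function with $\mathrm{ri}(\mathrm{dom}\,\varphi)\ne\emptyset$; let $\tilde f=f+\varphi$ have a minimizer $x^*$; and let $R\ge\|x_0-x^*\|$ with $R\ge1$. Let $\epsilon\in(0,1)$. Then Algorithm 6 (described in the context) with $$\delta=\frac{\epsilon}{2^{p+\nu}R^{p+\nu-1}}$$ performs at most $$\mathcal{O}\left(\log_2\left(\frac{R^{p+\nu-1}}{\epsilon}\right)\left(\frac{R^{p+\nu-1}}{\epsilon}\right)^{\frac{1}{p+\nu}}\right)$$ iterations of Algorithm 5 in order to generate $u_T$ such that $\|\nabla\tilde f(u_T)\|_*\le\epsilon$. Here $\mathcal{O}$ is understood as $R^{p+\nu-1}/\epsilon\to\infty$, with constants depending only on $p,\nu,H_{f,p}(\nu),\theta$.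
   Context: **Notation.** $\mathbb{E}$ is a finite-dimensional real vector space with dual $\mathbb{E}^*$, $B:\mathbb{E}\to\mathbb{E}^*$ is a fixed self-adjoint positive definite operator, $\|x\|=\langle Bx,x\rangle^{1/2}$, $\|s\|_*=\langle s,B^{-1}s\rangle^{1/2}$. $D^if(x)[h]^i$ is the $i$th directional derivative along $h$; the norm of a symmetric $p$-linear form $A$ is $\max\{|A[h_1,\ldots,h_p]|:\|h_i\|\le1\}$; $H_{f,p}(\nu)=\sup_{x\ne y}\|D^pf(x)-D^pf(y)\|/\|x-y\|^\nu$. **Regularized problem.** Fix $x_0\in\mathbb{E}$, $\delta>0$. Let $F_\delta(x)=f(x)+\frac{\delta}{p+\nu}\|x-x_0\|^{p+\nu}$ and $\tilde F_\delta=F_\delta+\varphi$. Let $C_{p,\nu}=2\prod_{i=1}^p(\nu+i)$, $H_{F_\delta,p}(\nu)=H_{f,p}(\nu)+\frac{\delta}{p+\nu}C_{p,\nu}$ (a Hölder constant of $D^pF_\delta$), and, for $\theta\ge0$, $H_\delta=p\left(H_{F_\delta,p}(\nu)+3\theta(p-1)!\right)$. Models: $\Omega_y(x)=F_\delta(y)+\sum_{i=1}^p\frac1{i!}D^iF_\delta(y)[x-y]^i+\frac{H_\delta}{p!}\|x-y\|^{p+\nu}$ and $\tilde\Omega_y=\Omega_y+\varphi$. **Algorithm 5** (applied to $\min\tilde F_\delta$ from a starting point $w_0$; the center $x_0$ in $F_\delta$ stays fixed). Set $\psi_0(x)=\frac{1}{p+\nu}\|x-w_0\|^{p+\nu}$,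 $v_0=w_0$, $A_0=0$. For $t=0,1,\ldots$ (one iteration each): compute $a_t>0$ solving $a_t^{p+\nu}=\frac{1}{2^{3p-1}}\left[\frac{(p-1)!}{H_\delta}\right](A_t+a_t)^{p+\nu-1}$; set $A_{t+1}=A_t+a_t$, $\gamma_t=a_t/A_{t+1}$, $\eta_t=(1-\gamma_t)w_t+\gamma_tv_t$; compute $w_{t+1}$ with $\tilde\Omega_{\eta_t}(w_{t+1})\le\tilde F_\delta(\eta_t)$ and $\|\nabla\Omega_{\eta_t}(w_{t+1})+g_\varphi(w_{t+1})\|_*\le\theta\|w_{t+1}-\eta_t\|^{p+\nu-1}$ for some $g_\varphi(w_{t+1})\in\partial\varphi(w_{t+1})$; set $\psi_{t+1}(x)=\psi_t(x)+a_t[F_\delta(w_{t+1})+\langle\nabla F_\delta(w_{t+1}),x-w_{t+1}\rangle+\varphi(x)]$ and $v_{t+1}=\arg\min_x\psi_{t+1}(x)$. **Algorithm 6.** Step 0: given $x_0$, $\epsilon\in(0,1)$, $\theta\ge0$, $\delta>0$, let $$m=1+\left\lceil\left(\frac{2^{4p+\nu-2}(p+\nu)^{p+\nu}H_\delta}{\delta(p-1)!}\right)^{\frac{1}{p+\nu}}\right\rceil,$$ $y_0=u_0=x_0$, $k:=0$. Step 1: if $k>0$ and $\|\nabla\tilde F_\delta(u_k)\|_*\le\epsilon/2$, stop. Step 2: run $m$ iterations of Algorithm 5 from $w_0=y_k$. Step 3: set $y_{k+1}=w_m$ and compute $u_{k+1}$ with $\tilde\Omega_{y_{k+1}}(u_{k+1})\le\tilde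 F_\delta(y_{k+1})$ and $\|\nabla\Omega_{y_{k+1}}(u_{k+1})+g_\varphi(u_{k+1})\|_*\le\theta\|u_{k+1}-y_{k+1}\|^{p+\nu-1}$ for some $g_\varphi(u_{k+1})\in\partial\varphi(u_{k+1})$. Step 4: $k:=k+1$, go to Step 1. **Convention.** For $k\ge1$, with $g_\varphi(u_k)$ from Step 3, $\nabla\tilde F_\delta(u_k)=\nabla F_\delta(u_k)+g_\varphi(u_k)$ and $\nabla\tilde f(u_k)=\nabla f(u_k)+g_\varphi(u_k)$. $u_T$ is the point at which Algorithm 6 stops.
   Formalization: For ν = 0 and odd p, the p-th derivative of ‖x−x₀‖^p does not exist at x₀, although Algorithm 6 uses D^pF_δ(x₀) in its first step; there the regularizer's contribution to D^pF_δ(x₀) is taken to be zero. *)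

theory Defs
  imports "HOL-Analysis.Analysis"
begin

text \<open>
  The finite-dimensional space \<open>E\<close> is a finite-dimensional subspace of an arbitrary real normed
  space rather than a type, so that constants can be chosen before \<open>E\<close> is, independently of its
  dimension. The ambient norm only supplies the topology of \<open>E\<close>; metric quantities use the norm
  induced by \<open>B\<close>. Elements of the dual of \<open>E\<close> are represented by linear functionals on the ambient
  space, of which only the restriction to \<open>E\<close> matters; \<open>B x :: 'a \<Rightarrow> real\<close> is the functional \<open>Bx\<close>,
  so \<open>B x y\<close> is the pairing of \<open>Bx\<close> with \<open>y\<close>.
\<close>

definition pos_def_selfadjoint_on :: "'a::real_vector set \<Rightarrow> ('a \<Rightarrow> 'a \<Rightarrow> real) \<Rightarrow> bool" where
  "pos_def_selfadjoint_on E B \<longleftrightarrow>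
     bilinear B \<and> (\<forall>x\<in>E. \<forall>y\<in>E. B x y = B y x) \<and> (\<forall>x\<in>E. x \<noteq> 0 \<longrightarrow> 0 < B x x)"

definition bnorm :: "('a \<Rightarrow> 'a \<Rightarrow> real) \<Rightarrow> 'a \<Rightarrow> real" where
  "bnorm B x = sqrt (B x x)"

text \<open>The described point is the preimage of \<open>s\<close> under \<open>B\<close>.\<close>

definition dual_norm :: "'a set \<Rightarrow> ('a \<Rightarrow> 'a \<Rightarrow> real) \<Rightarrow> ('a \<Rightarrow> real) \<Rightarrow> real" where
  "dual_norm E B s = sqrt (s (THE u. u \<in> E \<and> (\<forall>h\<in>E. B u h = s h)))"

text \<open>A directional derivative that does not exist is set to \<open>0\<close>; see \<open>reg_form\<close> below for the
  only place where this matters.\<close>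

definition dir_deriv :: "('a::real_vector \<Rightarrow> real) \<Rightarrow> 'a \<Rightarrow> 'a \<Rightarrow> real" where
  "dir_deriv g x h =
     (if (\<lambda>t. g (x + t *\<^sub>R h)) field_differentiable at 0
      then deriv (\<lambda>t. g (x + t *\<^sub>R h)) 0 else 0)"

text \<open>\<open>nderiv g [h\<^sub>1, \<dots>, h\<^sub>i] x\<close> is \<open>D\<^sup>i g(x)[h\<^sub>1, \<dots>, h\<^sub>i]\<close>.\<close>

primrec nderiv :: "('a::real_vector \<Rightarrow> real) \<Rightarrow> 'a list \<Rightarrow> 'a \<Rightarrow> real" where
  "nderiv g [] = g"
| "nderiv g (h # hs) = (\<lambda>x. dir_deriv (nderiv g hs) x h)"

definition grad :: "('a::real_vector \<Rightarrow> real) \<Rightarrow> 'a \<Rightarrow> 'a \<Rightarrow> real" where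
  "grad g x = (\<lambda>h. nderiv g [h] x)"

text \<open>Frechet differentiability, on \<open>E\<close>, of each derivative of order below \<open>p\<close>. As \<open>E\<close> is
  finite-dimensional, a map into multilinear forms is differentiable iff its evaluation at every
  tuple of directions is.\<close>

definition times_differentiable_on :: "nat \<Rightarrow> ('a::real_normed_vector \<Rightarrow> real) \<Rightarrow> 'a set \<Rightarrow> bool" where
  "times_differentiable_on p g E \<longleftrightarrow>
     (\<forall>hs. set hs \<subseteq> E \<and> length hs < p \<longrightarrow> nderiv g hs differentiable_on E)"

definition form_norm :: "'a set \<Rightarrow> ('a \<Rightarrow> 'a \<Rightarrow> real) \<Rightarrow> nat \<Rightarrow> ('a list \<Rightarrow> real) \<Rightarrow> ennreal" where
  "form_norm E B p A =
     (SUP hs \<in> {hs. length hs = p \<and> set hs \<subseteq> E \<and> (\<forall>h\<in>set hs. bnorm B h \<le> 1)}. ennreal \<bar>A hs\<bar>)"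

definition holder_const ::
  "'a::real_vector set \<Rightarrow> ('a \<Rightarrow> 'a \<Rightarrow> real) \<Rightarrow> nat \<Rightarrow> real \<Rightarrow> ('a \<Rightarrow> real) \<Rightarrow> ennreal" where
  "holder_const E B p \<nu> g =
     (SUP (x, y) \<in> {(x, y). x \<in> E \<and> y \<in> E \<and> x \<noteq> y}.
        form_norm E B p (\<lambda>hs. nderiv g hs x - nderiv g hs y) / ennreal (bnorm B (x - y) powr \<nu>))"

definition ext_epigraph :: "'a set \<Rightarrow> ('a \<Rightarrow> ereal) \<Rightarrow> ('a \<times> real) set" where
  "ext_epigraph E \<phi> = {(x, r). x \<in> E \<and> \<phi> x \<le> ereal r}"

definition closed_convex_fun_on :: "'a::real_normed_vector set \<Rightarrow> ('a \<Rightarrow> ereal) \<Rightarrow> bool" where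
  "closed_convex_fun_on E \<phi> \<longleftrightarrow>
     (\<forall>x\<in>E. \<phi> x \<noteq> -\<infinity>) \<and> convex (ext_epigraph E \<phi>) \<and>
     closedin (top_of_set (E \<times> UNIV)) (ext_epigraph E \<phi>)"

definition eff_dom :: "'a set \<Rightarrow> ('a \<Rightarrow> ereal) \<Rightarrow> 'a set" where
  "eff_dom E \<phi> = {x \<in> E. \<phi> x < \<infinity>}"

definition subdiff :: "'a::real_vector set \<Rightarrow> ('a \<Rightarrow> ereal) \<Rightarrow> 'a \<Rightarrow> ('a \<Rightarrow> real) set" where
  "subdiff E \<phi> w =
     {g. linear g \<and> w \<in> eff_dom E \<phi> \<and> (\<forall>x\<in>E. \<phi> w + ereal (g (x - w)) \<le> \<phi> x)}"

definition pow_reg :: "('a::real_vector \<Rightarrow> 'a \<Rightarrow> real) \<Rightarrow> nat \<Rightarrow> real \<Rightarrow> 'a \<Rightarrow> 'a \<Rightarrow> real" where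
  "pow_reg B p \<nu> c x = bnorm B (x - c) powr (real p + \<nu>)"

definition reg_fun ::
  "('a::real_vector \<Rightarrow> 'a \<Rightarrow> real) \<Rightarrow> nat \<Rightarrow> real \<Rightarrow> ('a \<Rightarrow> real) \<Rightarrow> 'a \<Rightarrow> real \<Rightarrow> 'a \<Rightarrow> real" where
  "reg_fun B p \<nu> f x0 \<delta> x = f x + \<delta> / (real p + \<nu>) * pow_reg B p \<nu> x0 x"

text \<open>
  \<open>reg_form B p \<nu> f x0 \<delta> i y h\<close> is \<open>D\<^sup>i F\<^sub>\<delta>(y)[h]\<^sup>i\<close>, expanded by linearity. If \<open>\<nu> = 0\<close> and \<open>p\<close> is odd,
  the \<open>p\<close>-th derivative of the \<open>p\<close>-th power of the norm does not exist at the origin, although the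
  algorithm uses \<open>D\<^sup>p F\<^sub>\<delta>(x\<^sub>0)\<close> in its first step. The expansion together with the convention in
  \<open>dir_deriv\<close> takes the contribution of the regularizer to be the zero form there; in all other
  cases it is the ordinary derivative of \<open>F\<^sub>\<delta>\<close>.
\<close>

definition reg_form ::
  "('a::real_vector \<Rightarrow> 'a \<Rightarrow> real) \<Rightarrow> nat \<Rightarrow> real \<Rightarrow> ('a \<Rightarrow> real) \<Rightarrow> 'a \<Rightarrow> real \<Rightarrow>
   nat \<Rightarrow> 'a \<Rightarrow> 'a \<Rightarrow> real" where
  "reg_form B p \<nu> f x0 \<delta> i y h =
     nderiv f (replicate i h) y
     + \<delta> / (real p + \<nu>) * nderiv (pow_reg B p \<nu> x0) (replicate i h) y"

definition C_const :: "nat \<Rightarrow> real \<Rightarrow> real" where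
  "C_const p \<nu> = 2 * (\<Prod>i=1..p. \<nu> + real i)"

text \<open>\<open>Hf\<close> stands for the Hoelder constant \<open>holder_const E B p \<nu> f\<close>, as a real number.\<close>

definition H_delta :: "nat \<Rightarrow> real \<Rightarrow> real \<Rightarrow> real \<Rightarrow> real \<Rightarrow> real" where
  "H_delta p \<nu> Hf \<theta> \<delta> =
     real p * ((Hf + \<delta> / (real p + \<nu>) * C_const p \<nu>) + 3 * \<theta> * fact (p - 1))"

definition model ::
  "('a::real_vector \<Rightarrow> 'a \<Rightarrow> real) \<Rightarrow> nat \<Rightarrow> real \<Rightarrow> real \<Rightarrow> real \<Rightarrow> ('a \<Rightarrow> real) \<Rightarrow> 'a \<Rightarrow> real \<Rightarrow>
   'a \<Rightarrow> 'a \<Rightarrow> real" where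
  "model B p \<nu> Hf \<theta> f x0 \<delta> y x =
     reg_fun B p \<nu> f x0 \<delta> y
     + (\<Sum>i=1..p. 1 / fact i * reg_form B p \<nu> f x0 \<delta> i y (x - y))
     + H_delta p \<nu> Hf \<theta> \<delta> / fact p * bnorm B (x - y) powr (real p + \<nu>)"

text \<open>The inexact tensor step from \<open>y\<close>: the point \<open>x\<close> is acceptable, with subgradient \<open>g\<close>.\<close>

definition tensor_step ::
  "'a::real_vector set \<Rightarrow> ('a \<Rightarrow> 'a \<Rightarrow> real) \<Rightarrow> nat \<Rightarrow> real \<Rightarrow> real \<Rightarrow> real \<Rightarrow> ('a \<Rightarrow> real) \<Rightarrow>
   ('a \<Rightarrow> ereal) \<Rightarrow> 'a \<Rightarrow> real \<Rightarrow> 'a \<Rightarrow> 'a \<Rightarrow> ('a \<Rightarrow> real) \<Rightarrow> bool" where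
  "tensor_step E B p \<nu> Hf \<theta> f \<phi> x0 \<delta> y x g \<longleftrightarrow>
     x \<in> E \<and> g \<in> subdiff E \<phi> x \<and>
     ereal (model B p \<nu> Hf \<theta> f x0 \<delta> y x) + \<phi> x \<le> ereal (reg_fun B p \<nu> f x0 \<delta> y) + \<phi> y \<and>
     dual_norm E B (\<lambda>h. grad (model B p \<nu> Hf \<theta> f x0 \<delta> y) x h + g h)
       \<le> \<theta> * bnorm B (x - y) powr (real p + \<nu> - 1)"

text \<open>\<open>alg5 \<dots> w0 m z\<close>: \<open>m\<close> iterations of the accelerated method started at \<open>w0\<close> can produce
  \<open>w\<^sub>m = z\<close>. The method is nondeterministic because its subproblems are solved inexactly.\<close>

definition alg5 ::
  "'a::real_vector set \<Rightarrow> ('a \<Rightarrow> 'a \<Rightarrow> real) \<Rightarrow> nat \<Rightarrow> real \<Rightarrow> real \<Rightarrow> real \<Rightarrow> ('a \<Rightarrow> real) \<Rightarrow>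
   ('a \<Rightarrow> ereal) \<Rightarrow> 'a \<Rightarrow> real \<Rightarrow> 'a \<Rightarrow> nat \<Rightarrow> 'a \<Rightarrow> bool" where
  "alg5 E B p \<nu> Hf \<theta> f \<phi> x0 \<delta> w0 m z \<longleftrightarrow>
     (\<exists>w v \<eta> :: nat \<Rightarrow> 'a. \<exists>a A \<gamma> :: nat \<Rightarrow> real. \<exists>\<psi> :: nat \<Rightarrow> 'a \<Rightarrow> ereal. \<exists>g :: nat \<Rightarrow> 'a \<Rightarrow> real.
        w 0 = w0 \<and> v 0 = w0 \<and> A 0 = 0 \<and>
        \<psi> 0 = (\<lambda>x. ereal (1 / (real p + \<nu>) * bnorm B (x - w0) powr (real p + \<nu>))) \<and>
        (\<forall>t<m.
           a t > 0 \<and>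
           a t powr (real p + \<nu>) =
             1 / 2 ^ (3 * p - 1) * (fact (p - 1) / H_delta p \<nu> Hf \<theta> \<delta>)
               * (A t + a t) powr (real p + \<nu> - 1) \<and>
           A (Suc t) = A t + a t \<and>
           \<gamma> t = a t / A (Suc t) \<and>
           \<eta> t = (1 - \<gamma> t) *\<^sub>R w t + \<gamma> t *\<^sub>R v t \<and>
           tensor_step E B p \<nu> Hf \<theta> f \<phi> x0 \<delta> (\<eta> t) (w (Suc t)) (g (Suc t)) \<and>
           \<psi> (Suc t) = (\<lambda>x. \<psi> t x + ereal (a t) *
             (ereal (reg_fun B p \<nu> f x0 \<delta> (w (Suc t))
                     + grad (reg_fun B p \<nu> f x0 \<delta>) (w (Suc t)) (x - w (Suc t)))
              + \<phi> x)) \<and>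
           is_arg_min (\<psi> (Suc t)) (\<lambda>x. x \<in> E) (v (Suc t))) \<and>
        w m = z)"

definition alg6_inner :: "nat \<Rightarrow> real \<Rightarrow> real \<Rightarrow> real \<Rightarrow> real \<Rightarrow> nat" where
  "alg6_inner p \<nu> Hf \<theta> \<delta> =
     1 + nat \<lceil>((2 powr (4 * real p + \<nu> - 2) * (real p + \<nu>) powr (real p + \<nu>) * H_delta p \<nu> Hf \<theta> \<delta>)
               / (\<delta> * fact (p - 1))) powr (1 / (real p + \<nu>))\<rceil>"

definition alg6_stop ::
  "'a::real_vector set \<Rightarrow> ('a \<Rightarrow> 'a \<Rightarrow> real) \<Rightarrow> nat \<Rightarrow> real \<Rightarrow> ('a \<Rightarrow> real) \<Rightarrow> 'a \<Rightarrow> real \<Rightarrow> real \<Rightarrow>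
   (nat \<Rightarrow> 'a) \<Rightarrow> (nat \<Rightarrow> 'a \<Rightarrow> real) \<Rightarrow> nat \<Rightarrow> bool" where
  "alg6_stop E B p \<nu> f x0 \<delta> \<epsilon> u g k \<longleftrightarrow>
     0 < k \<and> dual_norm E B (\<lambda>h. grad (reg_fun B p \<nu> f x0 \<delta>) (u k) h + g k h) \<le> \<epsilon> / 2"

text \<open>The sequences \<open>y\<close>, \<open>u\<close>, \<open>g\<close> (with \<open>g k\<close> the subgradient at \<open>u k\<close>) record an execution of the
  restarted method; they are constrained only as long as the stopping test has not succeeded.\<close>

definition alg6_execution ::
  "'a::real_vector set \<Rightarrow> ('a \<Rightarrow> 'a \<Rightarrow> real) \<Rightarrow> nat \<Rightarrow> real \<Rightarrow> real \<Rightarrow> real \<Rightarrow> ('a \<Rightarrow> real) \<Rightarrow>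
   ('a \<Rightarrow> ereal) \<Rightarrow> 'a \<Rightarrow> real \<Rightarrow> real \<Rightarrow> (nat \<Rightarrow> 'a) \<Rightarrow> (nat \<Rightarrow> 'a) \<Rightarrow> (nat \<Rightarrow> 'a \<Rightarrow> real) \<Rightarrow> bool" where
  "alg6_execution E B p \<nu> Hf \<theta> f \<phi> x0 \<delta> \<epsilon> y u g \<longleftrightarrow>
     y 0 = x0 \<and> u 0 = x0 \<and>
     (\<forall>k. (\<forall>j\<le>k. \<not> alg6_stop E B p \<nu> f x0 \<delta> \<epsilon> u g j) \<longrightarrow>
        alg5 E B p \<nu> Hf \<theta> f \<phi> x0 \<delta> (y k) (alg6_inner p \<nu> Hf \<theta> \<delta>) (y (Suc k)) \<and>
        tensor_step E B p \<nu> Hf \<theta> f \<phi> x0 \<delta> (y (Suc k)) (u (Suc k)) (g (Suc k)))"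

end

theory Submission
  imports Defs
begin

text \<open>
  Write \<open>q = p + \<nu>\<close>. The regularizer \<open>\<parallel>x\<parallel>\<^sup>q\<close> is, up to a constant, the average of \<open>\<bar>x \<bullet> \<omega>\<bar>\<^sup>q\<close> over \<open>\<omega>\<close> in a
  Euclidean ball, so the Taylor remainder of its gradient reduces, by Hoelder's inequality, to that of
  the scalar function \<open>\<bar>t\<bar>\<^sup>q\<close>; this yields the constant \<open>C_const\<close>. Together with Taylor's formula for \<open>f\<close>
  it shows that a tensor step from \<open>y\<close> to \<open>x\<close> at distance \<open>r\<close> produces a subgradient \<open>s\<close> of the
  regularized objective at \<open>x\<close> which is a perturbation of \<open>- q \<lambda> r\<^bsup>q-2\<^esup> B (x - y)\<close> of size at most
  \<open>\<lambda> r\<^bsup>q-1\<^esup>\<close>. Hence \<open>s\<close> is of order \<open>\<lambda> r\<^bsup>q-1\<^esup>\<close> while the step gains at least \<open>(q - 1) \<lambda> r\<^sup>q\<close>.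

  Estimating sequences turn this into the rate \<open>\<parallel>x - w\<^sub>0\<parallel>\<^sup>q / (q A\<^sub>m)\<close> with \<open>A\<^sub>m\<close> of order \<open>m\<^sup>q\<close>. The number \<open>m\<close>
  of inner iterations is such that, by uniform convexity of the regularizer, each restart contracts the
  gap to the infimum by a fixed factor below 1, so that logarithmically many restarts make the
  gradient small. The iterates stay within \<open>2 R\<close> of \<open>x\<^sub>0\<close>, where the gradient of the regularizer is at
  most \<open>\<epsilon> / 2\<close>.
\<close>

section \<open>Powers of the absolute value\<close>

text \<open>The scalar Taylor bound for |t|^q is uniform in the base point, so it can be integrated
  over \<omega> as it stands. The average is normalised so that the q-th moment of x is exactly the
  q-th power of its norm; Hoelder's inequality then loses no factor and the scalar constant carries
  over unchanged. The factor 2 in \<open>C_const\<close> is the price of a sign change across the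
  origin. Each estimate involves only a few vectors at a time, so the average can be taken in a
  fixed R^4 whatever the dimension of \<open>E\<close>.

  Two obstacles shape the second half. The starting point \<open>x0\<close> may lie outside the
  domain of \<phi>, so the contraction of the gap can only start after one complete restart, which
  is compared directly with the minimizer of the original problem. Moreover, the regularized
  objective is not shown to attain its infimum: the rate is stated against every point of the
  domain, and the restart argument works with approximate minimizers.\<close>

lemma young_powr:
  fixes a b q :: real
  assumes "1 < q" "0 \<le> a" "0 \<le> b"
  shows "q * (a powr (q - 1) * b) \<le> (q - 1) * a powr q + b powr q"
proof (cases "a = 0 \<or> b = 0")
  case False
  then have ab: "0 < a" "0 < b" using assms by auto
  \<comment> \<open>Weighted arithmetic-geometric mean with weights (q-1)/q and 1/q. Read as b^q
    \<ge> a^q + q a^(q-1) (b - a), the result also serves below as the tangent inequality of the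
    q-th power.\<close>
  have "(a powr q) powr ((q - 1) / q) * (b powr q) powr (1 / q)
      \<le> (q - 1) / q * a powr q + 1 / q * b powr q"
    using assms ab by (intro Youngs_inequality_0) (auto simp: field_simps)
  then have "a powr (q - 1) * b \<le> ((q - 1) * a powr q + b powr q) / q"
    using assms ab by (simp add: powr_powr add_divide_distrib)
  then show ?thesis using assms by (simp add: le_divide_eq mult.commute)
qed (use assms in auto)

section \<open>Integrating power bounds on derivatives\<close>

lemma abs_le_of_deriv_powr_bound_right:
  fixes e e' :: "real \<Rightarrow> real"
  assumes d: "\<And>t. (e has_real_derivative e' t) (at t)"
    and b: "\<And>t. \<bar>e' t\<bar> \<le> M * \<bar>t - a\<bar> powr \<beta>"
    and "e a = 0" "0 \<le> \<beta>" "a \<le> b"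
  shows "\<bar>e b\<bar> \<le> M * \<bar>b - a\<bar> powr (\<beta> + 1) / (\<beta> + 1)"
proof -
  have key: "s * e b \<le> M * \<bar>b - a\<bar> powr (\<beta> + 1) / (\<beta> + 1)" if s: "s = 1 \<or> s = -1" for s :: real
  proof -
    \<comment> \<open>Monotonicity of \<open>h\<close> needs its derivative only in the open
      interval, which avoids differentiating the power at its zero \<open>a\<close>. The sign
      \<open>s\<close> treats \<open>e\<close> and its negative at once.\<close>
    define h where "h t = M * (t - a) powr (\<beta> + 1) / (\<beta> + 1) - s * e t" for t
    have "h a \<le> h b"
    proof (rule DERIV_nonneg_imp_increasing_open[OF \<open>a \<le> b\<close>])
      fix x assume x: "a < x" "x < b"
      have "(h has_real_derivative M * (x - a) powr \<beta> - s * e' x) (at x)"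
        unfolding h_def using x assms(4)
        by (auto intro!: derivative_eq_intros d simp: divide_simps) (simp add: algebra_simps)
      moreover have "0 \<le> M * (x - a) powr \<beta> - s * e' x"
        using b[of x] s x by auto
      ultimately show "\<exists>y. (h has_real_derivative y) (at x) \<and> 0 \<le> y" by blast
    next
      have "continuous_on {a..b} e"
        by (meson DERIV_continuous continuous_at_imp_continuous_on d)
      then show "continuous_on {a..b} h"
        unfolding h_def using assms(4) by (intro continuous_intros continuous_on_powr') auto
    qed
    then show ?thesis using assms by (simp add: h_def)
  qed
  show ?thesis using key[of 1] key[of "-1"] by linarith
qed

lemma abs_le_of_deriv_powr_bound:
  fixes e e' :: "real \<Rightarrow> real"
  assumes d: "\<And>t. (e has_real_derivative e' t) (at t)"
    and b: "\<And>t. \<bar>e' t\<bar> \<le> M * \<bar>t - a\<bar> powr \<beta>"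
    and "e a = 0" "0 \<le> \<beta>"
  shows "\<bar>e b\<bar> \<le> M * \<bar>b - a\<bar> powr (\<beta> + 1) / (\<beta> + 1)"
proof (cases "a \<le> b")
  case True
  then show ?thesis using abs_le_of_deriv_powr_bound_right[OF assms] by blast
next
  case False
  have 1: "((\<lambda>t. e (- t)) has_real_derivative - e' (- t)) (at t)" for t
  proof -
    have "((\<lambda>t. - t) has_real_derivative - 1) (at t)" by (auto intro!: derivative_eq_intros)
    from DERIV_chain2[OF d this] show ?thesis by simp
  qed
  have 2: "\<bar>- e' (- t)\<bar> \<le> M * \<bar>t - (- a)\<bar> powr \<beta>" for t
    using b[of "-t"] by (simp add: abs_minus_commute add.commute)
  have "\<bar>e (- (- b))\<bar> \<le> M * \<bar>- b - (- a)\<bar> powr (\<beta> + 1) / (\<beta> + 1)"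
    using False assms by (intro abs_le_of_deriv_powr_bound_right[OF 1 2]) auto
  then show ?thesis by (simp add: abs_minus_commute)
qed

text \<open>The hypothesis on the top order is a first-order expansion instead of a derivative, because
  the last derivative of \<open>\<bar>t\<bar>\<^sup>p\<close> does not exist at \<open>0\<close> for odd \<open>p\<close>.\<close>

lemma taylor_holder_bound:
  fixes G :: "nat \<Rightarrow> real \<Rightarrow> real"
  assumes "\<And>i t. i < n \<Longrightarrow> (G i has_real_derivative G (Suc i) t) (at t)"
    and "\<And>t. \<bar>G n t - G n a - (t - a) * G (Suc n) a\<bar> \<le> K * \<bar>t - a\<bar> powr (\<nu> + 1)"
    and "0 \<le> \<nu>" "0 \<le> K"
  shows "\<bar>G 0 b - (\<Sum>i\<le>Suc n. G i a * (b - a) ^ i / fact i)\<bar>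
           \<le> K * \<bar>b - a\<bar> powr (\<nu> + 1 + n) / fact (Suc n)"
  using assms(1,2)
proof (induction n arbitrary: G b)
  case 0
  from 0(2)[of b] show ?case by (simp add: algebra_simps)
next
  case (Suc n)
  have IH: "\<bar>G 1 t - (\<Sum>i\<le>Suc n. G (Suc i) a * (t - a) ^ i / fact i)\<bar>
           \<le> K * \<bar>t - a\<bar> powr (\<nu> + 1 + n) / fact (Suc n)" for t
    using Suc.IH[of "\<lambda>i. G (Suc i)" t] Suc.prems by simp
  \<comment> \<open>The derivative \<open>e'\<close> of the remainder \<open>e\<close> is the
    remainder of the shifted family, of one order less. The induction hypothesis bounds it, and
    integration raises the exponent by one.\<close>
  define e where "e t = G 0 t - (\<Sum>i\<le>Suc (Suc n). G i a * (t - a) ^ i / fact i)" for t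
  define e' where "e' t = G 1 t - (\<Sum>i\<le>Suc n. G (Suc i) a * (t - a) ^ i / fact i)" for t
  have e_eq: "e t = G 0 t - (G 0 a + (\<Sum>i\<le>Suc n. G (Suc i) a * (t - a) ^ Suc i / fact (Suc i)))" for t
    unfolding e_def by (subst sum.atMost_Suc_shift) simp
  have "(e has_real_derivative e' t) (at t)" for t
  proof -
    have "((\<lambda>t. G (Suc i) a * (t - a) ^ Suc i / fact (Suc i)) has_real_derivative
           G (Suc i) a * (t - a) ^ i / fact i) (at t)" for i
    proof -
      have "((\<lambda>t. (t - a) ^ Suc i) has_real_derivative real (Suc i) * (t - a) ^ i) (at t)"
        by (rule derivative_eq_intros refl | simp del: power_Suc of_nat_Suc)+
      from DERIV_cmult[OF this, of "G (Suc i) a / fact (Suc i)"] show ?thesis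
        by (simp del: power_Suc of_nat_Suc)
    qed
    then have "((\<lambda>t. \<Sum>i\<le>Suc n. G (Suc i) a * (t - a) ^ Suc i / fact (Suc i)) has_real_derivative
           (\<Sum>i\<le>Suc n. G (Suc i) a * (t - a) ^ i / fact i)) (at t)"
      by (rule DERIV_sum)
    from DERIV_diff[OF Suc.prems(1)[of 0 t] DERIV_add[OF DERIV_const[of "G 0 a"] this]] show ?thesis
      by (simp add: e_eq[abs_def] e'_def del: sum.atMost_Suc fact_Suc power_Suc)
  qed
  moreover have "\<bar>e' t\<bar> \<le> K / fact (Suc n) * \<bar>t - a\<bar> powr (\<nu> + 1 + n)" for t
    using IH[of t] by (simp add: e'_def)
  moreover have "e a = 0"
    by (simp add: e_eq)
  ultimately have "\<bar>e b\<bar> \<le> K / fact (Suc n) * \<bar>b - a\<bar> powr (\<nu> + 1 + n + 1) / (\<nu> + 1 + n + 1)"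
    using assms(3) by (intro abs_le_of_deriv_powr_bound) auto
  also have "\<dots> = (K * \<bar>b - a\<bar> powr (\<nu> + 1 + n + 1)) / (fact (Suc n) * (\<nu> + 1 + n + 1))"
    by simp
  \<comment> \<open>Integration produces the factor \<nu> + n + 2; lowering it to n + 2 turns the
    denominator into a factorial free of \<nu>.\<close>
  also have "\<dots> \<le> (K * \<bar>b - a\<bar> powr (\<nu> + 1 + n + 1)) / fact (Suc (Suc n))"
  proof (rule frac_le)
    have "fact (Suc (Suc n)) = fact (Suc n) * (real n + 2)"
      by (subst fact_Suc) (simp add: mult.commute)
    also have "\<dots> \<le> fact (Suc n) * (\<nu> + 1 + n + 1)"
      using assms(3) by (intro mult_left_mono) auto
    finally show "(fact (Suc (Suc n)) :: real) \<le> fact (Suc n) * (\<nu> + 1 + n + 1)" .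
  qed (use assms in auto)
  finally show ?case
    by (simp add: e_def add_ac del: fact_Suc sum.atMost_Suc)
qed

text \<open>\<open>abs_powr_deriv q i\<close> is the \<open>i\<close>-th derivative of \<open>\<bar>t\<bar>\<^sup>q\<close>, except that for odd \<open>i = q\<close> it is
  completed by \<open>0\<close> at the origin. The case distinction avoids the value \<open>0 powr 0 = 0\<close>.\<close>

definition signed_powr :: "nat \<Rightarrow> real \<Rightarrow> real \<Rightarrow> real" where
  "signed_powr i a t = (if even i then 1 else sgn t) * (if a = 0 then 1 else \<bar>t\<bar> powr a)"

definition abs_powr_deriv :: "real \<Rightarrow> nat \<Rightarrow> real \<Rightarrow> real" where
  "abs_powr_deriv q i t = (\<Prod>j<i. q - real j) * signed_powr i (q - real i) t"

lemma abs_signed_powr_le: "0 \<le> a \<Longrightarrow> \<bar>t\<bar> \<le> r \<Longrightarrow> 1 \<le> r \<Longrightarrow> \<bar>signed_powr i a t\<bar> \<le> r powr a"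
  by (auto simp: signed_powr_def abs_mult sgn_if powr_mono2 ge_one_powr_ge_zero)

text \<open>The excluded case, t = 0 with a = 1 and even i, is the corner of |t|.\<close>

lemma has_derivative_signed_powr:
  assumes "1 \<le> a" "t \<noteq> 0 \<or> 1 < a \<or> odd i"
  shows "(signed_powr i a has_real_derivative a * signed_powr (Suc i) (a - 1) t) (at t)"
proof -
  consider "t > 0" | "t < 0" | "t = 0" by linarith
  then show ?thesis
  proof cases
    case 1
    have "((\<lambda>t. t powr a) has_real_derivative a * signed_powr (Suc i) (a - 1) t) (at t)"
      by (rule DERIV_cong[OF has_real_derivative_powr]) (use 1 in \<open>auto simp: signed_powr_def\<close>)
    then show ?thesis
      by (rule has_field_derivative_transform_within_open[where S = "{0<..}"])
        (use 1 assms in \<open>auto simp: signed_powr_def\<close>)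
  next
    case 2
    have "((\<lambda>t. (- 1) ^ i * (- t) powr a) has_real_derivative a * signed_powr (Suc i) (a - 1) t) (at t)"
    proof -
      have 1: "((\<lambda>t. - t) has_real_derivative - 1) (at t)" by (auto intro!: derivative_eq_intros)
      have 3: "((\<lambda>x. x powr a) has_real_derivative a * (- t) powr (a - 1)) (at (- t))"
        using \<open>t < 0\<close> by (intro has_real_derivative_powr) auto
      show ?thesis
        by (rule DERIV_cong[OF DERIV_cmult[OF DERIV_chain2[OF 3 1]]])
          (use \<open>t < 0\<close> in \<open>auto simp: signed_powr_def minus_one_power_iff\<close>)
    qed
    then show ?thesis
      by (rule has_field_derivative_transform_within_open[where S = "{..<0}"])
        (use 2 assms in \<open>auto simp: signed_powr_def minus_one_power_iff\<close>)
  next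
    case 3
    \<comment> \<open>At the origin the difference quotient is itself a signed power of the next
      order, so only its limit remains: it is constantly 1 for a = 1 and odd i, and tends to 0 for a
      > 1.\<close>
    have q: "(signed_powr i a h - signed_powr i a 0) / h = signed_powr (Suc i) (a - 1) h" if "h \<noteq> 0" for h
      using that assms by (auto simp: signed_powr_def powr_diff sgn_if abs_if)
    have ev: "\<forall>\<^sub>F h in at 0. (signed_powr i a (0 + h) - signed_powr i a 0) / h = signed_powr (Suc i) (a - 1) h"
      using q by (auto simp: eventually_at_filter)
    have "((\<lambda>h. (signed_powr i a (0 + h) - signed_powr i a 0) / h) \<longlongrightarrow> a * signed_powr (Suc i) (a - 1) 0) (at 0)"
    proof (cases "a = 1")
      case True
      then have "odd i" using assms 3 by auto
      then have "signed_powr (Suc i) (a - 1) = (\<lambda>_. 1)" using True by (auto simp: signed_powr_def)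
      then show ?thesis unfolding tendsto_cong[OF ev] using True by simp
    next
      case False
      have "((\<lambda>h. signed_powr (Suc i) (a - 1) h) \<longlongrightarrow> 0) (at 0)"
      proof (rule Lim_null_comparison)
        show "\<forall>\<^sub>F h in at 0. norm (signed_powr (Suc i) (a - 1) h) \<le> \<bar>h\<bar> powr (a - 1)"
          using False by (auto simp: eventually_at_filter signed_powr_def abs_mult sgn_if)
        show "((\<lambda>h. \<bar>h\<bar> powr (a - 1)) \<longlongrightarrow> 0) (at (0::real))"
          using assms False by (intro tendsto_zero_powrI[where b = "a - 1"] tendsto_const tendsto_rabs_zero) auto
      qed
      moreover have "a * signed_powr (Suc i) (a - 1) 0 = 0"
        using False by (simp add: signed_powr_def)
      ultimately show ?thesis unfolding tendsto_cong[OF ev] by (simp only:)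
    qed
    then show ?thesis using 3 by (simp add: DERIV_def)
  qed
qed

lemma has_derivative_abs_powr_deriv:
  assumes "real i + 1 \<le> q" "t \<noteq> 0 \<or> real i + 1 < q \<or> odd i"
  shows "(abs_powr_deriv q i has_real_derivative abs_powr_deriv q (Suc i) t) (at t)"
proof -
  have "(signed_powr i (q - i) has_real_derivative (q - i) * signed_powr (Suc i) (q - i - 1) t) (at t)"
    using assms by (intro has_derivative_signed_powr) auto
  from DERIV_cmult[OF this, of "\<Prod>j<i. q - real j"] show ?thesis
    by (simp add: abs_powr_deriv_def[abs_def] algebra_simps)
qed

text \<open>After division by the right power of a + b this says that on [0, 1] a power with
  exponent at most 1 dominates the identity.\<close>

lemma powr_subadditive:
  fixes a b \<nu> :: real
  assumes "0 \<le> a" "0 \<le> b" "0 < \<nu>" "\<nu> \<le> 1"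
  shows "(a + b) powr \<nu> \<le> a powr \<nu> + b powr \<nu>"
proof (cases "a + b = 0")
  case False
  then have s: "a + b > 0" using assms by linarith
  have *: "x / (a + b) \<le> (x / (a + b)) powr \<nu>" if "0 \<le> x" "x \<le> a + b" for x
  proof (cases "x = 0")
    case False
    then show ?thesis using that s assms powr_mono'[of \<nu> 1 "x / (a + b)"] by simp
  qed simp
  have "1 = a / (a + b) + b / (a + b)" using s by (simp flip: add_divide_distrib)
  also have "\<dots> \<le> (a / (a + b)) powr \<nu> + (b / (a + b)) powr \<nu>"
    using *[of a] *[of b] assms by linarith
  also have "\<dots> = (a powr \<nu> + b powr \<nu>) / (a + b) powr \<nu>"
    using assms s by (simp add: powr_divide add_divide_distrib)
  finally show ?thesis using s by (simp add: le_divide_eq)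
qed (use assms in auto)

text \<open>For equal signs subadditivity gives the constant 1. For different signs both |a| and |b|
  are at most |a - b|, which costs the factor 2; for \<nu> = 0 the values lie in {-1, 0, 1}. This 2
  is the one in \<open>C_const\<close>.\<close>

lemma signed_powr_holder:
  assumes "0 \<le> \<nu>" "\<nu> \<le> 1"
  shows "\<bar>signed_powr i \<nu> a - signed_powr i \<nu> b\<bar> \<le> 2 * \<bar>a - b\<bar> powr \<nu>"
proof (cases "\<nu> = 0")
  case True
  then show ?thesis by (cases "a = b") (auto simp: signed_powr_def sgn_if)
next
  case False
  define u v where "u = \<bar>a\<bar> powr \<nu>" and "v = \<bar>b\<bar> powr \<nu>"
  have nn: "0 \<le> u" "0 \<le> v" "0 \<le> \<bar>a - b\<bar> powr \<nu>" by (auto simp: u_def v_def)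
  have sub: "\<bar>x\<bar> powr \<nu> \<le> \<bar>y\<bar> powr \<nu> + \<bar>x - y\<bar> powr \<nu>" for x y :: real
  proof -
    have "\<bar>x\<bar> powr \<nu> \<le> (\<bar>y\<bar> + \<bar>x - y\<bar>) powr \<nu>" using assms by (intro powr_mono2) auto
    also have "\<dots> \<le> \<bar>y\<bar> powr \<nu> + \<bar>x - y\<bar> powr \<nu>" using assms False by (intro powr_subadditive) auto
    finally show ?thesis .
  qed
  have 1: "\<bar>u - v\<bar> \<le> \<bar>a - b\<bar> powr \<nu>"
    using sub[of a b] sub[of b a] by (simp add: u_def v_def abs_minus_commute abs_le_iff)
  have 2: "u \<le> \<bar>a - b\<bar> powr \<nu> \<and> v \<le> \<bar>a - b\<bar> powr \<nu>" if "sgn a \<noteq> sgn b"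
    using that assms by (auto simp: u_def v_def sgn_if split: if_splits intro!: powr_mono2)
  show ?thesis
  proof (cases "sgn a = sgn b")
    case True
    then have "\<bar>signed_powr i \<nu> a - signed_powr i \<nu> b\<bar> \<le> \<bar>u - v\<bar>"
      using False by (auto simp: signed_powr_def u_def v_def sgn_if split: if_splits)
    then show ?thesis using 1 nn by linarith
  next
    case sg: False
    have "\<bar>signed_powr i \<nu> a - signed_powr i \<nu> b\<bar> \<le> u + v"
    proof -
      have "\<bar>signed_powr i \<nu> x\<bar> \<le> \<bar>x\<bar> powr \<nu>" for x
        using False by (auto simp: signed_powr_def abs_mult sgn_if)
      from this[of a] this[of b] show ?thesis by (simp add: u_def v_def)
    qed
    then show ?thesis using 2[OF sg] by linarith
  qed
qed

lemma powr_lipschitz: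
  fixes s t r a :: real
  assumes "1 \<le> a" "0 \<le> s" "s \<le> t" "t \<le> r"
  shows "t powr a - s powr a \<le> a * r powr (a - 1) * (t - s)"
proof (cases "s = t")
  case False
  then have st: "s < t" using assms by auto
  have "\<exists>l z. s < z \<and> z < t \<and> ((\<lambda>x. x powr a) has_real_derivative l) (at z) \<and> t powr a - s powr a = (t - s) * l"
  proof (rule MVT[OF st])
    show "continuous_on {s..t} (\<lambda>x. x powr a)"
      using assms by (intro continuous_on_powr' continuous_intros) auto
    fix x assume "s < x" "x < t"
    then show "(\<lambda>x. x powr a) differentiable at x"
      using has_real_derivative_powr[of x a] assms real_differentiable_def by (metis order_le_less_trans)
  qed
  then obtain l z where z: "s < z" "z < t" "((\<lambda>x. x powr a) has_real_derivative l) (at z)"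
      "t powr a - s powr a = (t - s) * l" by blast
  have "l = a * z powr (a - 1)"
    using DERIV_unique[OF z(3) has_real_derivative_powr] z(1) assms(2) by linarith
  moreover have "z powr (a - 1) \<le> r powr (a - 1)"
    using z assms by (intro powr_mono2) auto
  ultimately have "t powr a - s powr a = (t - s) * (a * z powr (a - 1))" using z by simp
  also have "\<dots> \<le> (t - s) * (a * r powr (a - 1))"
    using st assms \<open>z powr (a - 1) \<le> r powr (a - 1)\<close> by (intro mult_left_mono) auto
  finally show ?thesis by (simp add: algebra_simps)
qed simp

text \<open>Across the origin |s| + |t| = |s - t|, so in contrast to exponents below 1 a sign change
  costs nothing. The bound later provides the dominating function for differentiation under the
  integral.\<close>

lemma signed_powr_lipschitz:
  assumes "1 \<le> a" "\<bar>s\<bar> \<le> r" "\<bar>t\<bar> \<le> r"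
  shows "\<bar>signed_powr i a s - signed_powr i a t\<bar> \<le> a * r powr (a - 1) * \<bar>s - t\<bar>"
proof -
  define C where "C = a * r powr (a - 1)"
  have C0: "0 \<le> C" using assms by (simp add: C_def)
  have le: "x powr a \<le> C * x" if "0 \<le> x" "x \<le> r" for x
    using powr_lipschitz[of a 0 x r] that assms by (simp add: C_def)
  have diff: "\<bar>\<bar>s\<bar> powr a - \<bar>t\<bar> powr a\<bar> \<le> C * \<bar>\<bar>s\<bar> - \<bar>t\<bar>\<bar>"
    using powr_lipschitz[of a "\<bar>s\<bar>" "\<bar>t\<bar>" r] powr_lipschitz[of a "\<bar>t\<bar>" "\<bar>s\<bar>" r] assms
      powr_mono2[of a "\<bar>s\<bar>" "\<bar>t\<bar>"] powr_mono2[of a "\<bar>t\<bar>" "\<bar>s\<bar>"]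
    by (cases "\<bar>s\<bar> \<le> \<bar>t\<bar>") (auto simp: C_def)
  show ?thesis
  proof (cases "sgn s = sgn t \<or> even i")
    case True
    then have "\<bar>signed_powr i a s - signed_powr i a t\<bar> \<le> \<bar>\<bar>s\<bar> powr a - \<bar>t\<bar> powr a\<bar>"
      using assms by (auto simp: signed_powr_def sgn_if split: if_splits)
    also have "\<dots> \<le> C * \<bar>\<bar>s\<bar> - \<bar>t\<bar>\<bar>" by (rule diff)
    also have "\<dots> \<le> C * \<bar>s - t\<bar>" using C0 by (intro mult_left_mono) auto
    finally show ?thesis by (simp add: C_def)
  next
    case False
    have "\<bar>signed_powr i a s - signed_powr i a t\<bar> \<le> \<bar>s\<bar> powr a + \<bar>t\<bar> powr a"
    proof -
      have "\<bar>signed_powr i a x\<bar> \<le> \<bar>x\<bar> powr a" for x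
        using assms by (auto simp: signed_powr_def abs_mult sgn_if)
      from this[of s] this[of t] show ?thesis by simp
    qed
    also have "\<dots> \<le> C * \<bar>s\<bar> + C * \<bar>t\<bar>" using le assms by (intro add_mono) auto
    also have "\<dots> = C * \<bar>s - t\<bar>" using False
      by (auto simp: sgn_if algebra_simps abs_if split: if_splits)
    finally show ?thesis by (simp add: C_def)
  qed
qed

lemma abs_powr_deriv_lipschitz:
  assumes "real i + 1 \<le> q" "\<bar>s\<bar> \<le> r" "\<bar>t\<bar> \<le> r"
  shows "\<bar>abs_powr_deriv q i s - abs_powr_deriv q i t\<bar>
           \<le> \<bar>\<Prod>j<i. q - real j\<bar> * ((q - i) * r powr (q - i - 1)) * \<bar>s - t\<bar>"
proof -
  have "\<bar>abs_powr_deriv q i s - abs_powr_deriv q i t\<bar>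
      = \<bar>\<Prod>j<i. q - real j\<bar> * \<bar>signed_powr i (q - i) s - signed_powr i (q - i) t\<bar>"
    by (simp add: abs_powr_deriv_def abs_mult flip: right_diff_distrib)
  also have "\<dots> \<le> \<bar>\<Prod>j<i. q - real j\<bar> * ((q - i) * r powr (q - i - 1) * \<bar>s - t\<bar>)"
    using assms signed_powr_lipschitz[of "q - i" s r t i] by (intro mult_left_mono) auto
  finally show ?thesis by (simp add: mult_ac)
qed

lemma continuous_on_abs_powr_deriv:
  assumes "real i + 1 \<le> q"
  shows "continuous_on A (abs_powr_deriv q i)"
proof -
  have "continuous_on {-r<..<r} (abs_powr_deriv q i)" for r
  proof -
    have "(\<bar>\<Prod>j<i. q - real j\<bar> * ((q - i) * r powr (q - i - 1)))-lipschitz_on {-r<..<r} (abs_powr_deriv q i)"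
      using abs_powr_deriv_lipschitz[OF assms, of _ r] assms
      by (intro lipschitz_onI) (auto simp: dist_real_def abs_if)
    then show ?thesis by (rule lipschitz_on_continuous_on)
  qed
  then have "isCont (abs_powr_deriv q i) x" for x
    by (rule continuous_on_interior[of "{-(\<bar>x\<bar>+1)<..<\<bar>x\<bar>+1}"]) (auto simp: interior_open)
  then show ?thesis by (simp add: continuous_at_imp_continuous_on)
qed

text \<open>The derivative may fail to exist at 0, so the mean value theorem is applied only to
  intervals that do not cross the origin, and an interval containing 0 inside is split there. In
  \<open>mv\<close> the slope is taken at any point \<open>c\<close> of an enclosing interval, so
  that both pieces can be compared with the same slope and added.\<close>

lemma first_order_holder_bound:
  fixes g g' :: "real \<Rightarrow> real"
  assumes cont: "continuous_on UNIV g"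
    and d: "\<And>t. t \<noteq> 0 \<Longrightarrow> (g has_real_derivative g' t) (at t)"
    and h: "\<And>s t. \<bar>g' s - g' t\<bar> \<le> K * \<bar>s - t\<bar> powr \<nu>"
    and "0 \<le> \<nu>" "0 \<le> K"
  shows "\<bar>g b - g a - (b - a) * g' a\<bar> \<le> K * \<bar>b - a\<bar> powr (\<nu> + 1)"
proof -
  have mv: "\<bar>g v - g u - (v - u) * g' c\<bar> \<le> K * (hi - lo) powr \<nu> * (v - u)"
    if "lo \<le> u" "u \<le> v" "v \<le> hi" "lo \<le> c" "c \<le> hi" "0 \<le> u \<or> v \<le> 0" for u v c lo hi
  proof (cases "u = v")
    case False
    then have uv: "u < v" using that by auto
    have "\<exists>l z. u < z \<and> z < v \<and> (g has_real_derivative l) (at z) \<and> g v - g u = (v - u) * l"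
    proof (rule MVT[OF uv])
      show "continuous_on {u..v} g" using cont continuous_on_subset by blast
      fix x assume "u < x" "x < v"
      then have "x \<noteq> 0" using that by auto
      then show "g differentiable at x" using d real_differentiable_def by blast
    qed
    then obtain l z where z: "u < z" "z < v" "(g has_real_derivative l) (at z)" "g v - g u = (v - u) * l"
      by blast
    then have "l = g' z" using that d[of z] DERIV_unique by force
    then have "\<bar>g v - g u - (v - u) * g' c\<bar> = (v - u) * \<bar>g' z - g' c\<bar>"
      using z uv by (simp flip: right_diff_distrib add: abs_mult)
    also have "\<dots> \<le> (v - u) * (K * (hi - lo) powr \<nu>)"
    proof (intro mult_left_mono order_trans[OF h])
      show "\<bar>z - c\<bar> powr \<nu> \<le> (hi - lo) powr \<nu>"
        using assms z that by (intro powr_mono2) auto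
    qed (use assms uv in auto)
    finally show ?thesis by (simp add: mult_ac)
  qed simp
  have main: "\<bar>g v - g u - (v - u) * g' c\<bar> \<le> K * (v - u) powr \<nu> * (v - u)"
    if "u \<le> c" "c \<le> v" for u v c
  proof (cases "0 \<le> u \<or> v \<le> 0")
    case True
    then show ?thesis using mv[of u u v v c] that by auto
  next
    case False
    have "g v - g u - (v - u) * g' c = (g v - g 0 - (v - 0) * g' c) + (g 0 - g u - (0 - u) * g' c)"
      by (simp add: algebra_simps)
    moreover have "\<bar>g v - g 0 - (v - 0) * g' c\<bar> \<le> K * (v - u) powr \<nu> * (v - 0)"
      using mv[of u 0 v v c] that False by auto
    moreover have "\<bar>g 0 - g u - (0 - u) * g' c\<bar> \<le> K * (v - u) powr \<nu> * (0 - u)"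
      using mv[of u u 0 v c] that False by auto
    ultimately have "\<bar>g v - g u - (v - u) * g' c\<bar>
        \<le> K * (v - u) powr \<nu> * (v - 0) + K * (v - u) powr \<nu> * (0 - u)" by linarith
    then show ?thesis by (simp add: algebra_simps)
  qed
  have "\<bar>g b - g a - (b - a) * g' a\<bar> \<le> K * \<bar>b - a\<bar> powr \<nu> * \<bar>b - a\<bar>"
  proof (cases "a \<le> b")
    case True
    then show ?thesis using main[of a a b] by simp
  next
    case False
    have "\<bar>g b - g a - (b - a) * g' a\<bar> = \<bar>g a - g b - (a - b) * g' a\<bar>"
      by (subst abs_minus_commute) (simp add: algebra_simps)
    then show ?thesis using main[of b a a] False by simp
  qed
  then show ?thesis using assms by (cases "b = a") (auto simp: powr_add mult_ac)
qed

lemma prod_falling_eq_C_const: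
  assumes "q = real p + \<nu>"
  shows "(\<Prod>j<p. q - real j) = (\<Prod>i=1..p. \<nu> + real i)"
  by (rule prod.reindex_bij_witness[of _ "\<lambda>i. p - i" "\<lambda>j. p - j"]) (auto simp: assms of_nat_diff)

text \<open>The right side depends on b - a only, not on the base point; this uniformity is what
  survives integration over \<omega>. The derivative of order p is Hoelder continuous but possibly
  not the derivative of its predecessor at 0, hence the detour through a first-order expansion of
  the derivative of order p - 1.\<close>

lemma abs_powr_taylor:
  fixes p :: nat and \<nu> :: real
  assumes "2 \<le> p" "0 \<le> \<nu>" "\<nu> \<le> 1" and q: "q = real p + \<nu>"
  shows "\<bar>abs_powr_deriv q 1 b - (\<Sum>i=1..p. abs_powr_deriv q i a * (b - a) ^ (i - 1) / fact (i - 1))\<bar>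
           \<le> C_const p \<nu> / fact (p - 1) * \<bar>b - a\<bar> powr (q - 1)"
proof -
  define n where "n = p - 2"
  have p: "p = Suc (Suc n)" using assms by (simp add: n_def)
  have C: "C_const p \<nu> = 2 * (\<Prod>j<p. q - real j)"
    unfolding C_const_def prod_falling_eq_C_const[OF q] ..
  have pr0: "0 \<le> (\<Prod>j<p. q - real j)" using assms by (intro prod_nonneg) auto
  have "\<bar>abs_powr_deriv q p s - abs_powr_deriv q p t\<bar> \<le> C_const p \<nu> * \<bar>s - t\<bar> powr \<nu>" for s t
  proof -
    have "\<bar>abs_powr_deriv q p s - abs_powr_deriv q p t\<bar>
       = (\<Prod>j<p. q - real j) * \<bar>signed_powr p \<nu> s - signed_powr p \<nu> t\<bar>"
      using pr0 by (simp add: abs_powr_deriv_def q abs_mult flip: right_diff_distrib)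
    also have "\<dots> \<le> (\<Prod>j<p. q - real j) * (2 * \<bar>s - t\<bar> powr \<nu>)"
      using pr0 assms by (intro mult_left_mono signed_powr_holder) auto
    finally show ?thesis by (simp add: C)
  qed
  moreover have "(abs_powr_deriv q (Suc n) has_real_derivative abs_powr_deriv q p t) (at t)" if "t \<noteq> 0" for t
    using has_derivative_abs_powr_deriv[of "Suc n" q t] assms p that by simp
  moreover have "continuous_on UNIV (abs_powr_deriv q (Suc n))"
    using assms p by (intro continuous_on_abs_powr_deriv) auto
  moreover have C0: "0 \<le> C_const p \<nu>" using C pr0 by simp
  ultimately have top: "\<bar>abs_powr_deriv q (Suc n) t - abs_powr_deriv q (Suc n) a - (t - a) * abs_powr_deriv q p a\<bar>
      \<le> C_const p \<nu> * \<bar>t - a\<bar> powr (\<nu> + 1)" for t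
    using first_order_holder_bound[of "abs_powr_deriv q (Suc n)" "abs_powr_deriv q p"] assms by blast
  have "\<bar>abs_powr_deriv q (Suc 0) b - (\<Sum>i\<le>Suc n. abs_powr_deriv q (Suc i) a * (b - a) ^ i / fact i)\<bar>
           \<le> C_const p \<nu> * \<bar>b - a\<bar> powr (\<nu> + 1 + n) / fact (Suc n)"
  proof (rule taylor_holder_bound[where G = "\<lambda>i. abs_powr_deriv q (Suc i)"])
    fix i t assume "i < n"
    then show "(abs_powr_deriv q (Suc i) has_real_derivative abs_powr_deriv q (Suc (Suc i)) t) (at t)"
      using assms p by (intro has_derivative_abs_powr_deriv) auto
  qed (use top p C0 assms in auto)
  moreover have "(\<Sum>i\<le>Suc n. abs_powr_deriv q (Suc i) a * (b - a) ^ i / fact i)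
      = (\<Sum>i=1..p. abs_powr_deriv q i a * (b - a) ^ (i - 1) / fact (i - 1))"
    by (rule sum.reindex_bij_witness[of _ "\<lambda>i. i - 1" Suc]) (auto simp: p)
  moreover have "\<nu> + 1 + n = q - 1" using p q by simp
  moreover have "fact (Suc n) = (fact (p - 1) :: real)" by (simp only: p diff_Suc_1)
  ultimately show ?thesis by (simp only: times_divide_eq_left One_nat_def)
qed

section \<open>Finite-dimensional spaces with an energy norm\<close>

text \<open>A gradient is given as a function on the whole ambient space but behaves linearly only
  on \<open>E\<close>, so \<open>linear\<close> would ask too much.\<close>

definition linear_functional_on :: "'a::real_vector set \<Rightarrow> ('a \<Rightarrow> real) \<Rightarrow> bool" where
  "linear_functional_on E s \<longleftrightarrow>
     (\<forall>x\<in>E. \<forall>y\<in>E. s (x + y) = s x + s y) \<and> (\<forall>c. \<forall>x\<in>E. s (c *\<^sub>R x) = c * s x)"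

lemma linear_functional_on_sum:
  assumes "linear_functional_on E s" "subspace E" "finite I" "\<And>i. i \<in> I \<Longrightarrow> v i \<in> E"
  shows "s (\<Sum>i\<in>I. c i *\<^sub>R v i) = (\<Sum>i\<in>I. c i * s (v i))"
  using assms(3,4)
proof (induction I rule: finite_induct)
  case empty
  have "s (0 *\<^sub>R 0) = 0 * s 0"
    using assms(1,2) unfolding linear_functional_on_def by (meson subspace_0)
  then show ?case by simp
next
  case (insert i I)
  have "s (c i *\<^sub>R v i + (\<Sum>i\<in>I. c i *\<^sub>R v i)) = s (c i *\<^sub>R v i) + s (\<Sum>i\<in>I. c i *\<^sub>R v i)"
  proof -
    have "(\<Sum>i\<in>I. c i *\<^sub>R v i) \<in> E" "c i *\<^sub>R v i \<in> E"
      using assms(2) insert.prems by (auto intro!: subspace_sum subspace_scale)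
    then show ?thesis using assms(1) unfolding linear_functional_on_def by blast
  qed
  then show ?case using insert assms(1) by (auto simp: linear_functional_on_def)
qed

locale energy_space =
  fixes E :: "'a::real_normed_vector set" and B :: "'a \<Rightarrow> 'a \<Rightarrow> real"
  assumes subspace_E: "subspace E" and fin_dim: "\<exists>b. finite b \<and> E = span b"
    and pos_def: "pos_def_selfadjoint_on E B"
begin

lemmas E_closed [simp, intro] =
  subspace_0[OF subspace_E] subspace_add[OF subspace_E] subspace_diff[OF subspace_E]
  subspace_scale[OF subspace_E] subspace_neg[OF subspace_E]

lemma bilinear_B: "bilinear B"
  using pos_def by (simp add: pos_def_selfadjoint_on_def)

lemmas B_simps = bilinear_ladd[OF bilinear_B] bilinear_radd[OF bilinear_B]
  bilinear_lsub[OF bilinear_B] bilinear_rsub[OF bilinear_B]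
  bilinear_lmul[OF bilinear_B] bilinear_rmul[OF bilinear_B]
  bilinear_lzero[OF bilinear_B] bilinear_rzero[OF bilinear_B]
  bilinear_lneg[OF bilinear_B] bilinear_rneg[OF bilinear_B]

lemma B_commute: "x \<in> E \<Longrightarrow> y \<in> E \<Longrightarrow> B x y = B y x"
  using pos_def by (auto simp: pos_def_selfadjoint_on_def)

lemma B_pos: "x \<in> E \<Longrightarrow> x \<noteq> 0 \<Longrightarrow> 0 < B x x"
  using pos_def by (auto simp: pos_def_selfadjoint_on_def)

lemma B_nonneg [simp]: "x \<in> E \<Longrightarrow> 0 \<le> B x x"
  using B_pos[of x] by (cases "x = 0") (auto simp: B_simps)

abbreviation nrm :: "'a \<Rightarrow> real" where "nrm \<equiv> bnorm B"

lemma nrm_sq: "x \<in> E \<Longrightarrow> (nrm x)\<^sup>2 = B x x"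
  by (simp add: bnorm_def)

lemma nrm_nonneg [simp]: "x \<in> E \<Longrightarrow> 0 \<le> nrm x"
  by (simp add: bnorm_def)

lemma nrm_zero [simp]: "nrm 0 = 0"
  by (simp add: bnorm_def B_simps)

lemma nrm_pos: "x \<in> E \<Longrightarrow> x \<noteq> 0 \<Longrightarrow> 0 < nrm x"
  using B_pos[of x] by (auto simp: bnorm_def)

lemma nrm_scale: "nrm (c *\<^sub>R x) = \<bar>c\<bar> * nrm x"
  by (simp add: bnorm_def B_simps real_sqrt_mult real_sqrt_mult_self flip: mult.assoc power2_eq_square)

lemma nrm_minus_commute: "nrm (x - y) = nrm (y - x)"
  using nrm_scale[of "-1" "x - y"] by simp

text \<open>Gram-Schmidt; a vector whose remainder after projection vanishes is dropped. The
  cardinality bound is what lets the span of four vectors fit into R^4.\<close>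

lemma orthonormal_basis_exists:
  assumes "finite S" "S \<subseteq> E"
  obtains Q where "finite Q" "card Q \<le> card S" "Q \<subseteq> E" "span Q = span S"
    "\<And>e e'. e \<in> Q \<Longrightarrow> e' \<in> Q \<Longrightarrow> B e e' = (if e = e' then 1 else 0)"
proof -
  have "\<exists>Q. finite Q \<and> card Q \<le> card S \<and> Q \<subseteq> E \<and> span Q = span S \<and>
      (\<forall>e\<in>Q. \<forall>e'\<in>Q. B e e' = (if e = e' then 1 else 0))"
    using assms
  proof (induction S rule: finite_induct)
    case empty
    then show ?case by (intro exI[of _ "{}"]) auto
  next
    case (insert a S)
    then obtain Q where Q: "finite Q" "card Q \<le> card S" "Q \<subseteq> E" "span Q = span S"
      "\<And>e e'. e \<in> Q \<Longrightarrow> e' \<in> Q \<Longrightarrow> B e e' = (if e = e' then 1 else 0)" by auto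
    have aE: "a \<in> E" using insert by auto
    define w where "w = (\<Sum>e\<in>Q. B a e *\<^sub>R e)"
    have wO: "w \<in> span Q" unfolding w_def by (intro span_sum span_scale span_base)
    have wE: "w \<in> E" unfolding w_def using Q by (intro subspace_sum subspace_E) auto
    define a' where "a' = a - w"
    have a'E: "a' \<in> E" using aE wE by (auto simp: a'_def)
    have orth: "B e a' = 0" if "e \<in> Q" for e
    proof -
      have lin: "linear (B e)" using bilinear_B by (simp add: bilinear_def)
      have "B e w = (\<Sum>e'\<in>Q. B a e' * B e e')"
        unfolding w_def by (simp add: linear_sum[OF lin] B_simps)
      also have "\<dots> = (\<Sum>e'\<in>Q. if e = e' then B a e' else 0)"
        by (intro sum.cong) (auto simp: Q(5) that)
      also have "\<dots> = B a e" using Q(1) that by simp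
      finally show ?thesis using B_commute[of a e] aE that Q by (auto simp: a'_def B_simps)
    qed
    show ?case
    proof (cases "a' = 0")
      case True
      then have "a \<in> span S" using wO Q by (simp add: a'_def)
      then have "span (insert a S) = span S" by (simp add: span_redundant)
      then show ?thesis using Q insert by (intro exI[of _ Q]) auto
    next
      case False
      define e0 where "e0 = a' /\<^sub>R nrm a'"
      have n0: "nrm a' \<noteq> 0" using False a'E nrm_pos by force
      have e0E: "e0 \<in> E" using a'E by (auto simp: e0_def)
      have e0e0: "B e0 e0 = 1"
        using n0 nrm_sq[OF a'E] 
        by (simp add: e0_def B_simps flip: nrm_sq[OF a'E]) (use n0 in \<open>simp add: power2_eq_square field_simps\<close>)
      have orth0: "B e e0 = 0" "B e0 e = 0" if "e \<in> Q" for e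
        using orth[OF that] B_commute[of e e0] e0E that Q(3) by (auto simp: e0_def B_simps)
      then have nin: "e0 \<notin> Q" using e0e0 by fastforce
      have e0S: "e0 \<in> span (insert a S)"
        unfolding e0_def a'_def using wO Q(4)
        by (intro span_scale span_diff) (auto intro: span_base span_mono[THEN subsetD, of S])
      have aQ: "a \<in> span (insert e0 Q)"
      proof -
        have "a = nrm a' *\<^sub>R e0 + w" using n0 by (simp add: e0_def a'_def)
        moreover have "nrm a' *\<^sub>R e0 + w \<in> span (insert e0 Q)"
          using wO by (intro span_add span_scale) (auto intro: span_base span_mono[THEN subsetD, of Q])
        ultimately show ?thesis by simp
      qed
      have "span (insert e0 Q) = span (insert a S)"
      proof (rule span_eq[THEN iffD2], intro conjI insert_subsetI e0S aQ)
        show "Q \<subseteq> span (insert a S)"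
          using Q(4) span_superset[of Q] span_mono[of S "insert a S"] by auto
        show "S \<subseteq> span (insert e0 Q)"
          using Q(4) span_superset[of S] span_mono[of Q "insert e0 Q"] by auto
      qed
      then show ?thesis using Q insert nin e0E e0e0 orth0
        by (intro exI[of _ "insert e0 Q"]) auto
    qed
  qed
  then show thesis using that by blast
qed

lemma orthonormal_expansion:
  assumes "finite Q" "Q \<subseteq> E" "\<And>e e'. e \<in> Q \<Longrightarrow> e' \<in> Q \<Longrightarrow> B e e' = (if e = e' then 1 else 0)"
    and "z \<in> span Q"
  shows "z = (\<Sum>e\<in>Q. B e z *\<^sub>R e)"
proof -
  obtain c where z: "z = (\<Sum>e\<in>Q. c e *\<^sub>R e)"
    using assms(4) span_finite[OF assms(1)] by auto
  have "B e z = c e" if "e \<in> Q" for e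
  proof -
    have lin: "linear (B e)" using bilinear_B by (simp add: bilinear_def)
    have "B e z = (\<Sum>e'\<in>Q. c e' * B e e')" by (simp add: z linear_sum[OF lin] B_simps)
    also have "\<dots> = (\<Sum>e'\<in>Q. if e = e' then c e' else 0)"
      by (intro sum.cong) (auto simp: assms(3) that)
    finally show ?thesis using assms(1) that by simp
  qed
  then show ?thesis using z by simp
qed

lemma B_cauchy_schwarz: assumes "x \<in> E" "y \<in> E" shows "\<bar>B x y\<bar> \<le> nrm x * nrm y"
proof (cases "y = 0")
  case False
  have p: "0 < B y y" using B_pos assms False by auto
  have "0 \<le> B (B y y *\<^sub>R x - B x y *\<^sub>R y) (B y y *\<^sub>R x - B x y *\<^sub>R y)"
    using assms by (intro B_nonneg) auto
  also have "\<dots> = B y y * (B x x * B y y - (B x y)\<^sup>2)"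
    using B_commute[of x y] assms by (simp add: B_simps algebra_simps power2_eq_square)
  finally have "(B x y)\<^sup>2 \<le> B x x * B y y" using p by (simp add: zero_le_mult_iff)
  then have "\<bar>B x y\<bar> \<le> sqrt (B x x * B y y)" by (simp add: real_le_rsqrt)
  then show ?thesis by (simp add: bnorm_def real_sqrt_mult)
qed (simp add: B_simps)

text \<open>\<open>L\<close> records the coordinates along an orthonormal basis of the span, so it
  is the orthogonal projection followed by an isometry. This is why only one of the two arguments
  has to lie in the span.\<close>

lemma isometry_into_Rn:
  assumes "finite S" "S \<subseteq> E" "card S \<le> CARD('n)"
  obtains L :: "'a \<Rightarrow> real ^ 'n" where "linear L"
    "\<And>z z'. z \<in> span S \<Longrightarrow> z' \<in> E \<Longrightarrow> L z \<bullet> L z' = B z z'"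
proof -
  obtain Q where Q: "finite Q" "card Q \<le> card S" "Q \<subseteq> E" "span Q = span S"
    "\<And>e e'. e \<in> Q \<Longrightarrow> e' \<in> Q \<Longrightarrow> B e e' = (if e = e' then 1 else 0)"
    using orthonormal_basis_exists[OF assms(1,2)] by metis
  obtain \<iota> :: "'a \<Rightarrow> 'n" where \<iota>: "inj_on \<iota> Q"
    using inj_on_iff_card_le[of Q "UNIV :: 'n set"] Q assms by fastforce
  define L :: "'a \<Rightarrow> real ^ 'n" where "L z = (\<Sum>e\<in>Q. B e z *\<^sub>R axis (\<iota> e) 1)" for z
  have "linear L"
    by (rule linearI) (simp_all add: L_def B_simps scaleR_add_left sum.distrib scaleR_sum_right)
  moreover have "L z \<bullet> L z' = B z z'" if "z \<in> span S" "z' \<in> E" for z z'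
  proof -
    have lin: "linear (\<lambda>x. B x z')" using bilinear_B by (simp add: bilinear_def)
    have "L z \<bullet> L z' = (\<Sum>e\<in>Q. \<Sum>e'\<in>Q. B e z * B e' z' * (axis (\<iota> e) 1 \<bullet> (axis (\<iota> e') 1 :: real ^ 'n)))"
      by (simp add: L_def inner_sum_left inner_sum_right sum_distrib_left mult_ac)
        (subst sum.swap, simp add: mult_ac inner_commute)
    also have "\<dots> = (\<Sum>e\<in>Q. \<Sum>e'\<in>Q. if e = e' then B e z * B e' z' else 0)"
      using \<iota> by (intro sum.cong refl) (auto simp: inner_axis_axis inj_on_def)
    also have "\<dots> = (\<Sum>e\<in>Q. B e z * B e z')" using Q(1) by simp
    also have "\<dots> = B (\<Sum>e\<in>Q. B e z *\<^sub>R e) z'"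
      by (simp add: linear_sum[OF lin] B_simps)
    also have "\<dots> = B z z'"
      using orthonormal_expansion[OF Q(1,3,5), of z] that Q(4) by simp
    finally show ?thesis .
  qed
  ultimately show thesis using that by blast
qed

text \<open>The coordinates of \<open>u\<close> in an orthonormal basis are the values of
  \<open>s\<close> on it. Uniqueness of \<open>u\<close> evaluates the description inside
  \<open>dual_norm\<close>.\<close>

lemma riesz:
  assumes "linear_functional_on E s"
  obtains u where "u \<in> E" "\<And>h. h \<in> E \<Longrightarrow> B u h = s h" "dual_norm E B s = nrm u"
proof -
  obtain b where b: "finite b" "E = span b" using fin_dim by blast
  obtain Q where Q: "finite Q" "Q \<subseteq> E" "span Q = span b"
    "\<And>e e'. e \<in> Q \<Longrightarrow> e' \<in> Q \<Longrightarrow> B e e' = (if e = e' then 1 else 0)"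
    using orthonormal_basis_exists[OF b(1)] b span_superset by metis
  define u where "u = (\<Sum>e\<in>Q. s e *\<^sub>R e)"
  have uE: "u \<in> E" unfolding u_def using Q by (intro subspace_sum subspace_E) auto
  have u: "B u h = s h" if "h \<in> E" for h
  proof -
    have lin: "linear (\<lambda>x. B x h)" using bilinear_B by (simp add: bilinear_def)
    have h: "h = (\<Sum>e\<in>Q. B e h *\<^sub>R e)"
      using orthonormal_expansion[OF Q(1,2,4)] that b Q(3) by blast
    have "B u h = (\<Sum>e\<in>Q. s e * B e h)"
      by (simp add: u_def linear_sum[OF lin] B_simps)
    also have "\<dots> = s (\<Sum>e\<in>Q. B e h *\<^sub>R e)"
      using Q by (subst linear_functional_on_sum[OF assms subspace_E]) (auto simp: mult.commute)
    finally show ?thesis using h by simp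
  qed
  have "(THE u. u \<in> E \<and> (\<forall>h\<in>E. B u h = s h)) = u"
  proof (rule the_equality)
    fix u' assume u': "u' \<in> E \<and> (\<forall>h\<in>E. B u' h = s h)"
    then have "B (u' - u) (u' - u) = 0" using u uE by (simp add: B_simps)
    then show "u' = u" using B_pos[of "u' - u"] u' uE by force
  qed (use u uE in auto)
  then have "dual_norm E B s = nrm u" using u[OF uE] by (simp add: dual_norm_def bnorm_def)
  then show thesis using that u uE by blast
qed

lemma dual_norm_bound:
  assumes "linear_functional_on E s" "h \<in> E"
  shows "\<bar>s h\<bar> \<le> dual_norm E B s * nrm h"
proof -
  from riesz[OF assms(1)] obtain u where "u \<in> E" "\<And>h. h \<in> E \<Longrightarrow> B u h = s h" "dual_norm E B s = nrm u"
    by blast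
  then show ?thesis using B_cauchy_schwarz[of u h] assms by simp
qed

lemma dual_norm_le:
  assumes "linear_functional_on E s" "\<And>h. h \<in> E \<Longrightarrow> s h \<le> c * nrm h" "0 \<le> c"
  shows "dual_norm E B s \<le> c"
proof -
  from riesz[OF assms(1)] obtain u where u: "u \<in> E" "\<And>h. h \<in> E \<Longrightarrow> B u h = s h" "dual_norm E B s = nrm u"
    by blast
  have "(nrm u)\<^sup>2 \<le> c * nrm u" using assms(2)[of u] u by (simp add: nrm_sq)
  then have "nrm u \<le> c" using assms(3) nrm_nonneg[OF u(1)]
    by (cases "nrm u = 0") (auto simp: power2_eq_square)
  then show ?thesis using u by simp
qed

end

section \<open>The Euclidean norm as an average of one-dimensional powers\<close>

text \<open>Linear change of variables: the ball is mapped onto itself and the determinant has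
  absolute value 1.\<close>

lemma integral_orthogonal_transformation_cball:
  fixes f :: "real ^ 'n::{finite,wellorder} \<Rightarrow> real" and T :: "real ^ 'n::_ \<Rightarrow> real ^ 'n::_"
  assumes T: "orthogonal_transformation T" and f: "continuous_on UNIV f"
  shows "integral (cball 0 r) (\<lambda>x. f (T x)) = integral (cball 0 r) f"
proof -
  have lin: "linear T" using T by (rule orthogonal_transformation_linear)
  have det: "\<bar>det (matrix T)\<bar> = 1"
    using T by simp
  have img: "T ` cball 0 r = cball 0 r"
    using image_orthogonal_transformation_cball[OF T, of 0 r] lin by (simp add: linear_0)
  \<comment> \<open>The change of variables rule speaks of functions with values in a Cartesian
    space, so \<open>f\<close> is wrapped as a vector of length one.\<close>
  define g where "g x = (vec (f x) :: real ^ 1)" for x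
  have g: "continuous_on UNIV g"
    unfolding g_def vec_def using f by (intro continuous_on_vec_lambda)
  have int: "g absolutely_integrable_on cball 0 r"
  proof -
    have "integrable lborel (\<lambda>x. indicator (cball 0 r) x *\<^sub>R g x)"
      by (intro borel_integrable_compact continuous_on_subset[OF g]) auto
    then show ?thesis unfolding set_integrable_def
      using integrable_completion borel_measurable_integrable by blast
  qed
  have eq: "integral (cball 0 r) (\<lambda>x. g (T x)) = integral (cball 0 r) g"
    and intT: "(\<lambda>x. g (T x)) absolutely_integrable_on cball 0 r"
    using has_absolute_integral_change_of_variables_linear[OF lin, of "cball 0 r" g "integral (cball 0 r) g"]
      int det img by simp_all
  have "integral (cball 0 r) (\<lambda>x. g (T x) $ 1) = integral (cball 0 r) (\<lambda>x. g x $ 1)"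
    using integral_component_eq_cart[OF set_lebesgue_integral_eq_integral(1)[OF int], of 1]
      integral_component_eq_cart[OF set_lebesgue_integral_eq_integral(1)[OF intT], of 1] eq by simp
  then show ?thesis by (simp add: g_def)
qed

text \<open>\<open>M\<close> is Lebesgue measure on the unit ball, divided by the q-th moment
  \<open>J e\<close> of a unit vector. By rotation invariance and homogeneity the q-th moment of x
  is the q-th power of its norm times \<open>J e\<close>, so the normalisation makes it
  exact.\<close>

lemma norm_powr_measure_exists:
  fixes q :: real
  assumes "0 < q"
  obtains M :: "(real ^ 4) measure" where "finite_measure M" "sets M = sets borel"
    "AE \<omega> in M. norm \<omega> \<le> 1" "\<And>x. x \<noteq> 0 \<Longrightarrow> AE \<omega> in M. x \<bullet> \<omega> \<noteq> 0"
    "\<And>x. (\<integral>\<omega>. \<bar>x \<bullet> \<omega>\<bar> powr q \<partial>M) = norm x powr q"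
proof -
  define Cb :: "(real ^ 4) set" where "Cb = cball 0 1"
  define J where "J x = integral Cb (\<lambda>\<omega>. \<bar>x \<bullet> \<omega>\<bar> powr q)" for x
  have cont: "continuous_on A (\<lambda>\<omega>. \<bar>x \<bullet> \<omega>\<bar> powr q)" for A and x :: "real ^ 4"
    using assms by (intro continuous_on_powr' continuous_intros) auto
  have ae: "AE \<omega> in lborel. x \<bullet> \<omega> \<noteq> 0" if "x \<noteq> 0" for x :: "real ^ 4"
  proof -
    have "negligible {\<omega>. x \<bullet> \<omega> = 0}" using that by (intro negligible_hyperplane) auto
    then have "AE \<omega> in lebesgue. \<omega> \<notin> {\<omega>. x \<bullet> \<omega> = 0}"
      by (metis AE_not_in negligible_iff_null_sets)
    then have "AE \<omega> in lebesgue. x \<bullet> \<omega> \<noteq> 0" by simp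
    then show ?thesis by (simp add: AE_completion_iff)
  qed
  have bor: "integrable lborel (\<lambda>\<omega>. indicator Cb \<omega> * \<bar>x \<bullet> \<omega>\<bar> powr q)" for x :: "real ^ 4"
    using borel_integrable_compact[of Cb "\<lambda>\<omega>. \<bar>x \<bullet> \<omega>\<bar> powr q"] cont by (simp add: Cb_def)
  have J: "J x = (\<integral>\<omega>. indicator Cb \<omega> * \<bar>x \<bullet> \<omega>\<bar> powr q \<partial>lborel)" for x
    using set_borel_integral_eq_integral(2)[of Cb "\<lambda>\<omega>. \<bar>x \<bullet> \<omega>\<bar> powr q"] bor[of x]
    by (simp add: J_def set_integrable_def set_lebesgue_integral_def)
  define e :: "real ^ 4" where "e = axis 1 1"
  have ne: "norm e = 1" by (simp add: e_def)
  have scale: "J x = norm x powr q * J e" for x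
  proof -
    obtain T where T: "orthogonal_transformation T" "T (norm x *\<^sub>R e) = x"
      using orthogonal_transformation_exists[of "norm x *\<^sub>R e" x] ne by auto
    have "J x = integral Cb (\<lambda>\<omega>. \<bar>x \<bullet> T \<omega>\<bar> powr q)"
      unfolding J_def Cb_def
      by (rule integral_orthogonal_transformation_cball[OF T(1) cont, symmetric])
    also have "\<dots> = integral Cb (\<lambda>\<omega>. norm x powr q * \<bar>e \<bullet> \<omega>\<bar> powr q)"
    proof (rule Henstock_Kurzweil_Integration.integral_cong)
      fix \<omega>
      have "x \<bullet> T \<omega> = T (norm x *\<^sub>R e) \<bullet> T \<omega>" by (simp only: T(2))
      also have "\<dots> = norm x * (e \<bullet> \<omega>)" using T(1) unfolding orthogonal_transformation_def by simp
      finally show "\<bar>x \<bullet> T \<omega>\<bar> powr q = norm x powr q * \<bar>e \<bullet> \<omega>\<bar> powr q"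
        by (simp add: abs_mult powr_mult)
    qed
    finally show ?thesis by (simp add: J_def)
  qed
  have Jpos: "0 < J e"
  proof -
    \<comment> \<open>If the moment vanished, the ball would lie, up to a null set, in the
      hyperplane orthogonal to \<open>e\<close>, although it has positive volume.\<close>
    have "J e \<noteq> 0"
    proof
      assume "J e = 0"
      then have "AE \<omega> in lborel. indicator Cb \<omega> * \<bar>e \<bullet> \<omega>\<bar> powr q = 0"
        using integral_nonneg_eq_0_iff_AE[OF bor[of e]] J by simp
      moreover have "AE \<omega> in lborel. e \<bullet> \<omega> \<noteq> 0" using ae[of e] ne by force
      ultimately have "AE \<omega> in lborel. \<omega> \<notin> Cb"
        by eventually_elim (auto simp: indicator_def)
      then have "emeasure lborel Cb = 0"
        using AE_iff_null_sets[of Cb lborel] by (auto simp: Cb_def)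
      moreover have "0 < emeasure lborel Cb"
        unfolding Cb_def by (simp add: emeasure_cball unit_ball_vol_pos)
      ultimately show False by simp
    qed
    moreover have "0 \<le> J e" unfolding J by (intro integral_nonneg_AE) auto
    ultimately show ?thesis by simp
  qed
  define M where "M = density lborel (\<lambda>\<omega>. ennreal (indicator Cb \<omega> / J e))"
  have mc: "(\<lambda>\<omega>. indicator Cb \<omega> / J e) \<in> borel_measurable lborel"
    unfolding Cb_def by (intro borel_measurable_divide borel_measurable_indicator) auto
  have mcE: "(\<lambda>\<omega>. ennreal (indicator Cb \<omega> / J e)) \<in> borel_measurable lborel"
    using mc by (rule measurable_compose) simp
  show thesis
  proof (rule that)
    show "finite_measure M"
    proof
      have "emeasure M (space M) = (\<integral>\<^sup>+\<omega>. ennreal (1 / J e) * indicator Cb \<omega> \<partial>lborel)"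
        unfolding M_def by (subst emeasure_density[OF mcE])
          (auto simp: indicator_def intro!: nn_integral_cong)
      also have "\<dots> = ennreal (1 / J e) * emeasure lborel Cb"
        by (simp add: nn_integral_cmult_indicator Cb_def)
      also have "\<dots> < \<infinity>"
        using emeasure_bounded_finite[of Cb] by (simp add: Cb_def ennreal_mult_less_top)
      finally show "emeasure M (space M) \<noteq> \<infinity>" by simp
    qed
    show "sets M = sets borel" by (simp add: M_def)
    show "AE \<omega> in M. norm \<omega> \<le> 1"
      unfolding M_def by (subst AE_density[OF mcE]) (auto simp: Cb_def indicator_def)
    show "AE \<omega> in M. x \<bullet> \<omega> \<noteq> 0" if "x \<noteq> 0" for x
      unfolding M_def using ae[OF that] by (subst AE_density[OF mcE]) auto
    show "(\<integral>\<omega>. \<bar>x \<bullet> \<omega>\<bar> powr q \<partial>M) = norm x powr q" for x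
    proof -
      have "(\<integral>\<omega>. \<bar>x \<bullet> \<omega>\<bar> powr q \<partial>M) = (\<integral>\<omega>. (indicator Cb \<omega> / J e) * \<bar>x \<bullet> \<omega>\<bar> powr q \<partial>lborel)"
        unfolding M_def using Jpos
        by (subst integral_real_density[OF mc]) auto
      also have "\<dots> = (\<integral>\<omega>. (indicator Cb \<omega> * \<bar>x \<bullet> \<omega>\<bar> powr q) / J e \<partial>lborel)" by simp
      also have "\<dots> = J x / J e" unfolding J by (rule integral_divide_zero)
      finally show ?thesis using scale[of x] Jpos by simp
    qed
  qed
qed

section \<open>Derivatives of the norm power as integrals\<close>

lemma abs_powr_deriv_borel_measurable [measurable]: "abs_powr_deriv q i \<in> borel_measurable borel"
proof -
  have "signed_powr i a \<in> borel_measurable borel" for a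
    by (cases "a = 0"; cases "even i") (auto simp: signed_powr_def[abs_def])
  then show ?thesis unfolding abs_powr_deriv_def[abs_def] by measurable
qed

lemma abs_abs_powr_deriv_le:
  "real i \<le> q \<Longrightarrow> \<bar>t\<bar> \<le> r \<Longrightarrow> 1 \<le> r \<Longrightarrow> \<bar>abs_powr_deriv q i t\<bar> \<le> \<bar>\<Prod>j<i. q - real j\<bar> * r powr (q - i)"
  unfolding abs_powr_deriv_def abs_mult by (intro mult_left_mono abs_signed_powr_le) auto

locale norm_powr_measure =
  fixes M :: "(real ^ 4) measure" and q :: real
  assumes fin: "finite_measure M" and sets_M [measurable_cong]: "sets M = sets borel"
    and ball: "AE \<omega> in M. norm \<omega> \<le> 1" and nz: "\<And>x. x \<noteq> 0 \<Longrightarrow> AE \<omega> in M. x \<bullet> \<omega> \<noteq> 0"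
    and int_powr: "\<And>x. (\<integral>\<omega>. \<bar>x \<bullet> \<omega>\<bar> powr q \<partial>M) = norm x powr q"
    and q: "1 < q"
begin

lemma AE_inner_le: "AE \<omega> in M. \<bar>x \<bullet> \<omega>\<bar> \<le> norm x"
  using ball
proof eventually_elim
  case (elim \<omega>)
  have "\<bar>x \<bullet> \<omega>\<bar> \<le> norm x * norm \<omega>" by (rule Cauchy_Schwarz_ineq2)
  also have "\<dots> \<le> norm x * 1" using elim by (intro mult_left_mono) auto
  finally show ?case by simp
qed

lemma integrable_bounded:
  fixes f :: "real ^ 4 \<Rightarrow> real"
  assumes [measurable]: "f \<in> borel_measurable borel" and "AE \<omega> in M. \<bar>f \<omega>\<bar> \<le> C"
  shows "integrable M f"
  using assms(2) by (intro finite_measure.integrable_const_bound[OF fin, where B = C]) auto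

text \<open>If \<open>w\<close> is a product of \<open>i\<close> linear functions of \<omega>, this
  is the i-th derivative at \<open>z\<close> of the q-th power of the norm, applied to the
  corresponding directions, wherever that derivative exists. A general weight \<open>w\<close>
  allows one differentiation lemma to cover all orders.\<close>

definition power_form :: "nat \<Rightarrow> real ^ 4 \<Rightarrow> (real ^ 4 \<Rightarrow> real) \<Rightarrow> real" where
  "power_form i z w = (\<integral>\<omega>. abs_powr_deriv q i (z \<bullet> \<omega>) * w \<omega> \<partial>M)"

lemma integrable_power_form:
  assumes [measurable]: "w \<in> borel_measurable borel" and "AE \<omega> in M. \<bar>w \<omega>\<bar> \<le> W" "real i \<le> q"
  shows "integrable M (\<lambda>\<omega>. abs_powr_deriv q i (z \<bullet> \<omega>) * w \<omega>)"
proof (rule integrable_bounded)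
  show "AE \<omega> in M. \<bar>abs_powr_deriv q i (z \<bullet> \<omega>) * w \<omega>\<bar>
      \<le> (\<bar>\<Prod>j<i. q - real j\<bar> * (norm z + 1) powr (q - i)) * W"
    using AE_inner_le[of z] assms(2)
  proof eventually_elim
    case (elim \<omega>)
    then show ?case unfolding abs_mult
      by (intro mult_mono abs_abs_powr_deriv_le assms) auto
  qed
qed measurable

text \<open>Differentiation under the integral by dominated convergence. For z \<noteq> 0 the
  integrand may fail to be differentiable only where \<open>z \<bullet> \<omega>\<close> is 0, a
  null set; for z = 0 the scalar function itself has to be differentiable at 0.\<close>

lemma has_derivative_power_form:
  assumes [measurable]: "w \<in> borel_measurable borel" and w: "AE \<omega> in M. \<bar>w \<omega>\<bar> \<le> W"
    and i: "real i + 1 \<le> q" "z \<noteq> 0 \<or> real i + 1 < q \<or> odd i"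
  shows "((\<lambda>t. power_form i (z + t *\<^sub>R k) w) has_real_derivative
           power_form (Suc i) z (\<lambda>\<omega>. (k \<bullet> \<omega>) * w \<omega>)) (at 0)"
  unfolding DERIV_def tendsto_at_iff_sequentially
proof (intro allI impI)
  fix X :: "nat \<Rightarrow> real" assume X0: "\<forall>n. X n \<in> UNIV - {0}" and X: "X \<longlonglongrightarrow> 0"
  \<comment> \<open>A convergent sequence of increments is bounded, so all arguments stay within one
    radius \<open>r\<close> and a single Lipschitz constant dominates the difference
    quotients.\<close>
  define b where "b = (SOME b. \<forall>n. \<bar>X n\<bar> \<le> b)"
  have "\<exists>b. \<forall>n. \<bar>X n\<bar> \<le> b"
    using convergent_imp_Bseq[of X] X by (auto simp: convergent_def Bseq_def)
  then have b: "\<bar>X n\<bar> \<le> b" for n unfolding b_def by (rule someI2_ex) auto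
  have b0: "0 \<le> b" using b[of 0] by simp
  define r where "r = norm z + b * norm k"
  define K where "K = \<bar>\<Prod>j<i. q - real j\<bar> * ((q - i) * r powr (q - i - 1))"
  have K0: "0 \<le> K" using i by (simp add: K_def)
  have int: "integrable M (\<lambda>\<omega>. abs_powr_deriv q i (y \<bullet> \<omega>) * w \<omega>)" for y
    using i by (intro integrable_power_form[OF _ w]) auto
  define S where "S n \<omega> = (abs_powr_deriv q i ((z + X n *\<^sub>R k) \<bullet> \<omega>) - abs_powr_deriv q i (z \<bullet> \<omega>)) / X n * w \<omega>" for n \<omega>
  have "(\<lambda>n. \<integral>\<omega>. S n \<omega> \<partial>M) \<longlonglongrightarrow> (\<integral>\<omega>. abs_powr_deriv q (Suc i) (z \<bullet> \<omega>) * ((k \<bullet> \<omega>) * w \<omega>) \<partial>M)"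
  proof (rule integral_dominated_convergence[where w = "\<lambda>_. K * norm k * W"])
    show "(\<lambda>\<omega>. abs_powr_deriv q (Suc i) (z \<bullet> \<omega>) * ((k \<bullet> \<omega>) * w \<omega>)) \<in> borel_measurable M"
      by measurable
    show "S n \<in> borel_measurable M" for n unfolding S_def by measurable
    show "integrable M (\<lambda>_. K * norm k * W)" by (rule finite_measure.integrable_const[OF fin])
    show "AE \<omega> in M. (\<lambda>n. S n \<omega>) \<longlonglongrightarrow> abs_powr_deriv q (Suc i) (z \<bullet> \<omega>) * ((k \<bullet> \<omega>) * w \<omega>)"
    proof -
      have "AE \<omega> in M. z \<bullet> \<omega> \<noteq> 0 \<or> real i + 1 < q \<or> odd i"
      proof (cases "z = 0")
        case False
        from nz[OF this] show ?thesis by eventually_elim simp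
      qed (use i(2) in simp)
      then show ?thesis
      proof eventually_elim
        case (elim \<omega>)
        have "((\<lambda>t. (z + t *\<^sub>R k) \<bullet> \<omega>) has_real_derivative k \<bullet> \<omega>) (at 0)"
          by (auto intro!: derivative_eq_intros simp: inner_add_left)
        moreover have "(abs_powr_deriv q i has_real_derivative abs_powr_deriv q (Suc i) (z \<bullet> \<omega>)) (at ((z + 0 *\<^sub>R k) \<bullet> \<omega>))"
          using has_derivative_abs_powr_deriv[of i q "z \<bullet> \<omega>"] i elim by simp
        ultimately have "((\<lambda>t. abs_powr_deriv q i ((z + t *\<^sub>R k) \<bullet> \<omega>)) has_real_derivative
            abs_powr_deriv q (Suc i) (z \<bullet> \<omega>) * (k \<bullet> \<omega>)) (at 0)"
          by (intro DERIV_chain2)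
        then have "(\<lambda>n. (abs_powr_deriv q i ((z + X n *\<^sub>R k) \<bullet> \<omega>) - abs_powr_deriv q i (z \<bullet> \<omega>)) / X n)
            \<longlonglongrightarrow> abs_powr_deriv q (Suc i) (z \<bullet> \<omega>) * (k \<bullet> \<omega>)"
          using X X0 unfolding DERIV_def tendsto_at_iff_sequentially by (auto simp: o_def)
        from tendsto_mult_right[OF this, of "w \<omega>"] show ?case
          by (simp add: S_def mult_ac)
      qed
    qed
    show "AE \<omega> in M. norm (S n \<omega>) \<le> K * norm k * W" for n
      using AE_inner_le[of z] AE_inner_le[of k] w
    proof eventually_elim
      case (elim \<omega>)
      have "\<bar>X n\<bar> * \<bar>k \<bullet> \<omega>\<bar> \<le> b * norm k" using elim b b0 by (intro mult_mono) auto
      then have 1: "\<bar>(z + X n *\<^sub>R k) \<bullet> \<omega>\<bar> \<le> r"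
        using elim abs_triangle_ineq[of "z \<bullet> \<omega>" "X n * (k \<bullet> \<omega>)"]
        by (simp add: r_def inner_add_left abs_mult)
      have "\<bar>z \<bullet> \<omega>\<bar> \<le> r" 
        unfolding r_def using elim(1) mult_nonneg_nonneg[OF b0 norm_ge_zero[of k]] by linarith
      from abs_powr_deriv_lipschitz[OF i(1) 1 this]
      have "\<bar>abs_powr_deriv q i ((z + X n *\<^sub>R k) \<bullet> \<omega>) - abs_powr_deriv q i (z \<bullet> \<omega>)\<bar> \<le> K * \<bar>X n * (k \<bullet> \<omega>)\<bar>"
        by (simp add: K_def inner_add_left)
      also have "\<dots> = \<bar>X n\<bar> * (K * \<bar>k \<bullet> \<omega>\<bar>)" by (simp add: abs_mult)
      also have "\<dots> \<le> \<bar>X n\<bar> * (K * norm k)" using elim K0 by (intro mult_left_mono) auto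
      finally have 2: "\<bar>(abs_powr_deriv q i ((z + X n *\<^sub>R k) \<bullet> \<omega>) - abs_powr_deriv q i (z \<bullet> \<omega>)) / X n\<bar> \<le> K * norm k"
        using X0 by (simp add: abs_divide divide_le_eq mult_ac)
      show ?case unfolding S_def real_norm_def abs_mult
        using 2 elim K0 by (intro mult_mono) auto
    qed
  qed
  moreover have "(\<integral>\<omega>. S n \<omega> \<partial>M) = (power_form i (z + X n *\<^sub>R k) w - power_form i z w) / X n" for n
  proof -
    have "S n \<omega> = (abs_powr_deriv q i ((z + X n *\<^sub>R k) \<bullet> \<omega>) * w \<omega> - abs_powr_deriv q i (z \<bullet> \<omega>) * w \<omega>) / X n" for \<omega>
      by (simp add: S_def algebra_simps)
    then show ?thesis unfolding power_form_def
      using int[of z] int[of "z + X n *\<^sub>R k"] by simp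
  qed
  ultimately show "((\<lambda>h. (power_form i (z + (0 + h) *\<^sub>R k) w - power_form i (z + 0 *\<^sub>R k) w) / h) \<circ> X)
      \<longlonglongrightarrow> power_form (Suc i) z (\<lambda>\<omega>. (k \<bullet> \<omega>) * w \<omega>)"
    by (simp add: o_def power_form_def)
qed

text \<open>For unit vectors both q-th moments are 1, so integrating Young's inequality gives
  (q-1)/q + 1/q = 1; homogeneity does the rest.\<close>

lemma holder_integral:
  "integrable M (\<lambda>\<omega>. \<bar>h \<bullet> \<omega>\<bar> powr (q - 1) * \<bar>u \<bullet> \<omega>\<bar>)" (is ?A)
  "(\<integral>\<omega>. \<bar>h \<bullet> \<omega>\<bar> powr (q - 1) * \<bar>u \<bullet> \<omega>\<bar> \<partial>M) \<le> norm h powr (q - 1) * norm u" (is ?B)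
proof -
  have int_q: "integrable M (\<lambda>\<omega>. \<bar>x \<bullet> \<omega>\<bar> powr q)" for x
  proof (rule integrable_bounded)
    show "AE \<omega> in M. \<bar>\<bar>x \<bullet> \<omega>\<bar> powr q\<bar> \<le> norm x powr q"
      using AE_inner_le[of x] by eventually_elim (use q in \<open>auto intro!: powr_mono2\<close>)
  qed measurable
  have int: "integrable M (\<lambda>\<omega>. \<bar>h \<bullet> \<omega>\<bar> powr (q - 1) * \<bar>u \<bullet> \<omega>\<bar>)" for h u
  proof (rule integrable_bounded)
    show "AE \<omega> in M. \<bar>\<bar>h \<bullet> \<omega>\<bar> powr (q - 1) * \<bar>u \<bullet> \<omega>\<bar>\<bar> \<le> norm h powr (q - 1) * norm u"
      using AE_inner_le[of h] AE_inner_le[of u]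
      by eventually_elim (use q in \<open>auto simp: abs_mult intro!: mult_mono powr_mono2\<close>)
  qed measurable
  show ?A by (rule int)
  have young: "a powr (q - 1) * b \<le> (q - 1) / q * a powr q + 1 / q * b powr q" if "0 \<le> a" "0 \<le> b" for a b :: real
  proof -
    have "a powr (q - 1) * b \<le> ((q - 1) * a powr q + b powr q) / q"
      using young_powr[OF q that] q by (simp add: pos_le_divide_eq mult.commute)
    then show ?thesis by (simp add: add_divide_distrib)
  qed
  have unit: "(\<integral>\<omega>. \<bar>h \<bullet> \<omega>\<bar> powr (q - 1) * \<bar>u \<bullet> \<omega>\<bar> \<partial>M) \<le> 1" if "norm h = 1" "norm u = 1" for h u
  proof -
    have "(\<integral>\<omega>. \<bar>h \<bullet> \<omega>\<bar> powr (q - 1) * \<bar>u \<bullet> \<omega>\<bar> \<partial>M)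
       \<le> (\<integral>\<omega>. (q - 1) / q * \<bar>h \<bullet> \<omega>\<bar> powr q + 1 / q * \<bar>u \<bullet> \<omega>\<bar> powr q \<partial>M)"
      using int_q[of h] int_q[of u] int by (intro integral_mono young) auto
    also have "\<dots> = (q - 1) / q * 1 + 1 / q * 1"
      using int_q[of h] int_q[of u] int_powr[of h] int_powr[of u] that by simp
    also have "\<dots> = 1" using q by (simp flip: add_divide_distrib)
    finally show ?thesis .
  qed
  show ?B
  proof (cases "h = 0 \<or> u = 0")
    case False
    define c where "c = norm h powr (q - 1) * norm u"
    have "(\<integral>\<omega>. \<bar>h \<bullet> \<omega>\<bar> powr (q - 1) * \<bar>u \<bullet> \<omega>\<bar> \<partial>M)
        = (\<integral>\<omega>. c * (\<bar>(h /\<^sub>R norm h) \<bullet> \<omega>\<bar> powr (q - 1) * \<bar>(u /\<^sub>R norm u) \<bullet> \<omega>\<bar>) \<partial>M)"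
      using False by (intro Bochner_Integration.integral_cong) (auto simp: c_def abs_mult powr_divide field_simps)
    also have "\<dots> = c * (\<integral>\<omega>. \<bar>(h /\<^sub>R norm h) \<bullet> \<omega>\<bar> powr (q - 1) * \<bar>(u /\<^sub>R norm u) \<bullet> \<omega>\<bar> \<partial>M)"
      by (rule integral_mult_right_zero)
    also have "\<dots> \<le> c * 1" using False by (intro mult_left_mono unit) (auto simp: c_def)
    finally show ?thesis by (simp add: c_def)
  qed (use q in auto)
qed

end

lemma norm_powr_measure_locale_exists:
  assumes "1 < q"
  shows "\<exists>M. norm_powr_measure M q"
proof (rule norm_powr_measure_exists[of q])
  show "0 < q" using assms by simp
next
  fix M :: "(real ^ 4) measure"
  assume "finite_measure M" "sets M = sets borel" "AE \<omega> in M. norm \<omega> \<le> 1"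
    "\<And>x. x \<noteq> 0 \<Longrightarrow> AE \<omega> in M. x \<bullet> \<omega> \<noteq> 0"
    "\<And>x. (\<integral>\<omega>. \<bar>x \<bullet> \<omega>\<bar> powr q \<partial>M) = norm x powr q"
  then have "norm_powr_measure M q" using assms by (rule norm_powr_measure.intro)
  then show "\<exists>M. norm_powr_measure M q" ..
qed

lemma dir_deriv_eqI:
  assumes "((\<lambda>t. g (x + t *\<^sub>R h)) has_real_derivative D) (at 0)"
  shows "dir_deriv g x h = D"
  using assms unfolding dir_deriv_def
  by (auto simp: field_differentiable_def intro: DERIV_imp_deriv)

text \<open>A derivative at the minimum would be 0, while all difference quotients have absolute
  value 1.\<close>

lemma abs_not_differentiable_at_0: "\<not> ((\<lambda>t::real. \<bar>t\<bar>) has_real_derivative D) (at 0)"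
proof
  assume d: "((\<lambda>t::real. \<bar>t\<bar>) has_real_derivative D) (at 0)"
  have "D = 0" by (rule DERIV_local_min[OF d zero_less_one]) auto
  then have "((\<lambda>h::real. \<bar>\<bar>h\<bar> / h\<bar>) \<longlongrightarrow> 0) (at 0)"
    using d by (intro tendsto_rabs_zero) (simp add: DERIV_def)
  moreover have "\<forall>\<^sub>F h in at 0. \<bar>\<bar>h\<bar> / h\<bar> = (1::real)"
    by (auto simp: eventually_at_filter)
  ultimately have "((\<lambda>h::real. 1::real) \<longlongrightarrow> 0) (at 0)"
    by (rule Lim_transform_eventually)
  then show False by (simp add: tendsto_const_iff)
qed

lemma has_derivative_polynomial_at_0:
  fixes c :: "nat \<Rightarrow> real"
  assumes "1 \<le> n"
  shows "((\<lambda>t. \<Sum>k\<le>n. c k * t ^ k) has_real_derivative c 1) (at 0)"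
proof -
  have "((\<lambda>t. \<Sum>k\<le>n. c k * t ^ k) has_real_derivative (\<Sum>k\<le>n. c k * (real k * 0 ^ (k - 1)))) (at 0)"
    by (intro DERIV_sum) (auto intro!: derivative_eq_intros)
  moreover have "(\<Sum>k\<le>n. c k * (real k * 0 ^ (k - 1))) = (\<Sum>k\<le>n. if k = 1 then c k else 0)"
    by (intro sum.cong) (auto simp: power_0_left)
  moreover have "\<dots> = c 1" using assms by simp
  ultimately show ?thesis by simp
qed

section \<open>Taylor expansion of the norm power under the integral\<close>

context norm_powr_measure
begin

lemma AE_inner_power_le: "AE \<omega> in M. \<bar>(k \<bullet> \<omega>) ^ i * (u \<bullet> \<omega>) ^ j\<bar> \<le> norm k ^ i * norm u ^ j"
  using AE_inner_le[of k] AE_inner_le[of u]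
  by eventually_elim (auto simp: abs_mult power_abs intro!: mult_mono power_mono)

lemma power_form_0: "power_form 0 z (\<lambda>_. 1) = norm z powr q"
  using int_powr[of z] q by (simp add: power_form_def abs_powr_deriv_def signed_powr_def)

text \<open>The exceptional case \<open>z = 0\<close>, \<open>q = i + 1\<close> odd is where both sides vanish by convention:
  on the left because \<open>\<bar>t\<bar>\<close> is not differentiable at \<open>0\<close>, on the right by the choice of
  \<open>abs_powr_deriv\<close>.\<close>

lemma dir_deriv_power_form:
  assumes i: "real i + 1 \<le> q"
    and g: "\<And>t. g (x + t *\<^sub>R h) = power_form i (z + t *\<^sub>R k) (\<lambda>\<omega>. (k \<bullet> \<omega>) ^ i)"
  shows "dir_deriv g x h = power_form (Suc i) z (\<lambda>\<omega>. (k \<bullet> \<omega>) ^ Suc i)"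
proof (cases "z \<noteq> 0 \<or> real i + 1 < q \<or> odd i")
  case True
  have "((\<lambda>t. power_form i (z + t *\<^sub>R k) (\<lambda>\<omega>. (k \<bullet> \<omega>) ^ i)) has_real_derivative
           power_form (Suc i) z (\<lambda>\<omega>. (k \<bullet> \<omega>) * (k \<bullet> \<omega>) ^ i)) (at 0)"
    using AE_inner_power_le[of k i 0 0] i True
    by (intro has_derivative_power_form[where W = "norm k ^ i"]) auto
  then show ?thesis by (intro dir_deriv_eqI) (simp add: g)
next
  case False
  then have z: "z = 0" and qi: "q = real i + 1" and ev: "even i" using i by auto
  define c where "c = (\<Prod>j<i. q - real j)"
  have c: "c > 0" unfolding c_def using qi by (intro prod_pos) auto
  have R: "power_form (Suc i) z (\<lambda>\<omega>. (k \<bullet> \<omega>) ^ Suc i) = 0"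
    using ev by (simp add: power_form_def z abs_powr_deriv_def signed_powr_def)
  \<comment> \<open>Since q = i + 1 with even i, the form restricted to a line through the origin is
    a nonnegative multiple of |t|. For k = 0 the multiple is 0 and the derivative exists; otherwise
    the default value of \<open>dir_deriv\<close> applies.\<close>
  have f: "power_form i (z + t *\<^sub>R k) (\<lambda>\<omega>. (k \<bullet> \<omega>) ^ i) = c * norm k powr q * \<bar>t\<bar>" for t
  proof -
    have e: "abs_powr_deriv q i ((z + t *\<^sub>R k) \<bullet> \<omega>) * (k \<bullet> \<omega>) ^ i = c * \<bar>t\<bar> * \<bar>k \<bullet> \<omega>\<bar> powr q" for \<omega>
    proof -
      have "\<bar>k \<bullet> \<omega>\<bar> powr q = \<bar>k \<bullet> \<omega>\<bar> ^ Suc i"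
      proof (cases "k \<bullet> \<omega> = 0")
        case False
        then show ?thesis using powr_realpow[of "\<bar>k \<bullet> \<omega>\<bar>" "Suc i"] qi by (simp add: add.commute)
      qed simp
      moreover have "(k \<bullet> \<omega>) ^ i = \<bar>k \<bullet> \<omega>\<bar> ^ i" by (rule power_even_abs[OF ev, symmetric])
      ultimately show ?thesis using ev qi
        by (simp add: abs_powr_deriv_def signed_powr_def z c_def abs_mult mult_ac)
    qed
    show ?thesis unfolding power_form_def e using int_powr[of k] by simp
  qed
  have "dir_deriv g x h = 0"
  proof (cases "k = 0")
    case True
    then show ?thesis by (intro dir_deriv_eqI) (simp add: g f q)
  next
    case False
    then have ck: "c * norm k powr q > 0" using c by simp
    define b where "b = c * norm k powr q"
    have b: "b \<noteq> 0" using ck unfolding b_def by linarith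
    have "\<not> (\<lambda>t. b * \<bar>t\<bar>) field_differentiable at 0"
    proof
      assume "(\<lambda>t. b * \<bar>t\<bar>) field_differentiable at (0::real)"
      then obtain D where "((\<lambda>t. b * \<bar>t\<bar>) has_real_derivative D) (at 0)"
        by (auto simp: field_differentiable_def)
      from DERIV_cdivide[OF this, of b] have "((\<lambda>t. \<bar>t\<bar>) has_real_derivative D / b) (at 0)"
        using b by simp
      then show False using abs_not_differentiable_at_0 by blast
    qed
    then show ?thesis by (simp add: dir_deriv_def g f flip: b_def)
  qed
  then show ?thesis by (simp only: R)
qed

text \<open>With the base point fixed the form is a polynomial in \<open>t\<close>, by the binomial
  theorem, and its linear coefficient is the derivative. No derivative of |t|^q is taken, so the
  exceptional origin needs no separate treatment.\<close>

lemma has_derivative_power_form_direction: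
  assumes i: "1 \<le> i" "real i \<le> q"
  shows "((\<lambda>t. power_form i z (\<lambda>\<omega>. ((h + t *\<^sub>R u) \<bullet> \<omega>) ^ i)) has_real_derivative
           power_form i z (\<lambda>\<omega>. real i * (h \<bullet> \<omega>) ^ (i - 1) * (u \<bullet> \<omega>))) (at 0)"
proof -
  define c where "c j = real (i choose j) * power_form i z (\<lambda>\<omega>. (h \<bullet> \<omega>) ^ (i - j) * (u \<bullet> \<omega>) ^ j)" for j
  have int: "integrable M (\<lambda>\<omega>. abs_powr_deriv q i (z \<bullet> \<omega>) * ((h \<bullet> \<omega>) ^ l * (u \<bullet> \<omega>) ^ j))" for l j
    using i by (intro integrable_power_form[OF _ AE_inner_power_le]) auto
  have "power_form i z (\<lambda>\<omega>. ((h + t *\<^sub>R u) \<bullet> \<omega>) ^ i) = (\<Sum>j\<le>i. c j * t ^ j)" for t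
  proof -
    have "abs_powr_deriv q i (z \<bullet> \<omega>) * ((h + t *\<^sub>R u) \<bullet> \<omega>) ^ i
        = (\<Sum>j\<le>i. real (i choose j) * t ^ j * (abs_powr_deriv q i (z \<bullet> \<omega>) * ((h \<bullet> \<omega>) ^ (i - j) * (u \<bullet> \<omega>) ^ j)))" for \<omega>
    proof -
      have "((h + t *\<^sub>R u) \<bullet> \<omega>) ^ i = (t * (u \<bullet> \<omega>) + h \<bullet> \<omega>) ^ i" by (simp add: inner_add_left add.commute)
      also have "\<dots> = (\<Sum>j\<le>i. of_nat (i choose j) * (t * (u \<bullet> \<omega>)) ^ j * (h \<bullet> \<omega>) ^ (i - j))"
        by (rule binomial_ring)
      finally show ?thesis by (simp add: sum_distrib_left power_mult_distrib mult_ac)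
    qed
    then have "power_form i z (\<lambda>\<omega>. ((h + t *\<^sub>R u) \<bullet> \<omega>) ^ i) =
       (\<Sum>j\<le>i. \<integral>\<omega>. real (i choose j) * t ^ j * (abs_powr_deriv q i (z \<bullet> \<omega>) * ((h \<bullet> \<omega>) ^ (i - j) * (u \<bullet> \<omega>) ^ j)) \<partial>M)"
      unfolding power_form_def by (subst Bochner_Integration.integral_sum[symmetric]) (auto intro!: integrable_mult_right int)
    then show ?thesis by (simp add: c_def power_form_def mult_ac)
  qed
  moreover have "c 1 = power_form i z (\<lambda>\<omega>. real i * (h \<bullet> \<omega>) ^ (i - 1) * (u \<bullet> \<omega>))"
  proof -
    have e: "abs_powr_deriv q i (z \<bullet> \<omega>) * (real i * (h \<bullet> \<omega>) ^ (i - 1) * (u \<bullet> \<omega>))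
        = real i * (abs_powr_deriv q i (z \<bullet> \<omega>) * ((h \<bullet> \<omega>) ^ (i - 1) * (u \<bullet> \<omega>)))" for \<omega>
      by (simp add: mult_ac)
    show ?thesis
      by (simp only: c_def power_form_def e choose_one power_one_right integral_mult_right_zero)
  qed
  ultimately show ?thesis using has_derivative_polynomial_at_0[OF i(1), of c] by simp
qed

text \<open>For fixed \<omega> the integrand is the scalar Taylor remainder between
  \<open>z \<bullet> \<omega>\<close> and \<open>(z + h) \<bullet> \<omega>\<close>, times
  \<open>u \<bullet> \<omega>\<close>. The scalar bound depends on
  \<open>h \<bullet> \<omega>\<close> only, so Hoelder's inequality finishes the estimate with the
  same constant.\<close>

lemma taylor_power_form_bound:
  assumes "2 \<le> p" "0 \<le> \<nu>" "\<nu> \<le> 1" "q = real p + \<nu>"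
  shows "\<bar>power_form 1 (z + h) (\<lambda>\<omega>. u \<bullet> \<omega>)
           - (\<Sum>i=1..p. 1 / fact i * power_form i z (\<lambda>\<omega>. real i * (h \<bullet> \<omega>) ^ (i - 1) * (u \<bullet> \<omega>)))\<bar>
         \<le> C_const p \<nu> / fact (p - 1) * (norm h powr (q - 1) * norm u)"
proof -
  let ?P = "\<lambda>i. power_form i z (\<lambda>\<omega>. real i * (h \<bullet> \<omega>) ^ (i - 1) * (u \<bullet> \<omega>))"
  let ?T = "\<lambda>i \<omega>. 1 / fact (i - 1) * (abs_powr_deriv q i (z \<bullet> \<omega>) * ((h \<bullet> \<omega>) ^ (i - 1) * (u \<bullet> \<omega>) ^ 1))"
  define K where "K = C_const p \<nu> / fact (p - 1)"
  have K0: "0 \<le> K" unfolding K_def C_const_def using assms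
    by (intro divide_nonneg_nonneg mult_nonneg_nonneg prod_nonneg) auto
  define r where "r \<omega> = abs_powr_deriv q 1 ((z + h) \<bullet> \<omega>)
      - (\<Sum>i=1..p. abs_powr_deriv q i (z \<bullet> \<omega>) * (h \<bullet> \<omega>) ^ (i - 1) / fact (i - 1))" for \<omega>
  have r: "\<bar>r \<omega>\<bar> \<le> K * \<bar>h \<bullet> \<omega>\<bar> powr (q - 1)" for \<omega>
    using abs_powr_taylor[OF assms, of "(z + h) \<bullet> \<omega>" "z \<bullet> \<omega>"] by (simp add: r_def K_def inner_add_left)
  have int1: "integrable M (\<lambda>\<omega>. abs_powr_deriv q 1 ((z + h) \<bullet> \<omega>) * (u \<bullet> \<omega>))"
    using assms by (intro integrable_power_form[OF _ AE_inner_le]) auto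
  have inti: "integrable M (\<lambda>\<omega>. abs_powr_deriv q i (z \<bullet> \<omega>) * ((h \<bullet> \<omega>) ^ (i - 1) * (u \<bullet> \<omega>) ^ 1))" if "i \<le> p" for i
    using assms that by (intro integrable_power_form[OF _ AE_inner_power_le]) auto
  \<comment> \<open>The factor \<open>i\<close> from differentiating the i-th power of the direction
    turns 1/i! into 1/(i-1)!, as in the scalar expansion.\<close>
  have eq: "1 / fact i * ?P i
      = (\<integral>\<omega>. ?T i \<omega> \<partial>M)"
    if "i \<in> {1..p}" for i
  proof -
    have fi: "(fact i :: real) = real i * fact (i - 1)" using that by (cases i) auto
    have "1 / fact i * ?P i
        = (\<integral>\<omega>. 1 / fact i * (abs_powr_deriv q i (z \<bullet> \<omega>) * (real i * (h \<bullet> \<omega>) ^ (i - 1) * (u \<bullet> \<omega>))) \<partial>M)"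
      unfolding power_form_def by (rule integral_mult_right_zero[symmetric])
    also have "\<dots> = (\<integral>\<omega>. ?T i \<omega> \<partial>M)"
      using that by (intro Bochner_Integration.integral_cong) (auto simp: fi)
    finally show ?thesis .
  qed
  have int2: "integrable M (\<lambda>\<omega>. \<Sum>i=1..p. ?T i \<omega>)"
    by (intro Bochner_Integration.integrable_sum integrable_mult_right inti) auto
  have ru: "r \<omega> * (u \<bullet> \<omega>) = abs_powr_deriv q 1 ((z + h) \<bullet> \<omega>) * (u \<bullet> \<omega>)
     - (\<Sum>i=1..p. ?T i \<omega>)" for \<omega>
    by (simp add: r_def left_diff_distrib sum_distrib_right mult.assoc)
  have intr: "integrable M (\<lambda>\<omega>. r \<omega> * (u \<bullet> \<omega>))"
    unfolding ru by (rule Bochner_Integration.integrable_diff[OF int1 int2])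
  have "(\<Sum>i=1..p. 1 / fact i * ?P i)
      = (\<Sum>i=1..p. \<integral>\<omega>. ?T i \<omega> \<partial>M)"
    by (rule sum.cong[OF refl eq])
  also have "\<dots> = (\<integral>\<omega>. (\<Sum>i=1..p. ?T i \<omega>) \<partial>M)"
    by (rule Bochner_Integration.integral_sum[symmetric]) (intro integrable_mult_right inti, simp)
  finally have "(\<Sum>i=1..p. 1 / fact i * ?P i)
      = (\<integral>\<omega>. (\<Sum>i=1..p. ?T i \<omega>) \<partial>M)" .
  then have "power_form 1 (z + h) (\<lambda>\<omega>. u \<bullet> \<omega>)
           - (\<Sum>i=1..p. 1 / fact i * ?P i)
      = (\<integral>\<omega>. r \<omega> * (u \<bullet> \<omega>) \<partial>M)"
    unfolding ru Bochner_Integration.integral_diff[OF int1 int2] power_form_def by simp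
  also have "\<bar>\<dots>\<bar> \<le> (\<integral>\<omega>. \<bar>r \<omega> * (u \<bullet> \<omega>)\<bar> \<partial>M)" by (rule integral_abs_bound)
  also have "\<dots> \<le> (\<integral>\<omega>. K * (\<bar>h \<bullet> \<omega>\<bar> powr (q - 1) * \<bar>u \<bullet> \<omega>\<bar>) \<partial>M)"
  proof (rule integral_mono)
    show "integrable M (\<lambda>\<omega>. \<bar>r \<omega> * (u \<bullet> \<omega>)\<bar>)" using intr by simp
    show "integrable M (\<lambda>\<omega>. K * (\<bar>h \<bullet> \<omega>\<bar> powr (q - 1) * \<bar>u \<bullet> \<omega>\<bar>))"
      by (intro integrable_mult_right holder_integral)
    fix \<omega>
    show "\<bar>r \<omega> * (u \<bullet> \<omega>)\<bar> \<le> K * (\<bar>h \<bullet> \<omega>\<bar> powr (q - 1) * \<bar>u \<bullet> \<omega>\<bar>)"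
      using mult_right_mono[OF r[of \<omega>], of "\<bar>u \<bullet> \<omega>\<bar>"] by (simp add: abs_mult mult_ac)
  qed
  also have "\<dots> = K * (\<integral>\<omega>. \<bar>h \<bullet> \<omega>\<bar> powr (q - 1) * \<bar>u \<bullet> \<omega>\<bar> \<partial>M)" by (rule integral_mult_right_zero)
  also have "\<dots> \<le> K * (norm h powr (q - 1) * norm u)"
    using K0 by (intro mult_left_mono holder_integral)
  finally show ?thesis by (simp add: K_def)
qed

end

section \<open>Transfer of the norm power estimates to the space \<open>E\<close>\<close>

context energy_space
begin

text \<open>Away from the origin this is the chain rule through the quadratic polynomial under the
  square root. At the origin the function is a multiple of |t|^q with q > 1, whose derivative
  vanishes.\<close>

lemma has_derivative_nrm_powr:
  assumes "z \<in> E" "u \<in> E" "1 < q"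
  shows "((\<lambda>t. nrm (z + t *\<^sub>R u) powr q) has_real_derivative q * nrm z powr (q - 2) * B z u) (at 0)"
proof (cases "z = 0")
  case True
  have "((\<lambda>t. \<bar>t\<bar> powr q) has_real_derivative abs_powr_deriv q (Suc 0) 0) (at 0)"
    using has_derivative_abs_powr_deriv[of 0 q 0] assms
    by (simp add: abs_powr_deriv_def[abs_def] signed_powr_def[abs_def])
  then have "((\<lambda>t. nrm u powr q * \<bar>t\<bar> powr q) has_real_derivative nrm u powr q * abs_powr_deriv q (Suc 0) 0) (at 0)"
    by (rule DERIV_cmult)
  moreover have "abs_powr_deriv q (Suc 0) 0 = 0"
    by (simp add: abs_powr_deriv_def signed_powr_def)
  ultimately show ?thesis using True assms
    by (simp add: nrm_scale powr_mult B_simps mult.commute)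
next
  case False
  define \<alpha> where "\<alpha> = B z z"
  have a0: "\<alpha> > 0" using B_pos[OF assms(1) False] by (simp add: \<alpha>_def)
  have sq: "nrm (z + t *\<^sub>R u) powr q = (\<alpha> + 2 * t * B z u + t\<^sup>2 * B u u) powr (q / 2)" for t
  proof -
    have "z + t *\<^sub>R u \<in> E" using assms by auto
    then have "0 \<le> B (z + t *\<^sub>R u) (z + t *\<^sub>R u)" by simp
    moreover have "B (z + t *\<^sub>R u) (z + t *\<^sub>R u) = \<alpha> + 2 * t * B z u + t\<^sup>2 * B u u"
      using B_commute[of z u] assms by (simp add: B_simps \<alpha>_def power2_eq_square algebra_simps)
    ultimately show ?thesis by (simp add: bnorm_def powr_half_sqrt[symmetric] powr_powr)
  qed
  have "((\<lambda>t. \<alpha> + 2 * t * B z u + t\<^sup>2 * B u u) has_real_derivative 2 * B z u) (at 0)"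
    by (auto intro!: derivative_eq_intros)
  moreover have "((\<lambda>x. x powr (q / 2)) has_real_derivative (q / 2) * \<alpha> powr (q / 2 - 1)) (at (\<alpha> + 2 * 0 * B z u + 0\<^sup>2 * B u u))"
    using has_real_derivative_powr[OF a0, of "q / 2"] by simp
  ultimately have "((\<lambda>t. (\<alpha> + 2 * t * B z u + t\<^sup>2 * B u u) powr (q / 2)) has_real_derivative
      (q / 2) * \<alpha> powr (q / 2 - 1) * (2 * B z u)) (at 0)"
    by (rule DERIV_chain2[rotated])
  moreover have "\<alpha> powr (q / 2 - 1) = nrm z powr (q - 2)"
    using a0 by (simp add: bnorm_def \<alpha>_def powr_half_sqrt[symmetric] powr_powr diff_divide_distrib)
  ultimately show ?thesis by (simp add: sq mult.assoc)
qed

definition reg_taylor :: "nat \<Rightarrow> real \<Rightarrow> 'a \<Rightarrow> 'a \<Rightarrow> 'a \<Rightarrow> real" where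
  "reg_taylor p \<nu> x0 y h = (\<Sum>i=1..p. 1 / fact i * nderiv (pow_reg B p \<nu> x0) (replicate i h) y)"

text \<open>Every instance of the claim involves a span of at most four vectors and can be moved to
  R^4 by an isometry, where the integral representation is available; the dimension of
  \<open>E\<close> never enters.\<close>

lemma reg_taylor_derivative:
  assumes p: "2 \<le> p" "0 \<le> \<nu>" "\<nu> \<le> 1" and pq: "q = real p + \<nu>" and E: "x0 \<in> E" "x \<in> E" "y \<in> E"
  obtains D where "linear_functional_on E D"
    "\<And>u. u \<in> E \<Longrightarrow> ((\<lambda>t. reg_taylor p \<nu> x0 y (x + t *\<^sub>R u - y)) has_real_derivative D u) (at 0)"
    "\<And>u. u \<in> E \<Longrightarrow> \<bar>q * nrm (x - x0) powr (q - 2) * B (x - x0) u - D u\<bar>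
        \<le> C_const p \<nu> / fact (p - 1) * (nrm (x - y) powr (q - 1) * nrm u)"
proof -
  have q1: "1 < q" using p pq by simp
  obtain M :: "(real ^ 4) measure" where "norm_powr_measure M q"
    
    using norm_powr_measure_locale_exists[OF q1] by blast
  then interpret norm_powr_measure M q .
  define z h where "z = y - x0" and "h = x - y"
  \<comment> \<open>Four dimensions accommodate \<open>z\<close>, \<open>h\<close> and two directions \<open>u\<close>, \<open>u'\<close>, which is what linearity
    of the derivative in its direction requires.\<close>
  have zhE: "z \<in> E" "h \<in> E" using E by (auto simp: z_def h_def)
  \<comment> \<open>Defined without reference to an embedding: \<open>main\<close> provides a
    functional \<open>F\<close> for each pair of directions, with its own isometry, and uniqueness
    of derivatives glues these into one \<open>D\<close>.\<close>
  define D where "D u = deriv (\<lambda>t. reg_taylor p \<nu> x0 y (x + t *\<^sub>R u - y)) 0" for u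
  have main: "\<exists>F. (\<forall>v\<in>span {u, u'}. ((\<lambda>t. reg_taylor p \<nu> x0 y (x + t *\<^sub>R v - y)) has_real_derivative F v) (at 0)) \<and>
      linear_functional_on (span {u, u'}) F \<and>
      (\<forall>v\<in>span {u, u'}. \<bar>q * nrm (x - x0) powr (q - 2) * B (x - x0) v - F v\<bar>
        \<le> C_const p \<nu> / fact (p - 1) * (nrm (x - y) powr (q - 1) * nrm v))"
    if u: "u \<in> E" "u' \<in> E" for u u'
  proof -
    define S where "S = {z, h, u, u'}"
    have SE: "S \<subseteq> E" using zhE u by (auto simp: S_def)
    then have spE: "span S \<subseteq> E" using span_minimal[OF _ subspace_E] by blast
    have "card S \<le> CARD(4)"
      using card_length[of "[z, h, u, u']"] by (simp add: S_def)
    then obtain L :: "'a \<Rightarrow> real ^ 4" where L: "linear L"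
        "\<And>a b. a \<in> span S \<Longrightarrow> b \<in> E \<Longrightarrow> L a \<bullet> L b = B a b"
      using isometry_into_Rn[of S, where 'n = 4] SE by (auto simp: S_def)
    have nL: "norm (L a) = nrm a" if "a \<in> span S" for a
    proof -
      have "a \<in> E" using that spE by blast
      from L(2)[OF that this] show ?thesis by (simp add: norm_eq_sqrt_inner bnorm_def)
    qed
    \<comment> \<open>The base point \<open>a\<close> ranges over the whole span because the next
      derivative needs the identity along the line through \<open>a\<close> in direction
      \<open>k\<close>.\<close>
    have form: "nderiv (pow_reg B p \<nu> x0) (replicate i k) (x0 + a) = power_form i (L a) (\<lambda>\<omega>. (L k \<bullet> \<omega>) ^ i)"
      if "i \<le> p" "a \<in> span S" "k \<in> span S" for i a k
      using that
    proof (induction i arbitrary: a)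
      case 0
      then show ?case using power_form_0[of "L a"] nL[of a] by (simp add: pow_reg_def flip: pq)
    next
      case (Suc i)
      show ?case unfolding replicate_Suc nderiv.simps
      proof (rule dir_deriv_power_form)
        show "real i + 1 \<le> q" using Suc.prems p pq by simp
        fix t
        have "nderiv (pow_reg B p \<nu> x0) (replicate i k) (x0 + (a + t *\<^sub>R k))
            = power_form i (L (a + t *\<^sub>R k)) (\<lambda>\<omega>. (L k \<bullet> \<omega>) ^ i)"
          using Suc.prems by (intro Suc.IH) (auto intro: span_add span_scale)
        then show "nderiv (pow_reg B p \<nu> x0) (replicate i k) (x0 + a + t *\<^sub>R k)
            = power_form i (L a + t *\<^sub>R L k) (\<lambda>\<omega>. (L k \<bullet> \<omega>) ^ i)"
          using L(1) by (simp add: linear_add linear_scale add.assoc)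
      qed
    qed
    have zhS: "z \<in> span S" "h \<in> span S" by (auto simp: S_def intro: span_base)
    have uS: "span {u, u'} \<subseteq> span S" by (rule span_mono) (auto simp: S_def)
    define F where "F v = (\<Sum>i=1..p. 1 / fact i * power_form i (L z) (\<lambda>\<omega>. real i * (L h \<bullet> \<omega>) ^ (i - 1) * (L v \<bullet> \<omega>)))" for v
    show ?thesis
    proof (intro exI[of _ F] conjI ballI)
      fix v assume v: "v \<in> span {u, u'}"
      then have vS: "v \<in> span S" using uS by auto
      have e: "nderiv (pow_reg B p \<nu> x0) (replicate i (x + t *\<^sub>R v - y)) y
          = power_form i (L z) (\<lambda>\<omega>. ((L h + t *\<^sub>R L v) \<bullet> \<omega>) ^ i)" if "i \<le> p" for i t
      proof -
        have hv: "x + t *\<^sub>R v - y = h + t *\<^sub>R v" by (simp add: h_def)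
        have yz: "x0 + z = y" by (simp add: z_def)
        have "h + t *\<^sub>R v \<in> span S" using zhS vS by (intro span_add span_scale)
        from form[OF that zhS(1) this] show ?thesis
          unfolding hv yz using L(1) by (simp add: linear_add linear_scale)
      qed
      have "((\<lambda>t. \<Sum>i=1..p. 1 / fact i * power_form i (L z) (\<lambda>\<omega>. ((L h + t *\<^sub>R L v) \<bullet> \<omega>) ^ i)) has_real_derivative F v) (at 0)"
        unfolding F_def using p pq
        by (intro DERIV_sum DERIV_cmult has_derivative_power_form_direction) auto
      then show "((\<lambda>t. reg_taylor p \<nu> x0 y (x + t *\<^sub>R v - y)) has_real_derivative F v) (at 0)"
        unfolding reg_taylor_def by (simp add: e cong: sum.cong_simp)
      \<comment> \<open>The gradient of the norm power at \<open>x\<close> is obtained in two ways,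
        in closed form and as a power form of order 1; both are derivatives of the same function
        along \<open>v\<close>.\<close>
      have g: "q * nrm (x - x0) powr (q - 2) * B (x - x0) v = power_form 1 (L z + L h) (\<lambda>\<omega>. L v \<bullet> \<omega>)"
      proof -
        have "((\<lambda>t. power_form 0 (L (z + h) + t *\<^sub>R L v) (\<lambda>_. 1)) has_real_derivative
           power_form (Suc 0) (L (z + h)) (\<lambda>\<omega>. (L v \<bullet> \<omega>) * 1)) (at 0)"
          using q1 by (intro has_derivative_power_form[where W = 1]) auto
        moreover have "power_form 0 (L (z + h) + t *\<^sub>R L v) (\<lambda>_. 1) = nrm (z + h + t *\<^sub>R v) powr q" for t
        proof -
          have "L (z + h) + t *\<^sub>R L v = L (z + h + t *\<^sub>R v)" using L(1) by (simp add: linear_add linear_scale)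
          then show ?thesis using zhS vS by (simp add: power_form_0 nL span_add span_scale)
        qed
        ultimately have "((\<lambda>t. nrm (z + h + t *\<^sub>R v) powr q) has_real_derivative
           power_form 1 (L z + L h) (\<lambda>\<omega>. L v \<bullet> \<omega>)) (at 0)" using L(1) by (simp add: linear_add)
        moreover have "z + h = x - x0" by (simp add: z_def h_def)
        ultimately show ?thesis
          using has_derivative_nrm_powr[of "z + h" v q] zhE vS spE q1 DERIV_unique by (metis E_closed(2) subsetD)
      qed
      show "\<bar>q * nrm (x - x0) powr (q - 2) * B (x - x0) v - F v\<bar>
        \<le> C_const p \<nu> / fact (p - 1) * (nrm (x - y) powr (q - 1) * nrm v)"
        unfolding g F_def using taylor_power_form_bound[OF p pq, of "L z" "L h" "L v"] nL[OF zhS(2)] nL[OF vS]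
        by (simp add: h_def)
    next
      have int: "integrable M (\<lambda>\<omega>. abs_powr_deriv q i (L z \<bullet> \<omega>) * (real i * (L h \<bullet> \<omega>) ^ (i - 1) * (L v \<bullet> \<omega>)))"
        if "i \<le> p" for i v
      proof -
        have "integrable M (\<lambda>\<omega>. real i * (abs_powr_deriv q i (L z \<bullet> \<omega>) * ((L h \<bullet> \<omega>) ^ (i - 1) * (L v \<bullet> \<omega>) ^ 1)))"
          using that p pq by (intro integrable_mult_right integrable_power_form[OF _ AE_inner_power_le]) auto
        then show ?thesis by (simp add: mult_ac)
      qed
      have add: "power_form i (L z) (\<lambda>\<omega>. real i * (L h \<bullet> \<omega>) ^ (i - 1) * (L (v + w) \<bullet> \<omega>))
          = power_form i (L z) (\<lambda>\<omega>. real i * (L h \<bullet> \<omega>) ^ (i - 1) * (L v \<bullet> \<omega>))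
          + power_form i (L z) (\<lambda>\<omega>. real i * (L h \<bullet> \<omega>) ^ (i - 1) * (L w \<bullet> \<omega>))" if "i \<le> p" for i v w
        unfolding power_form_def Bochner_Integration.integral_add[OF int[OF that] int[OF that], symmetric]
        using L(1) by (simp add: linear_add inner_add_left algebra_simps)
      have scale: "power_form i (L z) (\<lambda>\<omega>. real i * (L h \<bullet> \<omega>) ^ (i - 1) * (L (c *\<^sub>R v) \<bullet> \<omega>))
          = c * power_form i (L z) (\<lambda>\<omega>. real i * (L h \<bullet> \<omega>) ^ (i - 1) * (L v \<bullet> \<omega>))" for i v c
        unfolding power_form_def integral_mult_right_zero[symmetric]
        using L(1) by (simp add: linear_scale mult_ac)
      show "linear_functional_on (span {u, u'}) F"
        unfolding linear_functional_on_def
      proof (intro conjI ballI allI)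
        fix v w
        show "F (v + w) = F v + F w"
          unfolding F_def sum.distrib[symmetric]
          by (rule sum.cong[OF refl]) (simp only: add atLeastAtMost_iff distrib_left)
      next
        fix c v
        show "F (c *\<^sub>R v) = c * F v"
          unfolding F_def sum_distrib_left by (rule sum.cong[OF refl]) (simp only: scale mult.left_commute)
      qed
    qed
  qed
  have D: "D v = F v" if "((\<lambda>t. reg_taylor p \<nu> x0 y (x + t *\<^sub>R v - y)) has_real_derivative F v) (at 0)" for F v
    unfolding D_def using that by (rule DERIV_imp_deriv)
  show thesis
  proof (rule that[of D])
    show "linear_functional_on E D"
      unfolding linear_functional_on_def
    proof (intro conjI ballI allI)
      fix u u' assume "u \<in> E" "u' \<in> E"
      from main[OF this] obtain F where
        F: "\<And>v. v \<in> span {u, u'} \<Longrightarrow> ((\<lambda>t. reg_taylor p \<nu> x0 y (x + t *\<^sub>R v - y)) has_real_derivative F v) (at 0)"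
          "linear_functional_on (span {u, u'}) F" by blast
      have "D v = F v" if "v \<in> span {u, u'}" for v using D F(1)[OF that] by blast
      then show "D (u + u') = D u + D u'"
        using F(2) by (simp add: linear_functional_on_def span_base span_add)
    next
      fix u c assume "u \<in> E"
      from main[OF this this] obtain F where
        F: "\<And>v. v \<in> span {u, u} \<Longrightarrow> ((\<lambda>t. reg_taylor p \<nu> x0 y (x + t *\<^sub>R v - y)) has_real_derivative F v) (at 0)"
          "linear_functional_on (span {u, u}) F" by blast
      have "D v = F v" if "v \<in> span {u, u}" for v using D F(1)[OF that] by blast
      then show "D (c *\<^sub>R u) = c * D u"
        using F(2) by (simp add: linear_functional_on_def span_base span_scale)
    qed
    fix u assume "u \<in> E"
    from main[OF this this] obtain F where
      F: "\<And>v. v \<in> span {u, u} \<Longrightarrow> ((\<lambda>t. reg_taylor p \<nu> x0 y (x + t *\<^sub>R v - y)) has_real_derivative F v) (at 0)"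
        "\<And>v. v \<in> span {u, u} \<Longrightarrow> \<bar>q * nrm (x - x0) powr (q - 2) * B (x - x0) v - F v\<bar>
        \<le> C_const p \<nu> / fact (p - 1) * (nrm (x - y) powr (q - 1) * nrm v)" by blast
    have uu: "u \<in> span {u, u}" by (simp add: span_base)
    have "D u = F u" using D F(1)[OF uu] by blast
    then show "((\<lambda>t. reg_taylor p \<nu> x0 y (x + t *\<^sub>R u - y)) has_real_derivative D u) (at 0)"
      "\<bar>q * nrm (x - x0) powr (q - 2) * B (x - x0) u - D u\<bar>
        \<le> C_const p \<nu> / fact (p - 1) * (nrm (x - y) powr (q - 1) * nrm u)"
      using F(1)[OF uu] F(2)[OF uu] by simp_all
  qed
qed

end

section \<open>Higher derivatives of the smooth part\<close>

lemma dir_deriv_cong: "(\<And>t. g (x + t *\<^sub>R h) = g' (x + t *\<^sub>R h)) \<Longrightarrow> dir_deriv g x h = dir_deriv g' x h"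
  by (simp add: dir_deriv_def)

lemma deriv_le_chord_slope:
  fixes g :: "real \<Rightarrow> real"
  assumes d: "(g has_real_derivative D) (at 0)"
    and c: "\<And>t. 0 < t \<Longrightarrow> t < 1 \<Longrightarrow> g t \<le> (1 - t) * g 0 + t * b"
  shows "D \<le> b - g 0"
proof (rule tendsto_upperbound)
  show "((\<lambda>t. (g (0 + t) - g 0) / t) \<longlongrightarrow> D) (at_right 0)"
    using d unfolding DERIV_def by (rule tendsto_mono[OF at_le, rotated]) simp
  have "(g (0 + t) - g 0) / t \<le> b - g 0" if "0 < t" "t < 1" for t
  proof -
    have "g t - g 0 \<le> (b - g 0) * t" using c[OF that] by (simp add: algebra_simps)
    then show ?thesis using that by (simp add: pos_divide_le_eq)
  qed
  then show "\<forall>\<^sub>F t in at_right 0. (g (0 + t) - g 0) / t \<le> b - g 0"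
    by (auto simp: eventually_at_right_field intro!: exI[of _ 1])
qed simp

section \<open>Linearity, symmetry and Hoelder bounds of iterated derivatives\<close>

context energy_space
begin

context
  fixes p :: nat and f :: "'a \<Rightarrow> real"
  assumes diff: "times_differentiable_on p f E"
begin

text \<open>Connects the Frechet derivatives of the hypothesis with \<open>nderiv\<close>, which is
  built from derivatives along lines. The claim for an arbitrary parameter \<open>s\<close> gives
  differentiability at every point of a line, not only at its base point.\<close>

lemma nderiv_frechet:
  assumes "set hs \<subseteq> E" "length hs < p" "x \<in> E"
  shows "\<exists>D. (nderiv f hs has_derivative D) (at x within E) \<and> linear D \<and>
    (\<forall>h\<in>E. nderiv f (h # hs) x = D h) \<and>
    (\<forall>h\<in>E. \<forall>y\<in>E. \<forall>s. x = y + s *\<^sub>R h \<longrightarrow>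
       ((\<lambda>t. nderiv f hs (y + t *\<^sub>R h)) has_real_derivative D h) (at s))"
proof -
  have "nderiv f hs differentiable_on E"
    using diff assms unfolding times_differentiable_on_def by blast
  then obtain D where D: "(nderiv f hs has_derivative D) (at x within E)"
    using assms(3) unfolding differentiable_on_def differentiable_def by blast
  have lin: "linear D" using D has_derivative_bounded_linear bounded_linear.linear by blast
  have line: "((\<lambda>t. nderiv f hs (y + t *\<^sub>R h)) has_real_derivative D h) (at s)"
    if "h \<in> E" "x = y + s *\<^sub>R h" "y \<in> E" for h s y
  proof -
    have 1: "((\<lambda>t. y + t *\<^sub>R h) has_derivative (\<lambda>t. t *\<^sub>R h)) (at s)"
      by (auto intro!: derivative_eq_intros)
    have "(nderiv f hs has_derivative D) (at (y + s *\<^sub>R h) within range (\<lambda>t. y + t *\<^sub>R h))"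
    proof (rule has_derivative_subset)
      show "(nderiv f hs has_derivative D) (at (y + s *\<^sub>R h) within E)" using D unfolding that(2) .
      show "range (\<lambda>t. y + t *\<^sub>R h) \<subseteq> E" using that(1,3) by auto
    qed
    from diff_chain_within[OF 1 this]
    have "((\<lambda>t. nderiv f hs (y + t *\<^sub>R h)) has_derivative (\<lambda>t. D (t *\<^sub>R h))) (at s)"
      by (simp add: o_def)
    then show ?thesis
      by (rule has_derivative_imp_has_field_derivative) (simp add: linear_scale[OF lin])
  qed
  have "nderiv f (h # hs) x = D h" if "h \<in> E" for h
    using line[OF that, of x 0] assms(3) by (simp add: dir_deriv_eqI)
  with D line lin show ?thesis by (intro exI[of _ D]) simp
qed

lemma nderiv_line:
  assumes "set hs \<subseteq> E" "length hs < p" "y \<in> E" "h \<in> E"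
  shows "((\<lambda>t. nderiv f hs (y + t *\<^sub>R h)) has_real_derivative nderiv f (h # hs) (y + s *\<^sub>R h)) (at s)"
proof -
  have "y + s *\<^sub>R h \<in> E" using assms by auto
  from nderiv_frechet[OF assms(1,2) this] obtain D where
    "((\<lambda>t. nderiv f hs (y + t *\<^sub>R h)) has_real_derivative D h) (at s)"
    "nderiv f (h # hs) (y + s *\<^sub>R h) = D h" using assms(3,4) by blast
  then show ?thesis by simp
qed

lemma nderiv_head_linear:
  assumes "set hs \<subseteq> E" "length hs < p" "x \<in> E"
  shows "linear_functional_on E (\<lambda>h. nderiv f (h # hs) x)"
proof -
  from nderiv_frechet[OF assms] obtain D where D: "\<And>h. h \<in> E \<Longrightarrow> nderiv f (h # hs) x = D h" "linear D"
    by blast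
  show ?thesis unfolding linear_functional_on_def
    by (intro conjI ballI allI)
      (simp_all only: D(1) E_closed linear_add[OF D(2)] linear_scale[OF D(2)] real_scaleR_def)
qed

text \<open>The key to symmetry of second derivatives without assuming them continuous: the mean
  value theorem in direction \<open>a\<close> leaves a difference of first derivatives, which
  Frechet differentiability at \<open>z\<close> evaluates. The second difference itself is symmetric
  in \<open>a\<close> and \<open>b\<close>.\<close>

lemma second_difference_limit:
  assumes hs: "set hs \<subseteq> E" "length hs + 2 \<le> p" and z: "z \<in> E" "a \<in> E" "b \<in> E"
  defines "\<phi> \<equiv> nderiv f hs"
  shows "((\<lambda>t. (\<phi> (z + t *\<^sub>R a + t *\<^sub>R b) - \<phi> (z + t *\<^sub>R a) - \<phi> (z + t *\<^sub>R b) + \<phi> z) / t\<^sup>2)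
           \<longlongrightarrow> nderiv f (b # a # hs) z) (at_right 0)"
proof -
  define \<phi>a where "\<phi>a = nderiv f (a # hs)"
  have "set (a # hs) \<subseteq> E" "length (a # hs) < p" using hs z by auto
  from nderiv_frechet[OF this z(1)] obtain D where
    D: "(\<phi>a has_derivative D) (at z within E)" "nderiv f (b # a # hs) z = D b" "linear D"
    unfolding \<phi>a_def using z(3) by blast
  \<comment> \<open>\<open>t * c\<close> bounds the sum of the norms of the two displacements
    \<open>u\<close> and \<open>v\<close> below; the summand 1 keeps \<open>c\<close> positive when
    both directions vanish.\<close>
  define c where "c = 2 * norm a + norm b + 1"
  have c: "c > 0" by (simp add: c_def add_nonneg_pos)
  show ?thesis
  proof (rule tendstoI)
    fix e :: real assume e: "e > 0"
    define e' where "e' = e / (2 * c)"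
    have e': "e' > 0" using e c by (simp add: e'_def)
    obtain d where d: "d > 0" "\<And>w. w \<in> E \<Longrightarrow> norm (w - z) < d \<Longrightarrow> \<bar>\<phi>a w - \<phi>a z - D (w - z)\<bar> \<le> e' * norm (w - z)"
      using D(1) e' unfolding has_derivative_within_alt by (auto simp: real_norm_def)
    have "dist ((\<phi> (z + t *\<^sub>R a + t *\<^sub>R b) - \<phi> (z + t *\<^sub>R a) - \<phi> (z + t *\<^sub>R b) + \<phi> z) / t\<^sup>2) (D b) < e"
      if t: "0 < t" "t < d / c" for t
    proof -
      \<comment> \<open>The increment along \<open>b\<close> is frozen and the point moves along
        \<open>a\<close>, so \<open>g t - g 0\<close> is the second difference.\<close>
      define g where "g s = \<phi> (z + t *\<^sub>R b + s *\<^sub>R a) - \<phi> (z + s *\<^sub>R a)" for s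
      have "(g has_real_derivative \<phi>a (z + t *\<^sub>R b + s *\<^sub>R a) - \<phi>a (z + s *\<^sub>R a)) (at s)" for s
        unfolding g_def \<phi>_def \<phi>a_def using hs z by (intro DERIV_diff nderiv_line) auto
      from MVT2[OF t(1), of g, OF this] obtain \<xi> where
        \<xi>: "0 < \<xi>" "\<xi> < t" "g t - g 0 = t * (\<phi>a (z + t *\<^sub>R b + \<xi> *\<^sub>R a) - \<phi>a (z + \<xi> *\<^sub>R a))" by auto
      define u v where "u = t *\<^sub>R b + \<xi> *\<^sub>R a" and "v = \<xi> *\<^sub>R a"
      have uvE: "u \<in> E" "v \<in> E" using z by (auto simp: u_def v_def)
      have nv: "norm v \<le> t * norm a" using \<xi> by (simp add: v_def mult_right_mono)
      have nu: "norm u \<le> t * norm a + t * norm b"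
        using norm_triangle_ineq[of "t *\<^sub>R b" "\<xi> *\<^sub>R a"] nv t by (simp add: u_def v_def)
      have sum: "norm u + norm v \<le> t * (2 * norm a + norm b)" using nu nv by (simp add: algebra_simps)
      have tc: "t * c < d" using t c by (simp add: field_simps)
      have "t * (2 * norm a + norm b) \<le> t * c" using t by (intro mult_left_mono) (auto simp: c_def)
      then have lt: "norm u < d" "norm v < d" using sum tc norm_ge_zero[of u] norm_ge_zero[of v] by linarith+
      have "\<bar>\<phi>a (z + u) - \<phi>a (z + v) - (D u - D v)\<bar> \<le> e' * norm u + e' * norm v"
        using d(2)[of "z + u"] d(2)[of "z + v"] lt uvE z by simp
      also have "\<dots> \<le> e' * (t * (2 * norm a + norm b))"
        using sum e' by (simp flip: distrib_left)
      also have "D u - D v = t * D b"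
        using D(3) by (simp add: u_def v_def linear_add linear_scale)
      finally have 1: "\<bar>\<phi>a (z + u) - \<phi>a (z + v) - t * D b\<bar> \<le> e' * (t * (2 * norm a + norm b))" .
      have "\<phi> (z + t *\<^sub>R a + t *\<^sub>R b) - \<phi> (z + t *\<^sub>R a) - \<phi> (z + t *\<^sub>R b) + \<phi> z = g t - g 0"
        by (simp add: g_def add_ac)
      also have "\<dots> = t * (\<phi>a (z + u) - \<phi>a (z + v))"
        using \<xi>(3) by (simp add: u_def v_def add_ac)
      finally have eq: "\<phi> (z + t *\<^sub>R a + t *\<^sub>R b) - \<phi> (z + t *\<^sub>R a) - \<phi> (z + t *\<^sub>R b) + \<phi> z
          = t * (\<phi>a (z + u) - \<phi>a (z + v))" .
      have "(\<phi> (z + t *\<^sub>R a + t *\<^sub>R b) - \<phi> (z + t *\<^sub>R a) - \<phi> (z + t *\<^sub>R b) + \<phi> z) / t\<^sup>2 - D b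
          = (\<phi>a (z + u) - \<phi>a (z + v) - t * D b) / t"
        unfolding eq using t by (simp add: power2_eq_square diff_divide_distrib)
      then have "dist ((\<phi> (z + t *\<^sub>R a + t *\<^sub>R b) - \<phi> (z + t *\<^sub>R a) - \<phi> (z + t *\<^sub>R b) + \<phi> z) / t\<^sup>2) (D b)
          \<le> e' * (2 * norm a + norm b)"
        using 1 t by (simp add: dist_real_def divide_le_eq mult_ac)
      also have "\<dots> \<le> e' * c" using e' by (intro mult_left_mono) (auto simp: c_def)
      also have "\<dots> < e" using e c by (simp add: e'_def)
      finally show ?thesis .
    qed
    then show "\<forall>\<^sub>F t in at_right 0. dist ((\<phi> (z + t *\<^sub>R a + t *\<^sub>R b) - \<phi> (z + t *\<^sub>R a) - \<phi> (z + t *\<^sub>R b) + \<phi> z) / t\<^sup>2)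
        (nderiv f (b # a # hs) z) < e"
      using d(1) c D(2) by (auto simp: eventually_at_right_field intro!: exI[of _ "d / c"])
  qed
qed

lemma nderiv_swap:
  assumes hs: "set hs \<subseteq> E" "length hs + 2 \<le> p" and z: "z \<in> E" "a \<in> E" "b \<in> E"
  shows "nderiv f (b # a # hs) z = nderiv f (a # b # hs) z"
proof (rule tendsto_unique[OF _ second_difference_limit[OF assms]])
  show "((\<lambda>t. (nderiv f hs (z + t *\<^sub>R a + t *\<^sub>R b) - nderiv f hs (z + t *\<^sub>R a) - nderiv f hs (z + t *\<^sub>R b)
      + nderiv f hs z) / t\<^sup>2) \<longlongrightarrow> nderiv f (a # b # hs) z) (at_right 0)"
    using second_difference_limit[OF hs z(1,3,2)] by (simp add: algebra_simps)
qed simp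

lemma nderiv_move:
  assumes "x \<in> E" "set ys \<subseteq> E" "set zs \<subseteq> E" "Suc (length ys + length zs) \<le> p" "z \<in> E"
  shows "nderiv f (x # ys @ zs) z = nderiv f (ys @ x # zs) z"
  using assms(2,4,5)
proof (induction ys arbitrary: z)
  case (Cons y ys)
  have "nderiv f (x # y # ys @ zs) z = nderiv f (y # x # ys @ zs) z"
    using Cons.prems assms by (intro nderiv_swap) auto
  also have "\<dots> = nderiv f (y # ys @ x # zs) z"
    unfolding nderiv.simps(2)[of f y]
    using Cons.prems by (intro dir_deriv_cong Cons.IH) auto
  finally show ?case by simp
qed simp

text \<open>Linearity splits one of the \<open>j\<close> perturbed entries into \<open>h\<close>
  plus \<open>t\<close> times \<open>u\<close>; symmetry moves it into the tail, where the induction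
  hypothesis for \<open>j\<close> applies. This is why the tail \<open>ks\<close> is general. The
  term with \<open>u\<close> carries the factor \<open>t\<close>, so only its value at 0
  contributes.\<close>

lemma has_derivative_nderiv_replicate:
  assumes "h \<in> E" "u \<in> E" "set ks \<subseteq> E" "j + length ks \<le> p" "y \<in> E"
  shows "((\<lambda>t. nderiv f (replicate j (h + t *\<^sub>R u) @ ks) y) has_real_derivative
           real j * nderiv f (replicate (j - 1) h @ u # ks) y) (at 0)"
  using assms(3,4)
proof (induction j arbitrary: ks)
  case 0
  then show ?case by simp
next
  case (Suc j)
  have split: "nderiv f (replicate (Suc j) (h + t *\<^sub>R u) @ ks) y
      = nderiv f (replicate j (h + t *\<^sub>R u) @ h # ks) y + t * nderiv f (replicate j (h + t *\<^sub>R u) @ u # ks) y" for t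
  proof -
    let ?r = "replicate j (h + t *\<^sub>R u)"
    have "set (?r @ ks) \<subseteq> E" "length (?r @ ks) < p" using Suc.prems assms by auto
    from nderiv_head_linear[OF this assms(5)]
    have "nderiv f ((h + t *\<^sub>R u) # ?r @ ks) y = nderiv f (h # ?r @ ks) y + t * nderiv f (u # ?r @ ks) y"
      using assms(1,2) by (simp only: linear_functional_on_def E_closed)
    moreover have "nderiv f (v # ?r @ ks) y = nderiv f (?r @ v # ks) y" if "v \<in> E" for v
      using Suc.prems assms that by (intro nderiv_move) auto
    ultimately show ?thesis using assms(1,2) by simp
  qed
  have 1: "((\<lambda>t. nderiv f (replicate j (h + t *\<^sub>R u) @ h # ks) y) has_real_derivative
           real j * nderiv f (replicate (j - 1) h @ u # h # ks) y) (at 0)"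
    using Suc.IH[of "h # ks"] Suc.prems assms by auto
  have 2: "((\<lambda>t. nderiv f (replicate j (h + t *\<^sub>R u) @ u # ks) y) has_real_derivative
           real j * nderiv f (replicate (j - 1) h @ u # u # ks) y) (at 0)"
    using Suc.IH[of "u # ks"] Suc.prems assms by auto
  \<comment> \<open>The entry \<open>h\<close> put into the tail is moved back to the block, so that
    all j + 1 contributions have the same form.\<close>
  have mv: "real j * nderiv f (replicate (j - 1) h @ u # h # ks) y = real j * nderiv f (replicate j h @ u # ks) y"
  proof (cases j)
    case (Suc l)
    have "nderiv f (replicate l h @ u # h # ks) y = nderiv f (u # replicate l h @ h # ks) y"
      using Suc.prems assms Suc by (intro nderiv_move[symmetric]) auto
    also have "replicate l h @ h # ks = replicate j h @ ks"
      using Suc replicate_app_Cons_same[of l h ks] by simp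
    also have "nderiv f (u # replicate j h @ ks) y = nderiv f (replicate j h @ u # ks) y"
      using Suc.prems assms by (intro nderiv_move) auto
    finally show ?thesis using Suc by simp
  qed simp
  have "((\<lambda>t. nderiv f (replicate j (h + t *\<^sub>R u) @ h # ks) y + t * nderiv f (replicate j (h + t *\<^sub>R u) @ u # ks) y)
      has_real_derivative (real j * nderiv f (replicate (j - 1) h @ u # h # ks) y
        + (1 * nderiv f (replicate j (h + 0 *\<^sub>R u) @ u # ks) y + real j * nderiv f (replicate (j - 1) h @ u # u # ks) y * 0))) (at 0)"
    by (intro DERIV_add DERIV_mult 1 2 DERIV_ident)
  from this[unfolded mv] show ?case unfolding split by (simp add: algebra_simps)
qed

lemma nderiv_scale:
  assumes "set hs \<subseteq> E" "length hs \<le> p" "x \<in> E"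
  shows "nderiv f (map (\<lambda>h. c h *\<^sub>R h) hs) x = prod_list (map c hs) * nderiv f hs x"
  using assms
proof (induction hs arbitrary: x)
  case (Cons h hs)
  let ?m = "map (\<lambda>h. c h *\<^sub>R h) hs"
  have m: "set ?m \<subseteq> E" "length ?m < p" using Cons.prems by auto
  have hE: "h \<in> E" using Cons.prems by auto
  have "nderiv f (c h *\<^sub>R h # ?m) x = c h * nderiv f (h # ?m) x"
    using nderiv_head_linear[OF m Cons.prems(3)] hE unfolding linear_functional_on_def by blast
  also have "nderiv f (h # ?m) x = dir_deriv (\<lambda>z. prod_list (map c hs) * nderiv f hs z) x h"
    unfolding nderiv.simps(2)[of f h] using Cons.prems
    by (intro dir_deriv_cong Cons.IH) auto
  also have "\<dots> = prod_list (map c hs) * nderiv f (h # hs) x"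
    using nderiv_line[of hs x h 0] Cons.prems by (intro dir_deriv_eqI DERIV_cmult) auto
  finally show ?case by simp
qed simp

text \<open>\<open>form_norm\<close> tests only directions in the unit ball, so the given directions
  are normalised and multilinearity restores their lengths. Zero directions cannot be normalised and
  are treated first.\<close>

lemma nderiv_holder:
  assumes hc: "holder_const E B p \<nu> f = ennreal Hf" "0 \<le> Hf"
    and hs: "set hs \<subseteq> E" "length hs = p" and xy: "x \<in> E" "y \<in> E"
  shows "\<bar>nderiv f hs x - nderiv f hs y\<bar> \<le> Hf * nrm (x - y) powr \<nu> * prod_list (map nrm hs)"
proof (cases "x = y \<or> 0 \<in> set hs")
  case True
  have pn: "0 \<le> prod_list (map nrm hs)" using hs(1) by (intro prod_list_nonneg) auto
  have "nderiv f hs z = 0" if "0 \<in> set hs" "z \<in> E" for z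
  proof -
    \<comment> \<open>These factors leave the list unchanged, since zero times zero is zero, but
      their product is 0, so homogeneity makes the form vanish.\<close>
    define c where "c h = (if h = (0::'a) then 0 else 1 :: real)" for h
    have "map (\<lambda>h. c h *\<^sub>R h) hs = hs" by (rule map_idI) (simp add: c_def)
    moreover have "prod_list (map c hs) = 0" using that by (auto simp: prod_list_zero_iff c_def)
    ultimately show ?thesis using nderiv_scale[of hs z c] hs that by simp
  qed
  then show ?thesis using True xy hc(2) pn by auto
next
  case False
  have pos: "0 < nrm h" if "h \<in> set hs" for h
    using that False hs by (intro nrm_pos) auto
  define r where "r = nrm (x - y) powr \<nu>"
  have r: "r > 0" using False xy nrm_pos[of "x - y"] by (simp add: r_def)
  define c where "c h = 1 / nrm h" for h
  let ?m = "map (\<lambda>h. c h *\<^sub>R h) hs"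
  have m: "set ?m \<subseteq> E" "length ?m = p" "\<And>h. h \<in> set ?m \<Longrightarrow> nrm h \<le> 1"
    using hs pos by (auto simp: nrm_scale c_def)
  define A where "A hs = nderiv f hs x - nderiv f hs y" for hs
  have "ennreal \<bar>A ?m\<bar> \<le> form_norm E B p A"
    unfolding form_norm_def using m by (intro SUP_upper) auto
  then have "ennreal \<bar>A ?m\<bar> / ennreal r \<le> form_norm E B p A / ennreal r"
    by (rule divide_right_mono_ennreal)
  also have "\<dots> \<le> holder_const E B p \<nu> f"
    unfolding holder_const_def r_def A_def
    using xy False by (intro SUP_upper2[of "(x, y)"]) auto
  finally have "\<bar>A ?m\<bar> \<le> Hf * r"
    using r hc by (simp add: divide_ennreal divide_le_eq)
  moreover have "A ?m = prod_list (map c hs) * A hs"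
    unfolding A_def using hs xy by (simp add: nderiv_scale right_diff_distrib)
  moreover have cp: "0 < prod_list (map c hs)"
    using pos by (induction hs) (auto simp: c_def)
  ultimately have "prod_list (map c hs) * \<bar>A hs\<bar> \<le> Hf * r" by (simp add: abs_mult)
  moreover have "0 < prod_list (map nrm hs)"
    using pos by (induction hs) auto
  ultimately have "prod_list (map nrm hs) * (prod_list (map c hs) * \<bar>A hs\<bar>) \<le> prod_list (map nrm hs) * (Hf * r)"
    by (intro mult_left_mono) auto
  moreover have "prod_list (map c hs) * prod_list (map nrm hs) = 1"
    using pos
  proof (induction hs)
    case (Cons h hs)
    have "nrm h \<noteq> 0" using Cons.prems[of h] by simp
    then have "prod_list (map c (h # hs)) * prod_list (map nrm (h # hs)) = prod_list (map c hs) * prod_list (map nrm hs)"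
      by (simp add: c_def)
    then show ?case using Cons by simp
  qed simp
  then have "prod_list (map nrm hs) * (prod_list (map c hs) * a) = a" for a
    by (simp add: mult.commute[of "prod_list (map nrm hs)"] mult.assoc[symmetric])
  ultimately have "\<bar>A hs\<bar> \<le> prod_list (map nrm hs) * (Hf * r)" by (simp only:)
  then show ?thesis by (simp add: A_def r_def mult_ac)
qed

definition smooth_taylor :: "'a \<Rightarrow> 'a \<Rightarrow> real" where
  "smooth_taylor y h = (\<Sum>i=1..p. 1 / fact i * nderiv f (replicate i h) y)"

text \<open>With \<open>u\<close> fixed the gradient is followed along the segment from
  \<open>y\<close> to \<open>x\<close>, which reduces the claim to the scalar Taylor estimate
  between 0 and 1.\<close>

lemma smooth_taylor_derivative:
  assumes p: "2 \<le> p" "0 \<le> \<nu>" "\<nu> \<le> 1" and q: "q = real p + \<nu>"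
    and hc: "holder_const E B p \<nu> f = ennreal Hf" "0 \<le> Hf" and E: "x \<in> E" "y \<in> E"
  obtains D where "linear_functional_on E D"
    "\<And>u. u \<in> E \<Longrightarrow> ((\<lambda>t. smooth_taylor y (x + t *\<^sub>R u - y)) has_real_derivative D u) (at 0)"
    "\<And>u. u \<in> E \<Longrightarrow> \<bar>grad f x u - D u\<bar> \<le> Hf / fact (p - 1) * (nrm (x - y) powr (q - 1) * nrm u)"
proof -
  define h where "h = x - y"
  have hE: "h \<in> E" using E by (auto simp: h_def)
  define D where "D u = (\<Sum>i=1..p. 1 / fact i * (real i * nderiv f (replicate (i - 1) h @ [u]) y))" for u
  have mv: "nderiv f (replicate (i - 1) h @ [u]) y = nderiv f (u # replicate (i - 1) h) y"
    if "i \<in> {1..p}" "u \<in> E" for i u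
  proof -
    have "nderiv f (u # replicate (i - 1) h @ []) y = nderiv f (replicate (i - 1) h @ u # []) y"
      using that hE E by (intro nderiv_move) auto
    then show ?thesis by simp
  qed
  have lin: "linear_functional_on E (\<lambda>u. nderiv f (u # replicate (i - 1) h) y)" if "i \<in> {1..p}" for i
    using that hE E by (intro nderiv_head_linear) auto
  have 1: "linear_functional_on E D"
    unfolding linear_functional_on_def
  proof (intro conjI ballI allI)
    fix v w assume "v \<in> E" "w \<in> E"
    then show "D (v + w) = D v + D w"
      unfolding D_def sum.distrib[symmetric]
      using lin by (intro sum.cong refl) (simp only: mv E_closed linear_functional_on_def distrib_left)
  next
    fix c v assume "v \<in> E"
    then show "D (c *\<^sub>R v) = c * D v"
      unfolding D_def sum_distrib_left
      using lin by (intro sum.cong refl) (simp only: mv E_closed linear_functional_on_def mult.left_commute)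
  qed
  have 2: "((\<lambda>t. smooth_taylor y (x + t *\<^sub>R u - y)) has_real_derivative D u) (at 0)" if "u \<in> E" for u
  proof -
    have "((\<lambda>t. nderiv f (replicate i (h + t *\<^sub>R u)) y) has_real_derivative
        real i * nderiv f (replicate (i - 1) h @ [u]) y) (at 0)" if "i \<in> {1..p}" for i
      using has_derivative_nderiv_replicate[of h u "[]" i y] that hE E \<open>u \<in> E\<close> by simp
    then have "((\<lambda>t. smooth_taylor y (h + t *\<^sub>R u)) has_real_derivative D u) (at 0)"
      unfolding smooth_taylor_def D_def by (intro DERIV_sum DERIV_cmult)
    then show ?thesis by (simp add: h_def add_diff_eq diff_add_eq)
  qed
  have 3: "\<bar>grad f x u - D u\<bar> \<le> Hf / fact (p - 1) * (nrm (x - y) powr (q - 1) * nrm u)" if u: "u \<in> E" for u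
  proof -
    define n where "n = p - 2"
    have pn: "p = Suc (Suc n)" using p by (simp add: n_def)
    \<comment> \<open>\<open>u\<close> is the innermost direction, so that a further
      \<open>h\<close> at the head is exactly a derivative along the segment.\<close>
    define G where "G i t = nderiv f (replicate i h @ [u]) (y + t *\<^sub>R h)" for i t
    have G: "(G i has_real_derivative G (Suc i) t) (at t)" if "i \<le> n" for i t
    proof -
      have "set (replicate i h @ [u]) \<subseteq> E" "length (replicate i h @ [u]) < p"
        using that hE u pn by auto
      from nderiv_line[OF this E(2) hE] show ?thesis by (simp add: G_def[abs_def])
    qed
    define K where "K = Hf * nrm h powr \<nu> * (nrm h ^ (p - 1) * nrm u)"
    have K0: "0 \<le> K" using hc(2) hE u by (simp add: K_def)
    have hold: "\<bar>G (Suc n) s - G (Suc n) t\<bar> \<le> K * \<bar>s - t\<bar> powr \<nu>" for s t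
    proof -
      have "\<bar>G (Suc n) s - G (Suc n) t\<bar> \<le> Hf * nrm ((y + s *\<^sub>R h) - (y + t *\<^sub>R h)) powr \<nu>
          * prod_list (map nrm (replicate (Suc n) h @ [u]))"
        unfolding G_def using hE u E pn by (intro nderiv_holder[OF hc]) auto
      also have "(y + s *\<^sub>R h) - (y + t *\<^sub>R h) = (s - t) *\<^sub>R h" by (simp add: scaleR_diff_left)
      finally show ?thesis using hE
        by (simp add: K_def nrm_scale powr_mult pn mult_ac)
    qed
    have "continuous_on UNIV (G n)"
      using G[of n] DERIV_isCont by (blast intro: continuous_at_imp_continuous_on)
    then have top: "\<bar>G n t - G n 0 - (t - 0) * G (Suc n) 0\<bar> \<le> K * \<bar>t - 0\<bar> powr (\<nu> + 1)" for t
      using G[of n] hold K0 p by (intro first_order_holder_bound) auto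
    have "\<bar>G 0 1 - (\<Sum>i\<le>Suc n. G i 0 * (1 - 0) ^ i / fact i)\<bar> \<le> K * \<bar>1 - 0\<bar> powr (\<nu> + 1 + n) / fact (Suc n)"
      using G top K0 p by (intro taylor_holder_bound) auto
    moreover have "G 0 1 = grad f x u" by (simp add: G_def grad_def h_def)
    moreover have "(\<Sum>i\<le>Suc n. G i 0 * (1 - 0) ^ i / fact i) = D u"
      unfolding D_def
    proof (rule sum.reindex_bij_witness[of _ "\<lambda>i. i - 1" Suc])
      fix i assume "i \<in> {..Suc n}"
      show "1 / fact (Suc i) * (real (Suc i) * nderiv f (replicate (Suc i - 1) h @ [u]) y) = G i 0 * (1 - 0) ^ i / fact i"
        by (simp add: G_def fact_Suc del: of_nat_Suc)
    qed (auto simp: pn)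
    moreover have "K = Hf * (nrm h powr (q - 1) * nrm u)"
    proof (cases "h = 0")
      case False
      have "q - 1 = \<nu> + real (p - 1)" using p q by (simp add: of_nat_diff)
      then have "nrm h powr (q - 1) = nrm h powr \<nu> * nrm h ^ (p - 1)"
        using nrm_pos[OF hE False] by (simp only: powr_add powr_realpow)
      then show ?thesis by (simp add: K_def)
    qed (use p q in \<open>simp add: K_def\<close>)
    ultimately show ?thesis by (simp add: pn h_def)
  qed
  from that[OF 1 2 3] show thesis .
qed

end

end

section \<open>The regularized composite problem\<close>

locale composite_problem = energy_space E B
  for E :: "'a::real_normed_vector set" and B +
  fixes p :: nat and \<nu> Hf \<theta> :: real and f :: "'a \<Rightarrow> real" and \<phi> :: "'a \<Rightarrow> ereal" and x0 :: 'a and \<delta> :: real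
  assumes p: "2 \<le> p" and \<nu>: "0 \<le> \<nu>" "\<nu> \<le> 1" and Hf: "0 \<le> Hf" and \<theta>: "0 \<le> \<theta>"
    and f_convex: "convex_on E f" and f_diff: "times_differentiable_on p f E"
    and f_holder: "holder_const E B p \<nu> f = ennreal Hf"
    and \<phi>_proper: "\<And>x. x \<in> E \<Longrightarrow> \<phi> x \<noteq> - \<infinity>"
    and \<phi>_convex: "convex (ext_epigraph E \<phi>)"
    and x0: "x0 \<in> E" and \<delta>: "0 < \<delta>"
begin

definition q :: real where "q = real p + \<nu>"
definition F :: "'a \<Rightarrow> real" where "F = reg_fun B p \<nu> f x0 \<delta>"
text \<open>\<open>real_of_ereal\<close> sends infinity to 0, so this is the objective only on
  \<open>dom\<close>, to which all statements about it are restricted.\<close>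

definition Ft :: "'a \<Rightarrow> real" where "Ft x = F x + real_of_ereal (\<phi> x)"
text \<open>\<open>H_delta\<close> divided by p!, the coefficient of the power term in the
  model.\<close>

definition lam :: real where "lam = (Hf + \<delta> / q * C_const p \<nu>) / fact (p - 1) + 3 * \<theta>"
abbreviation dom where "dom \<equiv> eff_dom E \<phi>"
abbreviation accelerated where "accelerated \<equiv> alg5 E B p \<nu> Hf \<theta> f \<phi> x0 \<delta>"
abbreviation acceptable where "acceptable \<equiv> tensor_step E B p \<nu> Hf \<theta> f \<phi> x0 \<delta>"

lemma q_ge: "2 \<le> q" using p \<nu> by (simp add: q_def)
lemma C_const_pos: "0 < C_const p \<nu>"
  unfolding C_const_def using \<nu> by (intro mult_pos_pos prod_pos) auto

lemma lam_pos: "0 < lam"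
  unfolding lam_def using Hf \<theta> \<delta> C_const_pos q_ge by (intro add_pos_nonneg divide_pos_pos add_nonneg_pos) auto

lemma H_delta_eq: "H_delta p \<nu> Hf \<theta> \<delta> = fact p * lam"
proof -
  have "(fact p :: real) = real p * fact (p - 1)" using p by (cases p) auto
  then show ?thesis by (simp add: H_delta_def lam_def q_def field_simps)
qed

lemma H_delta_pos: "0 < H_delta p \<nu> Hf \<theta> \<delta>"
  using lam_pos by (simp add: H_delta_eq)

lemma dom_E: "x \<in> dom \<Longrightarrow> x \<in> E"
  by (simp add: eff_dom_def)

lemma \<phi>_real: "x \<in> dom \<Longrightarrow> \<phi> x = ereal (real_of_ereal (\<phi> x))"
  using \<phi>_proper[of x] by (cases "\<phi> x") (auto simp: eff_dom_def)

lemma dom_convex: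
  assumes "x \<in> dom" "y \<in> dom" "0 \<le> t" "t \<le> 1"
  shows "(1 - t) *\<^sub>R x + t *\<^sub>R y \<in> dom"
    "real_of_ereal (\<phi> ((1 - t) *\<^sub>R x + t *\<^sub>R y)) \<le> (1 - t) * real_of_ereal (\<phi> x) + t * real_of_ereal (\<phi> y)"
proof -
  let ?z = "(1 - t) *\<^sub>R x + t *\<^sub>R y"
  let ?v = "(1 - t) * real_of_ereal (\<phi> x) + t * real_of_ereal (\<phi> y)"
  have "(x, real_of_ereal (\<phi> x)) \<in> ext_epigraph E \<phi>" "(y, real_of_ereal (\<phi> y)) \<in> ext_epigraph E \<phi>"
    using assms \<phi>_real dom_E by (auto simp: ext_epigraph_def)
  then have "(1 - t) *\<^sub>R (x, real_of_ereal (\<phi> x)) + t *\<^sub>R (y, real_of_ereal (\<phi> y)) \<in> ext_epigraph E \<phi>"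
    using \<phi>_convex assms unfolding convex_def by (metis diff_add_cancel diff_ge_0_iff_ge)
  then have z: "?z \<in> E" "\<phi> ?z \<le> ereal ?v" by (auto simp: ext_epigraph_def)
  then show "?z \<in> dom" by (auto simp: eff_dom_def)
  then show "real_of_ereal (\<phi> ?z) \<le> ?v" using z(2) \<phi>_real[of ?z] by (metis ereal_less_eq(3))
qed

section \<open>Gradients of the regularized objective and of the model\<close>

lemma F_eq: "F x = f x + \<delta> / q * nrm (x - x0) powr q"
  by (simp add: F_def reg_fun_def pow_reg_def q_def)

lemma f_line_derivative:
  assumes "x \<in> E" "u \<in> E"
  shows "((\<lambda>t. f (x + t *\<^sub>R u)) has_real_derivative grad f x u) (at 0)"
  using nderiv_line[OF f_diff, of "[]" x u 0] p assms by (simp add: grad_def)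

lemma F_line_derivative:
  assumes "x \<in> E" "u \<in> E"
  shows "((\<lambda>t. F (x + t *\<^sub>R u)) has_real_derivative
           grad f x u + \<delta> * nrm (x - x0) powr (q - 2) * B (x - x0) u) (at 0)"
proof -
  have "((\<lambda>t. nrm (x - x0 + t *\<^sub>R u) powr q) has_real_derivative q * nrm (x - x0) powr (q - 2) * B (x - x0) u) (at 0)"
    using assms x0 q_ge by (intro has_derivative_nrm_powr) auto
  from DERIV_add[OF f_line_derivative[OF assms] DERIV_cmult[OF this, of "\<delta> / q"]]
  show ?thesis using q_ge
    by (simp add: F_eq diff_add_eq mult_ac)
qed

lemma grad_F: "x \<in> E \<Longrightarrow> u \<in> E \<Longrightarrow> grad F x u = grad f x u + \<delta> * nrm (x - x0) powr (q - 2) * B (x - x0) u"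
  unfolding grad_def using F_line_derivative by (simp add: dir_deriv_eqI grad_def)

lemma linear_functional_on_grad_f: "x \<in> E \<Longrightarrow> linear_functional_on E (grad f x)"
  using nderiv_head_linear[OF f_diff, of "[]" x] p by (simp add: grad_def[abs_def])

lemma linear_functional_on_grad_F: "x \<in> E \<Longrightarrow> linear_functional_on E (grad F x)"
  using linear_functional_on_grad_f[of x] unfolding linear_functional_on_def
  by (simp add: grad_F B_simps algebra_simps)

lemma grad_F_ineq:
  assumes "w \<in> E" "x \<in> E"
  shows "F w + grad F w (x - w) \<le> F x"
proof -
  have "grad f w (x - w) \<le> f x - f (w + 0 *\<^sub>R (x - w))"
  proof (rule deriv_le_chord_slope[OF f_line_derivative])
    fix t :: real assume t: "0 < t" "t < 1"
    have "f ((1 - t) *\<^sub>R w + t *\<^sub>R x) \<le> (1 - t) * f w + t * f x"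
      using f_convex assms t unfolding convex_on_def by auto
    moreover have "(1 - t) *\<^sub>R w + t *\<^sub>R x = w + t *\<^sub>R (x - w)" by (simp add: algebra_simps)
    ultimately show "f (w + t *\<^sub>R (x - w)) \<le> (1 - t) * f (w + 0 *\<^sub>R (x - w)) + t * f x" by simp
  qed (use assms in auto)
  \<comment> \<open>Convexity of the norm power: Cauchy-Schwarz replaces the inner product by
    lengths, and the tangent form of Young's inequality compares the powers.\<close>
  moreover have "q * (nrm (w - x0) powr (q - 2) * B (w - x0) (x - w)) \<le> nrm (x - x0) powr q - nrm (w - x0) powr q"
  proof -
    define a b where "a = w - x0" and "b = x - x0"
    have ab: "a \<in> E" "b \<in> E" using assms x0 by (auto simp: a_def b_def)
    have pa: "nrm a powr (q - 2) * (nrm a * c) = nrm a powr (q - 1) * c" for c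
      using ab q_ge powr_add[of "nrm a" "q - 2" 1] by (cases "nrm a = 0") auto
    have pa2: "nrm a powr (q - 1) * nrm a = nrm a powr q"
      using ab q_ge powr_add[of "nrm a" "q - 1" 1] by (cases "nrm a = 0") auto
    have "B a (b - a) \<le> nrm a * nrm b - nrm a * nrm a"
      using B_cauchy_schwarz[OF ab] nrm_sq[OF ab(1)] by (simp add: B_simps power2_eq_square)
    then have "nrm a powr (q - 2) * B a (b - a) \<le> nrm a powr (q - 2) * (nrm a * (nrm b - nrm a))"
      by (intro mult_left_mono) (auto simp: algebra_simps)
    also have "\<dots> = nrm a powr (q - 1) * nrm b - nrm a powr q"
      unfolding pa by (simp add: right_diff_distrib pa2)
    finally have "q * (nrm a powr (q - 2) * B a (b - a)) \<le> q * (nrm a powr (q - 1) * nrm b) - q * nrm a powr q"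
      using q_ge by (simp flip: right_diff_distrib)
    also have "\<dots> \<le> nrm b powr q - nrm a powr q"
      using young_powr[of q "nrm a" "nrm b"] q_ge ab by (simp add: left_diff_distrib)
    finally show ?thesis by (simp add: a_def b_def)
  qed
  then have "\<delta> / q * (q * (nrm (w - x0) powr (q - 2) * B (w - x0) (x - w))) \<le> \<delta> / q * (nrm (x - x0) powr q - nrm (w - x0) powr q)"
    using \<delta> q_ge by (intro mult_left_mono) auto
  ultimately show ?thesis using assms q_ge
    by (simp add: grad_F F_eq right_diff_distrib mult.assoc)
qed

lemma model_eq:
  "model B p \<nu> Hf \<theta> f x0 \<delta> y x = F y + (smooth_taylor p f y (x - y) + \<delta> / q * reg_taylor p \<nu> x0 y (x - y))
     + lam * nrm (x - y) powr q"
proof -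
  have "(\<Sum>i=1..p. 1 / fact i * reg_form B p \<nu> f x0 \<delta> i y h) = smooth_taylor p f y h + \<delta> / q * reg_taylor p \<nu> x0 y h" for h
    unfolding reg_form_def smooth_taylor_def[OF f_diff] reg_taylor_def q_def[symmetric]
    by (simp add: distrib_left sum.distrib sum_distrib_left mult_ac)
  then show ?thesis by (simp add: model_def F_def H_delta_eq q_def)
qed

text \<open>The model gradient is the sum of the two Taylor gradients and of \<open>K\<close>, the
  gradient of the power term. Thus \<open>s + K\<close> collects three errors: the two Taylor
  remainders and the inexactness of the step. Against \<open>y - x\<close> the term \<open>K\<close>
  contributes \<open>q * lam * r powr q\<close>, and the errors take back at most
  \<open>lam * r powr q\<close>. For \<open>y\<close> in \<open>dom\<close>, the subgradient
  inequality at z = y turns this into a decrease of the objective.\<close>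

lemma tensor_step_estimate:
  assumes step: "acceptable y x g" and y: "y \<in> E"
  defines "s \<equiv> \<lambda>u. grad F x u + g u" and "r \<equiv> nrm (x - y)"
  shows "x \<in> dom" "linear_functional_on E s"
    "\<And>u. u \<in> E \<Longrightarrow> \<bar>s u\<bar> \<le> (q + 1) * lam * r powr (q - 1) * nrm u"
    "(q - 1) * lam * r powr q \<le> s (y - x)"
    "\<And>z. z \<in> dom \<Longrightarrow> Ft x + s (z - x) \<le> Ft z"
    "\<And>z. z \<in> dom \<Longrightarrow> real_of_ereal (\<phi> x) + g (z - x) \<le> real_of_ereal (\<phi> z)"
proof -
  have x: "x \<in> E" and g: "g \<in> subdiff E \<phi> x"
    and dn: "dual_norm E B (\<lambda>h. grad (model B p \<nu> Hf \<theta> f x0 \<delta> y) x h + g h) \<le> \<theta> * r powr (q - 1)"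
    using step by (auto simp: tensor_step_def r_def q_def)
  show xd: "x \<in> dom" using g by (simp add: subdiff_def)
  have glin: "linear g" using g by (simp add: subdiff_def)
  then have g_lin: "linear_functional_on E g"
    by (simp add: linear_functional_on_def linear_add linear_scale)
  show s_lin: "linear_functional_on E s"
    using g_lin linear_functional_on_grad_F[OF x] unfolding s_def linear_functional_on_def
    by (simp add: distrib_left)
  obtain Df where Df: "linear_functional_on E Df"
    "\<And>u. u \<in> E \<Longrightarrow> ((\<lambda>t. smooth_taylor p f y (x + t *\<^sub>R u - y)) has_real_derivative Df u) (at 0)"
    "\<And>u. u \<in> E \<Longrightarrow> \<bar>grad f x u - Df u\<bar> \<le> Hf / fact (p - 1) * (r powr (q - 1) * nrm u)"
    unfolding r_def using smooth_taylor_derivative[OF f_diff p \<nu> q_def f_holder Hf x y] by blast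
  obtain Dr where Dr: "linear_functional_on E Dr"
    "\<And>u. u \<in> E \<Longrightarrow> ((\<lambda>t. reg_taylor p \<nu> x0 y (x + t *\<^sub>R u - y)) has_real_derivative Dr u) (at 0)"
    "\<And>u. u \<in> E \<Longrightarrow> \<bar>q * nrm (x - x0) powr (q - 2) * B (x - x0) u - Dr u\<bar>
        \<le> C_const p \<nu> / fact (p - 1) * (r powr (q - 1) * nrm u)"
    unfolding r_def using reg_taylor_derivative[OF p \<nu> q_def x0 x y] by blast
  define K where "K u = lam * (q * r powr (q - 2) * B (x - y) u)" for u
  have gm: "grad (model B p \<nu> Hf \<theta> f x0 \<delta> y) x u = Df u + \<delta> / q * Dr u + K u" if u: "u \<in> E" for u
  proof -
    have "((\<lambda>t. nrm (x - y + t *\<^sub>R u) powr q) has_real_derivative q * r powr (q - 2) * B (x - y) u) (at 0)"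
      unfolding r_def using x y u q_ge by (intro has_derivative_nrm_powr) auto
    then have 1: "((\<lambda>t. nrm (x + t *\<^sub>R u - y) powr q) has_real_derivative q * r powr (q - 2) * B (x - y) u) (at 0)"
      by (simp add: diff_add_eq)
    have "((\<lambda>t. model B p \<nu> Hf \<theta> f x0 \<delta> y (x + t *\<^sub>R u)) has_real_derivative 0 + (Df u + \<delta> / q * Dr u) + K u) (at 0)"
      unfolding model_eq K_def by (intro DERIV_add DERIV_cmult DERIV_const Df(2) Dr(2) 1 u)
    then show ?thesis by (simp add: grad_def dir_deriv_eqI)
  qed
  have K_lin: "linear_functional_on E K"
    unfolding linear_functional_on_def K_def by (simp add: B_simps algebra_simps)
  have m_lin: "linear_functional_on E (\<lambda>h. grad (model B p \<nu> Hf \<theta> f x0 \<delta> y) x h + g h)"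
    using Df(1) Dr(1) K_lin g_lin gm unfolding linear_functional_on_def
    by (simp add: distrib_left add_divide_distrib)
  define e where "e u = s u + K u" for u
  have e: "\<bar>e u\<bar> \<le> lam * (r powr (q - 1) * nrm u)" if u: "u \<in> E" for u
  proof -
    define X where "X = r powr (q - 1) * nrm u"
    have X0: "0 \<le> X" using u by (simp add: X_def)
    have m: "\<bar>Df u + \<delta> / q * Dr u + K u + g u\<bar> \<le> \<theta> * X"
    proof -
      have "\<bar>grad (model B p \<nu> Hf \<theta> f x0 \<delta> y) x u + g u\<bar>
          \<le> dual_norm E B (\<lambda>h. grad (model B p \<nu> Hf \<theta> f x0 \<delta> y) x h + g h) * nrm u"
        by (rule dual_norm_bound[OF m_lin u])
      also have "\<dots> \<le> \<theta> * r powr (q - 1) * nrm u" using dn u by (intro mult_right_mono) auto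
      finally show ?thesis using gm[OF u] by (simp add: X_def mult_ac)
    qed
    define d where "d = q * nrm (x - x0) powr (q - 2) * B (x - x0) u"
    have "e u = (grad f x u - Df u) + \<delta> / q * (d - Dr u) + (Df u + \<delta> / q * Dr u + K u + g u)"
      using q_ge grad_F[OF x u] by (simp add: e_def s_def d_def right_diff_distrib)
    then have "\<bar>e u\<bar> \<le> \<bar>grad f x u - Df u\<bar> + \<bar>\<delta> / q * (d - Dr u)\<bar> + \<bar>Df u + \<delta> / q * Dr u + K u + g u\<bar>"
      by linarith
    also have "\<bar>\<delta> / q * (d - Dr u)\<bar> = \<delta> / q * \<bar>d - Dr u\<bar>"
      using \<delta> q_ge by (simp add: abs_mult)
    also have "\<bar>grad f x u - Df u\<bar> + \<delta> / q * \<bar>d - Dr u\<bar> + \<bar>Df u + \<delta> / q * Dr u + K u + g u\<bar>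
        \<le> Hf / fact (p - 1) * X + \<delta> / q * (C_const p \<nu> / fact (p - 1) * X) + \<theta> * X"
      using Df(3)[OF u] Dr(3)[OF u] m \<delta> q_ge unfolding X_def d_def
      by (intro add_mono mult_left_mono) auto
    \<comment> \<open>The summand 3 \<theta> of \<open>lam\<close> covers the residual \<theta> and
      leaves 2 \<theta> to spare.\<close>
    also have "\<dots> = (lam - 2 * \<theta>) * X" by (simp add: lam_def add_divide_distrib distrib_right)
    also have "\<dots> \<le> lam * X" using \<theta> X0 by (intro mult_right_mono) auto
    finally show ?thesis by (simp add: X_def)
  qed
  have r0: "0 \<le> r" using x y by (simp add: r_def)
  have r1: "r powr (q - 2) * (r * c) = r powr (q - 1) * c" for c
    using r0 q_ge powr_add[of r "q - 2" 1] by (cases "r = 0") auto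
  have r2: "r powr (q - 1) * r = r powr q"
    using r0 q_ge powr_add[of r "q - 1" 1] by (cases "r = 0") auto
  show "\<bar>s u\<bar> \<le> (q + 1) * lam * r powr (q - 1) * nrm u" if u: "u \<in> E" for u
  proof -
    have "\<bar>K u\<bar> = lam * q * (r powr (q - 2) * \<bar>B (x - y) u\<bar>)"
      using lam_pos q_ge by (simp add: K_def abs_mult)
    also have "\<dots> \<le> lam * q * (r powr (q - 2) * (r * nrm u))"
      using B_cauchy_schwarz[of "x - y" u] x y u lam_pos q_ge
      by (intro mult_left_mono) (auto simp: r_def)
    finally have "\<bar>K u\<bar> \<le> lam * q * (r powr (q - 1) * nrm u)" unfolding r1 .
    moreover have "\<bar>s u\<bar> \<le> \<bar>e u\<bar> + \<bar>K u\<bar>" by (simp add: e_def)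
    ultimately have "\<bar>s u\<bar> \<le> lam * (r powr (q - 1) * nrm u) + lam * q * (r powr (q - 1) * nrm u)"
      using e[OF u] by linarith
    then show ?thesis by (simp add: algebra_simps)
  qed
  show "(q - 1) * lam * r powr q \<le> s (y - x)"
  proof -
    have yx: "y - x \<in> E" using x y by auto
    have "B (x - y) (y - x) = - (r * r)"
      using nrm_sq[of "x - y"] x y by (simp add: r_def B_simps power2_eq_square)
    then have "K (y - x) = - (lam * q * (r powr (q - 2) * (r * r)))" by (simp add: K_def)
    then have "K (y - x) = - (lam * q * r powr q)" unfolding r1 r2 .
    moreover have "\<bar>e (y - x)\<bar> \<le> lam * r powr q"
      using e[OF yx] r2 nrm_minus_commute[of x y] by (simp add: r_def)
    ultimately show ?thesis by (simp add: e_def algebra_simps abs_le_iff)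
  qed
  show sub: "real_of_ereal (\<phi> x) + g (z - x) \<le> real_of_ereal (\<phi> z)" if z: "z \<in> dom" for z
  proof -
    have "\<phi> x + ereal (g (z - x)) \<le> \<phi> z" using g dom_E[OF z] by (simp add: subdiff_def)
    then have "ereal (real_of_ereal (\<phi> x)) + ereal (g (z - x)) \<le> ereal (real_of_ereal (\<phi> z))"
      using \<phi>_real[OF xd] \<phi>_real[OF z] by simp
    then show ?thesis by simp
  qed
  show "Ft x + s (z - x) \<le> Ft z" if z: "z \<in> dom" for z
    using sub[OF z] grad_F_ineq[OF x dom_E[OF z]] by (simp add: Ft_def s_def)
qed

end

section \<open>The accelerated tensor method\<close>

lemma powr_superadditive:
  fixes x y k :: real
  assumes "0 \<le> x" "0 \<le> y" "1 \<le> k"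
  shows "x powr k + y powr k \<le> (x + y) powr k"
proof (cases "x + y = 0")
  case False
  then have s: "x + y > 0" using assms by linarith
  have *: "z powr k \<le> z * (x + y) powr (k - 1)" if "0 \<le> z" "z \<le> x + y" for z
  proof (cases "z = 0")
    case False
    then have "z powr k = z * z powr (k - 1)" using that powr_add[of z 1 "k - 1"] by simp
    also have "\<dots> \<le> z * (x + y) powr (k - 1)" using that assms by (intro mult_left_mono powr_mono2) auto
    finally show ?thesis .
  qed simp
  have "x powr k + y powr k \<le> x * (x + y) powr (k - 1) + y * (x + y) powr (k - 1)"
    using assms by (intro add_mono *) auto
  also have "\<dots> = (x + y) powr k"
    using s powr_add[of "x + y" 1 "k - 1"] by (simp add: distrib_right)
  finally show ?thesis .
qed (use assms in \<open>simp add: add_nonneg_eq_0_iff\<close>)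

lemma powr_midpoint_convex:
  fixes x y k :: real
  assumes "0 \<le> x" "0 \<le> y" "1 \<le> k"
  shows "((x + y) / 2) powr k \<le> (x powr k + y powr k) / 2"
proof (cases "k = 1 \<or> x + y = 0")
  case False
  define m where "m = (x + y) / 2"
  have m: "0 < m" using False assms by (simp add: m_def)
  have "k * (m powr (k - 1) * x) \<le> (k - 1) * m powr k + x powr k"
       "k * (m powr (k - 1) * y) \<le> (k - 1) * m powr k + y powr k"
    using False assms m by (auto intro!: young_powr)
  then have "k * (m powr (k - 1) * (x + y)) \<le> 2 * ((k - 1) * m powr k) + (x powr k + y powr k)"
    by (simp add: distrib_left)
  moreover have "m powr (k - 1) * (x + y) = 2 * m powr k"
    using m powr_add[of m "k - 1" 1] by (simp add: m_def field_simps)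
  ultimately have "k * (2 * m powr k) \<le> 2 * ((k - 1) * m powr k) + (x powr k + y powr k)" by (simp only:)
  then show ?thesis by (simp add: m_def[symmetric] algebra_simps)
qed (use assms in \<open>auto simp: add_nonneg_eq_0_iff\<close>)

text \<open>Since (1 + 1/q)^(q-1) is at most e and hence at most 3, and q + 1 \<le> 2 p, the claim
  reduces to 6 * 2^p \<le> 2^(3p-1), true from p = 2 on. This is what the constant in the weight
  equation of the method pays for.\<close>

lemma step_constant_bound:
  fixes q :: real and p :: nat
  assumes "2 \<le> p" "real p \<le> q" "q \<le> real p + 1"
  shows "(q + 1) powr q * 2 powr (q - 1) \<le> 2 ^ (3 * p - 1) * real p * q powr (q - 1)"
proof -
  have q: "2 \<le> q" using assms by simp
  have "((q + 1) / q) powr (q - 1) \<le> ((q + 1) / q) powr q"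
    using q by (intro powr_mono) auto
  also have "\<dots> = exp (q * ln (1 + 1 / q))"
  proof -
    have "(q + 1) / q = 1 + 1 / q" "0 < 1 + 1 / q" using q by (auto simp: add_divide_distrib add_pos_nonneg)
    then show ?thesis by (simp add: powr_def)
  qed
  also have "\<dots> \<le> exp (q * (1 / q))"
    using q ln_add_one_self_le_self[of "1 / q"] by (intro exp_mono mult_left_mono) auto
  also have "\<dots> \<le> 3" using q exp_le by simp
  finally have 1: "(q + 1) powr (q - 1) \<le> 3 * q powr (q - 1)"
    using q by (simp add: powr_divide divide_le_eq)
  have "(q + 1) powr q * 2 powr (q - 1) = (q + 1) * (q + 1) powr (q - 1) * 2 powr (q - 1)"
    using q powr_add[of "q + 1" 1 "q - 1"] by simp
  also have "\<dots> \<le> (2 * real p) * (3 * q powr (q - 1)) * 2 powr real p"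
    using assms 1 by (intro mult_mono powr_mono) auto
  also have "\<dots> = 6 * 2 ^ p * (real p * q powr (q - 1))"
    by (simp add: powr_realpow)
  also have "\<dots> \<le> 2 ^ (3 * p - 1) * (real p * q powr (q - 1))"
  proof (intro mult_right_mono)
    have "3 * p - 1 = p + (2 * (p - 2) + 3)" using assms by simp
    then have "(2 :: real) ^ (3 * p - 1) = 2 ^ p * (4 ^ (p - 2) * 8)"
      by (simp add: power_add power_mult)
    moreover have "(6 :: real) \<le> 4 ^ (p - 2) * 8"
      using one_le_power[of "4 :: real" "p - 2"] by linarith
    ultimately show "6 * 2 ^ p \<le> (2 :: real) ^ (3 * p - 1)"
      using mult_left_mono[of 6 "4 ^ (p - 2) * 8" "2 ^ p :: real"] by (simp only: mult.commute) simp
  qed (use q in auto)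
  finally show ?thesis by (simp add: mult.assoc)
qed

section \<open>Uniform convexity of the norm power\<close>

context energy_space
begin

text \<open>Parallelogram law for the squared norms, followed by the power q/2 \<ge> 1, which is
  superadditive on the left side and midpoint convex on the right.\<close>

lemma nrm_powr_midpoint:
  assumes "a \<in> E" "b \<in> E" "2 \<le> q"
  shows "nrm ((1/2) *\<^sub>R a + (1/2) *\<^sub>R b) powr q + 2 powr (- q) * nrm (a - b) powr q
           \<le> (nrm a powr q + nrm b powr q) / 2"
proof -
  define m d where "m = (1/2) *\<^sub>R a + (1/2) *\<^sub>R b" and "d = (1/2) *\<^sub>R (a - b)"
  have md: "m \<in> E" "d \<in> E" using assms by (auto simp: m_def d_def)
  have sq: "nrm z powr q = ((nrm z)\<^sup>2) powr (q / 2)" if "z \<in> E" for z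
    using that by (simp add: powr_power[symmetric] powr_powr flip: powr_numeral)
  have par: "(nrm m)\<^sup>2 + (nrm d)\<^sup>2 = ((nrm a)\<^sup>2 + (nrm b)\<^sup>2) / 2"
    using md assms B_commute[of a b] unfolding nrm_sq[OF md(1)] nrm_sq[OF md(2)] nrm_sq[OF assms(1)] nrm_sq[OF assms(2)]
    by (simp add: m_def d_def B_simps field_simps)
  have "nrm m powr q + nrm d powr q \<le> ((nrm m)\<^sup>2 + (nrm d)\<^sup>2) powr (q / 2)"
    unfolding sq[OF md(1)] sq[OF md(2)] using assms by (intro powr_superadditive) auto
  also have "\<dots> \<le> (((nrm a)\<^sup>2) powr (q / 2) + ((nrm b)\<^sup>2) powr (q / 2)) / 2"
    unfolding par using assms by (intro powr_midpoint_convex) auto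
  also have "\<dots> = (nrm a powr q + nrm b powr q) / 2"
    using sq assms by simp
  finally have "nrm m powr q + nrm d powr q \<le> (nrm a powr q + nrm b powr q) / 2" .
  moreover have "nrm d powr q = 2 powr (- q) * nrm (a - b) powr q"
    by (simp add: d_def nrm_scale powr_mult powr_divide powr_minus_divide)
  ultimately show ?thesis by (simp add: m_def)
qed

end

section \<open>Estimating sequences\<close>

context composite_problem
begin

text \<open>The coefficient in the equation that determines the weights \<open>a t\<close>.\<close>

definition c0 :: real where "c0 = 1 / 2 ^ (3 * p - 1) * (fact (p - 1) / H_delta p \<nu> Hf \<theta> \<delta>)"

lemma c0_eq: "c0 * (2 ^ (3 * p - 1) * real p * lam) = 1"
proof -
  have "(fact p :: real) = real p * fact (p - 1)" using p by (cases p) auto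
  then show ?thesis using lam_pos p by (simp add: c0_def H_delta_eq)
qed

lemma c0_pos: "0 < c0"
  unfolding c0_def using H_delta_pos by simp

text \<open>Pays for the error in the estimating sequence argument: with r the step length and D the
  distance of the comparison point from \<open>v t\<close>, the left side is split by Young's
  inequality between the decrease of the tensor step and the uniform growth of the estimating
  function.\<close>

lemma step_inequality:
  assumes a: "0 < a" "a powr q = c0 * A powr (q - 1)" and A: "0 < A" and rD: "0 \<le> r" "0 \<le> D"
  shows "a * ((q + 1) * lam * r powr (q - 1) * D) \<le> A * ((q - 1) * lam * r powr q) + 2 powr (1 - q) / q * D powr q"
proof -
  \<comment> \<open>The weights are dictated by the two terms on the right: after multiplication by
    q, \<mu>^q must be q A \<open>lam\<close> and \<sigma>^q must be 2^(1-q). Comparison of q-th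
    powers, with the equation for \<open>a\<close>, leaves exactly
    \<open>step_constant_bound\<close>.\<close>
  define \<mu> where "\<mu> = (q * A * lam) powr (1 / q)"
  define \<sigma> where "\<sigma> = 2 powr ((1 - q) / q)"
  have q: "2 \<le> q" by (rule q_ge)
  have pos: "0 < q * A * lam" using q A lam_pos by simp
  have \<mu>q: "\<mu> powr q = q * A * lam" using q pos by (simp add: \<mu>_def powr_powr)
  have \<sigma>q: "\<sigma> powr q = 2 powr (1 - q)" using q by (simp add: \<sigma>_def powr_powr)
  have \<mu>0: "0 < \<mu>" and \<sigma>0: "0 < \<sigma>" using pos by (auto simp: \<mu>_def \<sigma>_def)
  have "(a * ((q + 1) * lam)) powr q \<le> (\<mu> powr (q - 1) * \<sigma>) powr q"
  proof -
    have "(q + 1) powr q * 2 powr (q - 1) \<le> 2 ^ (3 * p - 1) * real p * q powr (q - 1)"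
      using step_constant_bound[OF p] \<nu> by (simp add: q_def)
    then have "c0 * lam * ((q + 1) powr q * 2 powr (q - 1)) \<le> c0 * lam * (2 ^ (3 * p - 1) * real p * q powr (q - 1))"
      using c0_pos lam_pos by (intro mult_left_mono) auto
    also have "\<dots> = q powr (q - 1) * (c0 * (2 ^ (3 * p - 1) * real p * lam))" by (simp only: mult_ac)
    also have "\<dots> = q powr (q - 1)" by (simp only: c0_eq mult_1_right)
    finally have "c0 * lam * (q + 1) powr q * 2 powr (q - 1) \<le> q powr (q - 1)" by (simp only: mult.assoc)
    then have 1: "c0 * lam * (q + 1) powr q \<le> q powr (q - 1) * 2 powr (1 - q)"
      using powr_minus_divide[of 2 "q - 1"] by (simp add: le_divide_eq)
    have "(a * ((q + 1) * lam)) powr q = a powr q * ((q + 1) powr q * lam powr q)"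
      using a q lam_pos by (simp add: powr_mult)
    also have "\<dots> = (c0 * lam * (q + 1) powr q) * (A powr (q - 1) * lam powr (q - 1))"
      using a lam_pos powr_add[of lam "q - 1" 1] by (simp add: mult_ac)
    also have "\<dots> \<le> (q powr (q - 1) * 2 powr (1 - q)) * (A powr (q - 1) * lam powr (q - 1))"
      using 1 by (intro mult_right_mono) auto
    also have "\<dots> = (q * A * lam) powr (q - 1) * 2 powr (1 - q)"
      using q A lam_pos by (simp add: powr_mult mult_ac)
    also have "\<dots> = (\<mu> powr q) powr (q - 1) * \<sigma> powr q" by (simp add: \<mu>q \<sigma>q)
    also have "\<dots> = (\<mu> powr (q - 1) * \<sigma>) powr q"
      using \<mu>0 \<sigma>0 by (simp add: powr_mult powr_powr mult.commute)
    finally show ?thesis .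
  qed
  then have le: "a * ((q + 1) * lam) \<le> \<mu> powr (q - 1) * \<sigma>"
    using powr_less_mono2[of q "\<mu> powr (q - 1) * \<sigma>" "a * ((q + 1) * lam)"] q \<mu>0 \<sigma>0
    by (force simp: not_le[symmetric])
  have "q * (a * ((q + 1) * lam * r powr (q - 1) * D)) = q * ((a * ((q + 1) * lam)) * (r powr (q - 1) * D))"
    by (simp add: mult_ac)
  also have "\<dots> \<le> q * ((\<mu> powr (q - 1) * \<sigma>) * (r powr (q - 1) * D))"
    using le rD q by (intro mult_left_mono mult_right_mono) auto
  also have "\<dots> = q * ((\<mu> * r) powr (q - 1) * (\<sigma> * D))"
    using \<mu>0 rD by (simp add: powr_mult mult_ac)
  also have "\<dots> \<le> (q - 1) * (\<mu> * r) powr q + (\<sigma> * D) powr q"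
    using q \<mu>0 \<sigma>0 rD by (intro young_powr) auto
  also have "\<dots> = q * (A * ((q - 1) * lam * r powr q)) + 2 powr (1 - q) * D powr q"
    using \<mu>0 \<sigma>0 rD by (simp add: powr_mult \<mu>q \<sigma>q mult_ac)
  also have "\<dots> = q * (A * ((q - 1) * lam * r powr q) + 2 powr (1 - q) / q * D powr q)"
    using q by (simp add: distrib_left)
  finally show ?thesis using q by (simp add: mult_le_cancel_left)
qed

text \<open>The q-th root of \<open>A\<close> grows by at least a fixed amount per iteration: with X
  and Y the new and old roots, X^q - Y^q \<le> q X^(q-1) (X - Y), while the weight equation says
  that this difference is c0^(1/q) X^(q-1).\<close>

lemma coefficient_growth:
  assumes "\<And>t. t < m \<Longrightarrow> 0 < a t \<and> a t powr q = c0 * (A t + a t) powr (q - 1) \<and> A (Suc t) = A t + a t"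
    and "A 0 = 0" and "t \<le> m"
  shows "real t * c0 powr (1 / q) / q \<le> A t powr (1 / q) \<and> 0 \<le> A t"
  using assms(3)
proof (induction t)
  case 0
  then show ?case using assms(2) by simp
next
  case (Suc t)
  have q: "2 \<le> q" by (rule q_ge)
  have at: "0 < a t" "a t powr q = c0 * A (Suc t) powr (q - 1)" "A (Suc t) = A t + a t"
    using assms(1)[of t] Suc.prems by auto
  have IH: "real t * c0 powr (1 / q) / q \<le> A t powr (1 / q)" "0 \<le> A t" using Suc by auto
  define X Y where "X = A (Suc t) powr (1 / q)" and "Y = A t powr (1 / q)"
  have A': "0 < A (Suc t)" using at IH by simp
  have X: "0 < X" "X powr q = A (Suc t)" using A' q by (auto simp: X_def powr_powr)
  have Y: "0 \<le> Y" "Y powr q = A t" using IH q by (auto simp: Y_def powr_powr)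
  have aX: "a t = c0 powr (1 / q) * X powr (q - 1)"
  proof -
    have "a t = (a t powr q) powr (1 / q)" using at(1) q by (simp add: powr_powr)
    also have "\<dots> = c0 powr (1 / q) * (A (Suc t) powr (q - 1)) powr (1 / q)"
      using at c0_pos by (simp add: powr_mult)
    finally show ?thesis by (simp add: X_def powr_powr)
  qed
  have "q * (X powr (q - 1) * Y) \<le> (q - 1) * X powr q + Y powr q"
    using q X Y by (intro young_powr) auto
  then have "X powr q - Y powr q \<le> q * (X powr q - X powr (q - 1) * Y)" by (simp add: algebra_simps)
  also have "X powr q = X powr (q - 1) * X" using X(1) powr_add[of X "q - 1" 1] by simp
  finally have "a t \<le> q * (X powr (q - 1) * (X - Y))"
    using at(3) X(2) Y(2) X(1) powr_add[of X "q - 1" 1] by (simp add: right_diff_distrib)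
  then have "X powr (q - 1) * c0 powr (1 / q) \<le> X powr (q - 1) * (q * (X - Y))"
    by (simp add: aX mult_ac)
  then have "c0 powr (1 / q) \<le> q * (X - Y)" using X(1) by (simp add: mult_le_cancel_left)
  then have "c0 powr (1 / q) / q \<le> X - Y" using q by (simp add: divide_le_eq mult.commute)
  then show ?case using IH(1) A' by (simp add: X_def Y_def add_divide_distrib distrib_right)
qed

text \<open>\<open>v\<close> is compared with the midpoint of \<open>v\<close> and \<open>x\<close>.
  The linear terms and \<phi> are convex there, and the norm power gains 2^(-q)/q times the distance
  power; minimality of \<open>v\<close> doubles this gain.\<close>

lemma argmin_growth:
  assumes c: "\<And>j. j < t \<Longrightarrow> 0 \<le> a j" and w: "\<And>j. j < t \<Longrightarrow> w (Suc j) \<in> E" and w0: "w0 \<in> E"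
    and v: "v \<in> dom" and x: "x \<in> dom"
  defines "\<Psi> \<equiv> \<lambda>x. nrm (x - w0) powr q / q + (\<Sum>j<t. a j * (F (w (Suc j)) + grad F (w (Suc j)) (x - w (Suc j)) + real_of_ereal (\<phi> x)))"
  assumes min: "\<And>y. y \<in> dom \<Longrightarrow> \<Psi> v \<le> \<Psi> y"
  shows "\<Psi> v + 2 powr (1 - q) / q * nrm (x - v) powr q \<le> \<Psi> x"
proof -
  define z where "z = (1 - 1/2) *\<^sub>R v + (1/2) *\<^sub>R x"
  have z: "z \<in> dom" "real_of_ereal (\<phi> z) \<le> (1 - 1/2) * real_of_ereal (\<phi> v) + 1/2 * real_of_ereal (\<phi> x)"
    unfolding z_def using v x by (intro dom_convex; simp)+
  have E: "v \<in> E" "x \<in> E" using v x dom_E by auto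
  have lin: "grad F (w (Suc j)) (z - w (Suc j)) = 1/2 * grad F (w (Suc j)) (v - w (Suc j)) + 1/2 * grad F (w (Suc j)) (x - w (Suc j))"
    if "j < t" for j
  proof -
    have e: "z - w (Suc j) = (1/2) *\<^sub>R (v - w (Suc j)) + (1/2) *\<^sub>R (x - w (Suc j))"
      by (simp add: z_def algebra_simps flip: scaleR_add_left)
    show ?thesis unfolding e using linear_functional_on_grad_F[OF w[OF that]] E w[OF that]
      by (simp only: linear_functional_on_def E_closed)
  qed
  have n: "nrm (z - w0) powr q + 2 powr (- q) * nrm (x - v) powr q \<le> (nrm (v - w0) powr q + nrm (x - w0) powr q) / 2"
  proof -
    have "z - w0 = (1/2) *\<^sub>R (v - w0) + (1/2) *\<^sub>R (x - w0)"
      by (simp add: z_def algebra_simps flip: scaleR_add_left)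
    then show ?thesis using nrm_powr_midpoint[of "v - w0" "x - w0" q] E w0 q_ge
      by (simp add: nrm_minus_commute[of x v])
  qed
  have "\<Psi> z \<le> ((nrm (v - w0) powr q + nrm (x - w0) powr q) / 2 - 2 powr (- q) * nrm (x - v) powr q) / q
      + (\<Sum>j<t. (a j * (F (w (Suc j)) + grad F (w (Suc j)) (v - w (Suc j)) + real_of_ereal (\<phi> v))
        + a j * (F (w (Suc j)) + grad F (w (Suc j)) (x - w (Suc j)) + real_of_ereal (\<phi> x))) / 2)"
    unfolding \<Psi>_def
  proof (intro add_mono sum_mono divide_right_mono)
    show "nrm (z - w0) powr q \<le> (nrm (v - w0) powr q + nrm (x - w0) powr q) / 2 - 2 powr - q * nrm (x - v) powr q"
      using n by linarith
    fix j assume "j \<in> {..<t}"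
    then have j: "j < t" by simp
    have "a j * (F (w (Suc j)) + grad F (w (Suc j)) (z - w (Suc j)) + real_of_ereal (\<phi> z))
        \<le> a j * (((F (w (Suc j)) + grad F (w (Suc j)) (v - w (Suc j)) + real_of_ereal (\<phi> v))
        + (F (w (Suc j)) + grad F (w (Suc j)) (x - w (Suc j)) + real_of_ereal (\<phi> x))) / 2)"
      using c[OF j] z(2) lin[OF j] by (intro mult_left_mono) (simp_all add: field_simps)
    then show "a j * (F (w (Suc j)) + grad F (w (Suc j)) (z - w (Suc j)) + real_of_ereal (\<phi> z))
        \<le> (a j * (F (w (Suc j)) + grad F (w (Suc j)) (v - w (Suc j)) + real_of_ereal (\<phi> v))
        + a j * (F (w (Suc j)) + grad F (w (Suc j)) (x - w (Suc j)) + real_of_ereal (\<phi> x))) / 2"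
      by (simp add: distrib_left)
  qed (use q_ge in auto)
  also have "\<dots> = (\<Psi> v + \<Psi> x) / 2 - 2 powr (- q) * nrm (x - v) powr q / q"
    unfolding \<Psi>_def sum_divide_distrib[symmetric] sum.distrib by (simp add: add_divide_distrib diff_divide_distrib)
  finally have "\<Psi> v \<le> (\<Psi> v + \<Psi> x) / 2 - 2 powr (- q) * nrm (x - v) powr q / q"
    using min[OF z(1)] by linarith
  moreover have "2 powr (1 - q) = 2 * 2 powr (- q)" using powr_add[of 2 1 "- q"] by simp
  ultimately show ?thesis by (simp add: field_simps)
qed

text \<open>The invariant combines two facts in one inequality: A t times the objective value at
  \<open>w t\<close> lies below the estimating function on \<open>dom\<close>, and a uniform growth
  term around \<open>v t\<close> fits in between. The bound on the estimating function from above
  uses only convexity, so the comparison point is any point of \<open>dom\<close>.\<close>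

lemma alg5_bound:
  assumes run: "accelerated w0 m z" and w0: "w0 \<in> E" and m: "0 < m"
  shows "z \<in> dom"
    and "\<And>x. x \<in> dom \<Longrightarrow> Ft z \<le> Ft x + nrm (x - w0) powr q / (q * (c0 * (real m / q) powr q))"
proof -
  obtain w v \<eta> :: "nat \<Rightarrow> 'a" and a A \<gamma> :: "nat \<Rightarrow> real" and \<psi> :: "nat \<Rightarrow> 'a \<Rightarrow> ereal" and g :: "nat \<Rightarrow> 'a \<Rightarrow> real"
    where init: "w 0 = w0" "v 0 = w0" "A 0 = 0"
      "\<psi> 0 = (\<lambda>x. ereal (1 / (real p + \<nu>) * bnorm B (x - w0) powr (real p + \<nu>)))" "w m = z"
    and iter: "\<And>t. t < m \<Longrightarrow>
           a t > 0 \<and>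
           a t powr (real p + \<nu>) =
             1 / 2 ^ (3 * p - 1) * (fact (p - 1) / H_delta p \<nu> Hf \<theta> \<delta>)
               * (A t + a t) powr (real p + \<nu> - 1) \<and>
           A (Suc t) = A t + a t \<and>
           \<gamma> t = a t / A (Suc t) \<and>
           \<eta> t = (1 - \<gamma> t) *\<^sub>R w t + \<gamma> t *\<^sub>R v t \<and>
           acceptable (\<eta> t) (w (Suc t)) (g (Suc t)) \<and>
           \<psi> (Suc t) = (\<lambda>x. \<psi> t x + ereal (a t) *
             (ereal (reg_fun B p \<nu> f x0 \<delta> (w (Suc t))
                     + grad (reg_fun B p \<nu> f x0 \<delta>) (w (Suc t)) (x - w (Suc t)))
              + \<phi> x)) \<and>
           is_arg_min (\<psi> (Suc t)) (\<lambda>x. x \<in> E) (v (Suc t))"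
    using run unfolding alg5_def by blast
  have a_pos: "0 < a t" and A_Suc: "A (Suc t) = A t + a t"
    and step: "acceptable (\<eta> t) (w (Suc t)) (g (Suc t))"
    and a_eq: "a t powr q = c0 * A (Suc t) powr (q - 1)"
    and \<eta>: "\<eta> t = (1 - a t / A (Suc t)) *\<^sub>R w t + (a t / A (Suc t)) *\<^sub>R v t"
    and \<psi>_Suc: "\<And>x. \<psi> (Suc t) x = \<psi> t x + ereal (a t) *
             (ereal (F (w (Suc t)) + grad F (w (Suc t)) (x - w (Suc t))) + \<phi> x)"
    and vmin: "v (Suc t) \<in> E" "\<And>y. y \<in> E \<Longrightarrow> \<not> \<psi> (Suc t) y < \<psi> (Suc t) (v (Suc t))"
    if "t < m" for t
    using iter[OF that] by (auto simp: c0_def q_def F_def is_arg_min_def)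
  have w_dom: "w (Suc t) \<in> dom" if "t < m" for t
    using step[OF that] by (simp add: tensor_step_def subdiff_def)
  have growth: "real t * c0 powr (1 / q) / q \<le> A t powr (1 / q)" "0 \<le> A t" if "t \<le> m" for t
    using coefficient_growth[of m a A t] a_pos A_Suc a_eq init(3) that by auto
  define L where "L j x = F (w (Suc j)) + grad F (w (Suc j)) (x - w (Suc j)) + real_of_ereal (\<phi> x)" for j x
  define \<Psi> where "\<Psi> t x = nrm (x - w0) powr q / q + (\<Sum>j<t. a j * L j x)" for t x
  have \<psi>_dom: "\<psi> t x = ereal (\<Psi> t x)" if "t \<le> m" "x \<in> dom" for t x
    using that(1)
  proof (induction t)
    case 0
    then show ?case using init(4) by (simp add: \<Psi>_def q_def)
  next
    case (Suc t)
    then have t: "t < m" by simp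
    have "\<psi> (Suc t) x = ereal (\<Psi> t x) + ereal (a t) * (ereal (F (w (Suc t)) + grad F (w (Suc t)) (x - w (Suc t))) + ereal (real_of_ereal (\<phi> x)))"
      using \<psi>_Suc[OF t, of x] Suc.IH t \<phi>_real[OF that(2)] by simp
    then show ?case by (simp add: \<Psi>_def L_def)
  qed
  \<comment> \<open>Before the first iteration \<psi> is finite everywhere; from then on it is
    infinite outside \<open>dom\<close>, which forces its minimizers into
    \<open>dom\<close>.\<close>
  have \<psi>_out: "\<psi> t x \<noteq> - \<infinity> \<and> (0 < t \<longrightarrow> \<psi> t x = \<infinity>)" if "t \<le> m" "x \<in> E" "x \<notin> dom" for t x
    using that(1)
  proof (induction t)
    case 0
    then show ?case using init(4) by simp
  next
    case (Suc t)
    then have t: "t < m" by simp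
    have "\<phi> x = \<infinity>" using that by (simp add: eff_dom_def)
    then have "\<psi> (Suc t) x = \<psi> t x + \<infinity>" using \<psi>_Suc[OF t, of x] a_pos[OF t] by simp
    then show ?case using Suc.IH t by simp
  qed
  have v_dom: "v (Suc t) \<in> dom" and v_min: "\<And>y. y \<in> dom \<Longrightarrow> \<Psi> (Suc t) (v (Suc t)) \<le> \<Psi> (Suc t) y"
    if t: "t < m" for t
  proof -
    show vd: "v (Suc t) \<in> dom"
    proof (rule ccontr)
      assume "v (Suc t) \<notin> dom"
      then have "\<psi> (Suc t) (v (Suc t)) = \<infinity>" using \<psi>_out[of "Suc t"] vmin(1)[OF t] t by simp
      moreover have "\<psi> (Suc t) (w (Suc t)) < \<infinity>" using \<psi>_dom[of "Suc t"] w_dom[OF t] t by simp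
      ultimately show False using vmin(2)[OF t] dom_E[OF w_dom[OF t]] by auto
    qed
    fix y assume y: "y \<in> dom"
    have "ereal (\<Psi> (Suc t) (v (Suc t))) \<le> ereal (\<Psi> (Suc t) y)"
      using vmin(2)[OF t dom_E[OF y]] \<psi>_dom[of "Suc t"] t vd y by (simp add: not_less)
    then show "\<Psi> (Suc t) (v (Suc t)) \<le> \<Psi> (Suc t) y" by simp
  qed
  have q: "2 \<le> q" by (rule q_ge)
  have inv: "w t \<in> E \<and> v t \<in> E \<and> (0 < t \<longrightarrow> w t \<in> dom) \<and>
      (\<forall>x\<in>dom. A t * Ft (w t) + 2 powr (1 - q) / q * nrm (x - v t) powr q \<le> \<Psi> t x)" if "t \<le> m" for t
    using that
  proof (induction t)
    case 0
    \<comment> \<open>Initially \<open>A 0\<close> is 0 and \<open>v 0\<close> is \<open>w0\<close>,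
      so the invariant only says that the growth coefficient is at most that of the prox
      term.\<close>
    have "2 powr (1 - q) \<le> (2 :: real) powr 0" using q by (intro powr_mono) auto
    then have "2 powr (1 - q) / q * nrm (x - w0) powr q \<le> nrm (x - w0) powr q / q" for x
      using q by (simp add: divide_le_cancel mult_left_le_one_le)
    then show ?case using init w0 by (simp add: \<Psi>_def)
  next
    case (Suc t)
    then have t: "t < m" by simp
    note IH = Suc.IH[OF less_imp_le[OF t]]
    define w' where "w' = w (Suc t)"
    define A' where "A' = A (Suc t)"
    define s where "s u = grad F w' u + g (Suc t) u" for u
    have w'd: "w' \<in> dom" using w_dom[OF t] by (simp add: w'_def)
    have w'E: "w' \<in> E" using dom_E[OF w'd] .
    have A't: "A' = A t + a t" using A_Suc[OF t] by (simp add: A'_def)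
    have A'0: "0 < A'" using growth(2)[of t] a_pos[OF t] t A't by simp
    have E: "w t \<in> E" "v t \<in> E" using IH by auto
    have \<eta>E: "\<eta> t \<in> E" unfolding \<eta>[OF t] using E by auto
    define r where "r = nrm (w' - \<eta> t)"
    have r0: "0 \<le> r" using w'E \<eta>E by (simp add: r_def)
    note est = tensor_step_estimate[OF step[OF t] \<eta>E, folded w'_def, folded s_def r_def]
    have lb: "A' * Ft w' \<le> \<Psi> (Suc t) x" if x: "x \<in> dom" for x
    proof -
      have xE: "x \<in> E" using dom_E[OF x] .
      \<comment> \<open>The starting point may lie outside \<open>dom\<close>, where the subgradient
        inequality says nothing, but there the weight \<open>A 0\<close> is 0.\<close>
      have 1: "A t * (Ft w' + s (w t - w')) \<le> A t * Ft (w t)"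
      proof (cases "t = 0")
        case False
        then show ?thesis using IH est(5)[of "w t"] growth(2)[of t] t by (intro mult_left_mono) auto
      qed (use init in simp)
      have 2: "a t * (Ft w' + s (x - w')) \<le> a t * L t x"
        using est(6)[OF x] a_pos[OF t] by (intro mult_left_mono) (auto simp: L_def Ft_def s_def w'_def)
      \<comment> \<open>The extrapolated point is the weighted mean of \<open>w t\<close> and
        \<open>v t\<close>. Regrouping thus isolates the decrease of the tensor step, taken from
        that point, and an error measured from \<open>v t\<close>, where the growth term of the
        invariant is available.\<close>
      have 3: "A t * s (w t - w') + a t * s (x - w') = A' * s (\<eta> t - w') + a t * s (x - v t)"
      proof -
        have lin: "s (c *\<^sub>R y) = c * s y" "s (y + y') = s y + s y'" if "y \<in> E" "y' \<in> E" for c y y'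
          using est(2) that by (auto simp: linear_functional_on_def)
        have "A' *\<^sub>R \<eta> t = A t *\<^sub>R w t + a t *\<^sub>R v t"
        proof -
          have "A' *\<^sub>R \<eta> t = (A' * (1 - a t / A')) *\<^sub>R w t + (A' * (a t / A')) *\<^sub>R v t"
            unfolding \<eta>[OF t] A'_def[symmetric] by (simp add: scaleR_add_right)
          moreover have "A' * (1 - a t / A') = A t" "A' * (a t / A') = a t"
            using A'0 A't by (simp_all add: right_diff_distrib)
          ultimately show ?thesis by (simp only:)
        qed
        then have "A t *\<^sub>R (w t - w') + a t *\<^sub>R (x - w') = A' *\<^sub>R (\<eta> t - w') + a t *\<^sub>R (x - v t)"
          by (simp add: scaleR_diff_right A't scaleR_add_left)
        then have "s (A t *\<^sub>R (w t - w') + a t *\<^sub>R (x - w')) = s (A' *\<^sub>R (\<eta> t - w') + a t *\<^sub>R (x - v t))"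
          by simp
        then show ?thesis using E xE w'E \<eta>E by (simp only: lin E_closed)
      qed
      have 4: "- (a t * s (x - v t)) \<le> A' * s (\<eta> t - w') + 2 powr (1 - q) / q * nrm (x - v t) powr q"
      proof -
        have "- (a t * s (x - v t)) \<le> a t * \<bar>s (x - v t)\<bar>"
          using a_pos[OF t] by (simp add: abs_if)
        also have "\<dots> \<le> a t * ((q + 1) * lam * r powr (q - 1) * nrm (x - v t))"
          using est(3)[of "x - v t"] E xE a_pos[OF t] by (intro mult_left_mono) auto
        also have "\<dots> \<le> A' * ((q - 1) * lam * r powr q) + 2 powr (1 - q) / q * nrm (x - v t) powr q"
          using a_pos[OF t] a_eq[OF t] A'0 r0 E xE by (intro step_inequality) (auto simp: A'_def)
        also have "\<dots> \<le> A' * s (\<eta> t - w') + 2 powr (1 - q) / q * nrm (x - v t) powr q"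
          using est(4) A'0 by (intro add_right_mono mult_left_mono) auto
        finally show ?thesis .
      qed
      have "A' * Ft w' = A t * (Ft w' + s (w t - w')) + a t * (Ft w' + s (x - w'))
          - (A t * s (w t - w') + a t * s (x - w'))"
        by (simp add: A't algebra_simps)
      also have "\<dots> \<le> A t * Ft (w t) + a t * L t x - (A' * s (\<eta> t - w') + a t * s (x - v t))"
        unfolding 3 using 1 2 by (intro diff_right_mono add_mono)
      also have "\<dots> \<le> A t * Ft (w t) + a t * L t x + 2 powr (1 - q) / q * nrm (x - v t) powr q"
        using 4 by linarith
      also have "\<dots> \<le> \<Psi> t x + a t * L t x" using IH x by (simp add: add.commute add.left_commute)
      also have "\<dots> = \<Psi> (Suc t) x" by (simp add: \<Psi>_def)
      finally show ?thesis .
    qed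
    have "A' * Ft w' + 2 powr (1 - q) / q * nrm (x - v (Suc t)) powr q \<le> \<Psi> (Suc t) x" if x: "x \<in> dom" for x
    proof -
      have "\<Psi> (Suc t) (v (Suc t)) + 2 powr (1 - q) / q * nrm (x - v (Suc t)) powr q \<le> \<Psi> (Suc t) x"
        unfolding \<Psi>_def L_def
      proof (rule argmin_growth)
        show "0 \<le> a j" if "j < Suc t" for j using a_pos[of j] that t by simp
        show "w (Suc j) \<in> E" if "j < Suc t" for j using dom_E[OF w_dom[of j]] that t by simp
      qed (use w0 v_dom[OF t] x v_min[OF t] in \<open>auto simp: \<Psi>_def L_def\<close>)
      then show ?thesis using lb[OF v_dom[OF t]] by linarith
    qed
    then show ?case using w'd w'E vmin(1)[OF t] by (auto simp: w'_def A'_def)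
  qed
  show zd: "z \<in> dom" using inv[of m] m init by auto
  fix x assume x: "x \<in> dom"
  have A_sum: "A t = (\<Sum>j<t. a j)" if "t \<le> m" for t
    using that by (induction t) (auto simp: init A_Suc)
  have "A m * Ft z \<le> \<Psi> m x"
  proof -
    have "A m * Ft z + 2 powr (1 - q) / q * nrm (x - v m) powr q \<le> \<Psi> m x"
      using inv[of m] x init(5) by auto
    moreover have "0 \<le> 2 powr (1 - q) / q * nrm (x - v m) powr q" using q by simp
    ultimately show ?thesis by linarith
  qed
  also have "\<dots> \<le> nrm (x - w0) powr q / q + (\<Sum>j<m. a j * Ft x)"
    unfolding \<Psi>_def
  proof (intro add_left_mono sum_mono mult_left_mono)
    fix j assume "j \<in> {..<m}"
    then have j: "j < m" by simp
    show "L j x \<le> Ft x"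
      using grad_F_ineq[OF dom_E[OF w_dom[OF j]] dom_E[OF x]] by (simp add: L_def Ft_def)
    show "0 \<le> a j" using a_pos[OF j] by simp
  qed
  also have "\<dots> = nrm (x - w0) powr q / q + A m * Ft x"
    using A_sum[of m] by (simp add: sum_distrib_right)
  finally have main: "A m * Ft z \<le> nrm (x - w0) powr q / q + A m * Ft x" .
  define b where "b = c0 * (real m / q) powr q"
  have b: "0 < b" using c0_pos m q by (simp add: b_def)
  have bA: "b \<le> A m"
  proof -
    have "b = (real m * c0 powr (1 / q) / q) powr q"
      using c0_pos q by (simp add: b_def powr_mult powr_divide powr_powr)
    also have "\<dots> \<le> (A m powr (1 / q)) powr q"
      using growth(1)[of m] q by (intro powr_mono2) auto
    also have "\<dots> = A m" using growth(2)[of m] q by (simp add: powr_powr)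
    finally show ?thesis .
  qed
  then have Am: "0 < A m" using b by simp
  have "Ft z \<le> (nrm (x - w0) powr q / q + A m * Ft x) / A m"
    using main Am by (simp add: le_divide_eq mult.commute)
  also have "\<dots> = Ft x + nrm (x - w0) powr q / (q * A m)"
    using Am by (simp add: add_divide_distrib)
  also have "\<dots> \<le> Ft x + nrm (x - w0) powr q / (q * b)"
    using bA b q by (intro add_left_mono divide_left_mono mult_left_mono) (auto intro!: mult_pos_pos Am)
  finally show "Ft z \<le> Ft x + nrm (x - w0) powr q / (q * (c0 * (real m / q) powr q))"
    by (simp add: b_def)
qed

end

section \<open>Restarts\<close>

context composite_problem
begin

text \<open>The smooth part and \<phi> contribute plain convexity; the modulus comes entirely from
  the regularizer.\<close>

lemma Ft_midpoint:
  assumes "z \<in> dom" "y \<in> dom"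
  shows "(1/2) *\<^sub>R z + (1/2) *\<^sub>R y \<in> dom"
    "Ft ((1/2) *\<^sub>R z + (1/2) *\<^sub>R y) \<le> (Ft z + Ft y) / 2 - \<delta> / q * (2 powr (- q) * nrm (z - y) powr q)"
proof -
  define m where "m = (1/2) *\<^sub>R z + (1/2) *\<^sub>R y"
  have E: "z \<in> E" "y \<in> E" using assms dom_E by auto
  have \<phi>: "m \<in> dom" "real_of_ereal (\<phi> m) \<le> 1/2 * real_of_ereal (\<phi> z) + 1/2 * real_of_ereal (\<phi> y)"
    using dom_convex[OF assms, of "1/2"] by (simp_all add: m_def)
  then show "(1/2) *\<^sub>R z + (1/2) *\<^sub>R y \<in> dom" by (simp add: m_def)
  have "f m \<le> 1/2 * f z + 1/2 * f y"
    using convex_onD[OF f_convex, of "1/2" z y] E by (simp add: m_def)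
  moreover have "nrm (m - x0) powr q + 2 powr (- q) * nrm (z - y) powr q
      \<le> (nrm (z - x0) powr q + nrm (y - x0) powr q) / 2"
  proof -
    have "m - x0 = (1/2) *\<^sub>R (z - x0) + (1/2) *\<^sub>R (y - x0)"
      by (simp add: m_def algebra_simps flip: scaleR_add_left)
    then show ?thesis using nrm_powr_midpoint[of "z - x0" "y - x0" q] E x0 q_ge by simp
  qed
  then have "\<delta> / q * (nrm (m - x0) powr q + 2 powr (- q) * nrm (z - y) powr q)
      \<le> \<delta> / q * ((nrm (z - x0) powr q + nrm (y - x0) powr q) / 2)"
    using \<delta> q_ge by (intro mult_left_mono) auto
  then have "\<delta> / q * nrm (m - x0) powr q + \<delta> / q * (2 powr (- q) * nrm (z - y) powr q)
      \<le> (\<delta> / q * nrm (z - x0) powr q + \<delta> / q * nrm (y - x0) powr q) / 2"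
    by (simp only: distrib_left times_divide_eq_right)
  moreover have "a + b + c \<le> (a1 + b1 + c1 + (a2 + b2 + c2)) / 2 - n"
    if "a \<le> 1/2 * a1 + 1/2 * a2" "b + n \<le> (b1 + b2) / 2" "c \<le> 1/2 * c1 + 1/2 * c2"
    for a b c a1 b1 c1 a2 b2 c2 n :: real
    using that by (simp add: field_simps)
  ultimately show "Ft ((1/2) *\<^sub>R z + (1/2) *\<^sub>R y) \<le> (Ft z + Ft y) / 2 - \<delta> / q * (2 powr (- q) * nrm (z - y) powr q)"
    using \<phi>(2) unfolding m_def[symmetric] Ft_def F_eq by blast
qed

definition inner_iters :: nat where "inner_iters = alg6_inner p \<nu> Hf \<theta> \<delta>"

lemma inner_iters_pos: "0 < inner_iters" by (simp add: inner_iters_def alg6_inner_def)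

text \<open>The exponent splits as 4p + \<nu> - 2 = (3p - 1) + (q - 1): the first part cancels the
  power of two in \<open>c0\<close>, the second remains. The factors \<open>H_delta\<close>,
  \<delta>, q^q and the factorial cancel against the rest.\<close>

lemma alg6_inner_large: "2 powr (q - 1) \<le> \<delta> * (c0 * (real inner_iters / q) powr q)"
proof -
  define H where "H = H_delta p \<nu> Hf \<theta> \<delta>"
  have H: "0 < H" using H_delta_pos by (simp add: H_def)
  define X where "X = 2 powr (4 * real p + \<nu> - 2) * q powr q * H / (\<delta> * fact (p - 1))"
  have X: "0 < X" using H \<delta> q_ge by (simp add: X_def)
  have "X powr (1 / q) \<le> real inner_iters"
  proof -
    have "inner_iters = 1 + nat \<lceil>X powr (1 / q)\<rceil>"
      by (simp add: inner_iters_def alg6_inner_def X_def H_def q_def)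
    then show ?thesis using real_nat_ceiling_ge[of "X powr (1 / q)"] by linarith
  qed
  then have "(X powr (1 / q)) powr q \<le> real inner_iters powr q" using q_ge by (intro powr_mono2) auto
  then have "X \<le> real inner_iters powr q" using X q_ge by (simp add: powr_powr)
  then have "X / q powr q \<le> (real inner_iters / q) powr q"
    using q_ge by (simp add: powr_divide divide_right_mono)
  then have "\<delta> * (c0 * (X / q powr q)) \<le> \<delta> * (c0 * (real inner_iters / q) powr q)"
    using \<delta> c0_pos by (intro mult_left_mono) auto
  moreover have "\<delta> * (c0 * (X / q powr q)) = 2 powr (4 * real p + \<nu> - 2) / 2 ^ (3 * p - 1)"
    using \<delta> H q_ge unfolding X_def c0_def H_def[symmetric] by simp
  moreover have "\<dots> = 2 powr (q - 1)"
  proof -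
    have "(2 :: real) ^ (3 * p - 1) = 2 powr (3 * real p - 1)"
      using p by (simp add: powr_realpow[symmetric] of_nat_diff)
    moreover have "4 * real p + \<nu> - 2 - (3 * real p - 1) = q - 1" by (simp add: q_def)
    ultimately show ?thesis by (metis powr_diff)
  qed
  ultimately show ?thesis by simp
qed

text \<open>The number of inner iterations is large enough to bring the rate down to \<delta>/q
  times 2^(1-q), the very multiple of the distance power that uniform convexity can bound by the
  gap.\<close>

lemma restart_bound:
  assumes "accelerated y inner_iters y'" "y \<in> E" "z \<in> dom"
  shows "Ft y' \<le> Ft z + \<delta> / q * (2 powr (1 - q) * nrm (z - y) powr q)"
proof -
  define b where "b = c0 * (real inner_iters / q) powr q"
  have b: "0 < b" using c0_pos inner_iters_pos q_ge by (simp add: b_def)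
  have "1 \<le> \<delta> * 2 powr (1 - q) * b"
  proof -
    have "2 powr (1 - q) * 2 powr (q - 1) \<le> 2 powr (1 - q) * (\<delta> * b)"
      using alg6_inner_large by (intro mult_left_mono) (auto simp: b_def)
    moreover have "2 powr (1 - q) * 2 powr (q - 1) = (1 :: real)" by (simp flip: powr_add)
    ultimately have "1 \<le> 2 powr (1 - q) * (\<delta> * b)" by (simp only:)
    then show ?thesis by (simp only: mult_ac)
  qed
  then have "nrm (z - y) powr q * 1 \<le> nrm (z - y) powr q * (\<delta> * 2 powr (1 - q) * b)"
    by (intro mult_left_mono) auto
  then have "nrm (z - y) powr q / (q * b) \<le> \<delta> / q * (2 powr (1 - q) * nrm (z - y) powr q)"
    using b q_ge by (simp add: divide_le_eq mult_ac)
  then show ?thesis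
    using alg5_bound(2)[OF assms(1,2) inner_iters_pos assms(3)] by (simp add: b_def)
qed

text \<open>An infimum and not a minimum value: attainment is not established, and approximate
  minimizers suffice.\<close>

definition Fstar :: real where "Fstar = Inf (Ft ` dom)"
definition \<rho> :: real where "\<rho> = 1 / (1 + 2 powr (1 - q))"

lemma \<rho>: "0 < \<rho>" "\<rho> < 1"
  by (simp_all add: \<rho>_def add_pos_pos)

end

section \<open>Contraction of the gap under restarts\<close>

locale composite_problem_with_minimizer = composite_problem +
  fixes xs :: 'a and R :: real
  assumes xs: "xs \<in> dom"
    and minimal: "\<And>x. x \<in> dom \<Longrightarrow> f xs + real_of_ereal (\<phi> xs) \<le> f x + real_of_ereal (\<phi> x)"
    and R: "nrm (x0 - xs) \<le> R" "1 \<le> R"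
begin

lemma Ft_lower: "x \<in> dom \<Longrightarrow> f xs + real_of_ereal (\<phi> xs) + \<delta> / q * nrm (x - x0) powr q \<le> Ft x"
  using minimal[of x] by (simp add: Ft_def F_eq)

lemma Ft_ge: "x \<in> dom \<Longrightarrow> f xs + real_of_ereal (\<phi> xs) \<le> Ft x"
proof -
  assume x: "x \<in> dom"
  have "0 \<le> \<delta> / q * nrm (x - x0) powr q" using \<delta> q_ge by simp
  then show ?thesis using Ft_lower[OF x] by linarith
qed

lemma Fstar_le: "x \<in> dom \<Longrightarrow> Fstar \<le> Ft x"
  unfolding Fstar_def using Ft_ge by (intro cInf_lower bdd_belowI2[of _ "f xs + real_of_ereal (\<phi> xs)"]) auto

lemma Fstar_ge: "f xs + real_of_ereal (\<phi> xs) \<le> Fstar"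
  unfolding Fstar_def using xs Ft_ge by (intro cInf_greatest) auto

lemma Fstar_approx:
  assumes "0 < e" obtains z where "z \<in> dom" "Ft z < Fstar + e"
proof -
  have "Inf (Ft ` dom) < Fstar + e" using assms by (simp add: Fstar_def)
  then have "\<exists>v\<in>Ft ` dom. v < Fstar + e" using xs by (intro cInf_lessD) auto
  then show thesis using that by blast
qed

text \<open>Uniform convexity is only used along halvings towards an approximate minimizer \<open>z\<close>: two of them
  give the factor \<open>1 + 2 powr (1 - q) > 1\<close>, one alone would not contract.\<close>

lemma uniform_convexity_gap:
  assumes "z \<in> dom" "y \<in> dom"
  shows "\<delta> / q * (2 powr (1 - q) * nrm (z - y) powr q) \<le> \<rho> * ((Ft y - Fstar) + 3 * (Ft z - Fstar))"
proof -
  define N where "N = nrm (z - y) powr q"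
  define c where "c = \<delta> / q * N"
  define w where "w = (1/2) *\<^sub>R z + (1/2) *\<^sub>R y"
  have w: "w \<in> dom" "Ft w \<le> (Ft z + Ft y) / 2 - c * 2 powr (- q)"
    using Ft_midpoint[OF assms] by (simp_all add: w_def c_def N_def mult_ac)
  have "nrm (z - w) powr q = 2 powr (- q) * N"
  proof -
    have "z - w = (1/2) *\<^sub>R (z - y)" by (simp add: w_def algebra_simps flip: scaleR_add_left)
    then show ?thesis by (simp add: N_def nrm_scale powr_mult powr_divide powr_minus_divide)
  qed
  \<comment> \<open>The second halving, between \<open>z\<close> and the first midpoint
    \<open>w\<close>; the new midpoint is bounded below by the infimum.\<close>
  then have "Fstar \<le> (Ft z + Ft w) / 2 - c * (2 powr (- q) * 2 powr (- q))"
    using Ft_midpoint[OF assms(1) w(1)] Fstar_le[of "(1/2) *\<^sub>R z + (1/2) *\<^sub>R w"]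
    by (simp add: c_def mult_ac)
  moreover have "2 * k + 4 * l \<le> (a - s) + 3 * (b - s)"
    if "s \<le> (b + t) / 2 - l" "t \<le> (b + a) / 2 - k" for s t a b k l :: real
    using that by (simp add: field_simps)
  ultimately have "2 * (c * 2 powr (- q)) + 4 * (c * (2 powr (- q) * 2 powr (- q))) \<le> (Ft y - Fstar) + 3 * (Ft z - Fstar)"
    using w(2) by blast
  \<comment> \<open>With b = 2^(-q) the two halvings contribute 2 b c + 4 b^2 c = 2 b c (1 + 2 b),
    and 2 b = 2^(1-q); this is the origin of \<rho>.\<close>
  moreover have "c * 2 powr (1 - q) * (1 + 2 powr (1 - q)) = 2 * (c * 2 powr (- q)) + 4 * (c * (2 powr (- q) * 2 powr (- q)))"
  proof -
    define b :: real where "b = 2 powr (- q)"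
    have "2 powr (1 - q) = 2 * b" using powr_add[of 2 1 "- q"] by (simp add: b_def)
    then show ?thesis unfolding b_def[symmetric] by (simp add: algebra_simps)
  qed
  moreover have "0 < 1 + (2 :: real) powr (1 - q)" by (simp add: add_pos_pos)
  ultimately have "c * 2 powr (1 - q) \<le> ((Ft y - Fstar) + 3 * (Ft z - Fstar)) / (1 + 2 powr (1 - q))"
    by (simp only: pos_le_divide_eq)
  then show ?thesis by (simp add: c_def N_def \<rho>_def mult_ac)
qed

text \<open>The rate is applied against an approximate minimizer \<open>z\<close>. Its own gap
  enters once from the rate and at most three times from uniform convexity, hence the accuracy
  e/4.\<close>

lemma restart_contraction:
  assumes run: "accelerated y inner_iters y'" and y: "y \<in> dom"
  shows "Ft y' - Fstar \<le> \<rho> * (Ft y - Fstar)"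
proof (rule field_le_epsilon)
  fix e :: real assume e: "0 < e"
  obtain z where z: "z \<in> dom" "Ft z < Fstar + e / 4" using Fstar_approx[of "e / 4"] e by auto
  have "Ft y' \<le> Ft z + \<rho> * ((Ft y - Fstar) + 3 * (Ft z - Fstar))"
    using restart_bound[OF run dom_E[OF y] z(1)] uniform_convexity_gap[OF z(1) y] by linarith
  then have "Ft y' \<le> Ft z + (\<rho> * (Ft y - Fstar) + \<rho> * (3 * (Ft z - Fstar)))"
    by (simp only: distrib_left)
  moreover have "\<rho> * (3 * (Ft z - Fstar)) \<le> 1 * (3 * (Ft z - Fstar))"
    using \<rho> Fstar_le[OF z(1)] by (intro mult_right_mono) auto
  moreover have "a - b \<le> c + e" if "a \<le> d + (c + h)" "h \<le> 1 * (3 * (d - b))" "d < b + e / 4" for a b c d h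
    using that by simp
  ultimately show "Ft y' - Fstar \<le> \<rho> * (Ft y - Fstar) + e"
    using z(2) by blast
qed

section \<open>Estimates along an initial segment of an execution\<close>

context
  fixes y u :: "nat \<Rightarrow> 'a" and g :: "nat \<Rightarrow> 'a \<Rightarrow> real" and N :: nat
  assumes y0: "y 0 = x0"
    and run: "\<And>k. k < N \<Longrightarrow> accelerated (y k) inner_iters (y (Suc k))"
    and step: "\<And>k. k < N \<Longrightarrow> acceptable (y (Suc k)) (u (Suc k)) (g (Suc k))"
begin

text \<open>Starts at index 1, since \<open>y 0\<close> is \<open>x0\<close>, which may lie outside
  \<open>dom\<close>. \<open>N\<close> is the number of restarts known to have been
  executed.\<close>

lemma y_dom: "k < N \<Longrightarrow> y (Suc k) \<in> dom"
proof (induction k)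
  case 0
  then show ?case using alg5_bound(1)[OF run[of 0] _ inner_iters_pos] y0 x0 by simp
next
  case (Suc k)
  then show ?case using alg5_bound(1)[OF run[of "Suc k"] _ inner_iters_pos] dom_E by simp
qed

text \<open>The contraction cannot start from \<open>x0\<close>, whose gap may be meaningless. The
  first restart is instead compared with \<open>xs\<close>, at a distance of at most R from
  \<open>x0\<close>; both the regularizer at \<open>xs\<close> and the rate contribute at most
  \<delta>/q R^q.\<close>

lemma first_gap:
  assumes "0 < N"
  shows "Ft (y 1) \<le> f xs + real_of_ereal (\<phi> xs) + 2 * (\<delta> / q * R powr q)"
proof -
  define c where "c = \<delta> / q * nrm (xs - x0) powr q"
  have c0': "0 \<le> c" using \<delta> q_ge by (simp add: c_def)
  have "Ft (y (Suc 0)) \<le> Ft xs + \<delta> / q * (2 powr (1 - q) * nrm (xs - x0) powr q)"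
    using restart_bound[OF run[OF assms] _ xs] y0 x0 by simp
  also have "\<delta> / q * (2 powr (1 - q) * nrm (xs - x0) powr q) = 2 powr (1 - q) * c"
    by (simp add: c_def)
  also have "\<dots> \<le> 1 * c"
  proof (rule mult_right_mono)
    show "2 powr (1 - q) \<le> 1" using powr_mono[of "1 - q" 0 2] q_ge by simp
  qed (rule c0')
  also have "Ft xs = f xs + real_of_ereal (\<phi> xs) + c" by (simp add: Ft_def F_eq c_def)
  finally have "Ft (y 1) \<le> f xs + real_of_ereal (\<phi> xs) + 2 * c" by simp
  moreover have "c \<le> \<delta> / q * R powr q"
    unfolding c_def using \<delta> q_ge R xs x0 dom_E nrm_minus_commute[of x0 xs]
    by (intro mult_left_mono powr_mono2) auto
  ultimately show ?thesis by linarith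
qed

lemma gap_bound: "k < N \<Longrightarrow> Ft (y (Suc k)) - Fstar \<le> \<rho> ^ k * (\<delta> * R powr q)"
proof (induction k)
  case 0
  \<comment> \<open>The factor 2 of the first gap is absorbed by q \<ge> 2, which removes the
    division by q.\<close>
  have "2 * (\<delta> / q * R powr q) \<le> q * (\<delta> / q * R powr q)"
    using q_ge \<delta> by (intro mult_right_mono) auto
  then show ?case using first_gap 0 Fstar_ge q_ge by simp
next
  case (Suc k)
  have "Ft (y (Suc (Suc k))) - Fstar \<le> \<rho> * (Ft (y (Suc k)) - Fstar)"
    using Suc.prems by (intro restart_contraction run y_dom) auto
  also have "\<dots> \<le> \<rho> * (\<rho> ^ k * (\<delta> * R powr q))" using Suc \<rho> by (intro mult_left_mono) auto
  finally show ?case by (simp add: mult_ac)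
qed

lemma gap_antimono: "k < N \<Longrightarrow> Ft (y (Suc k)) \<le> Ft (y 1)"
proof (induction k)
  case (Suc k)
  have "Ft (y (Suc (Suc k))) - Fstar \<le> \<rho> * (Ft (y (Suc k)) - Fstar)"
    using Suc.prems by (intro restart_contraction run y_dom) auto
  also have "\<dots> \<le> 1 * (Ft (y (Suc k)) - Fstar)"
    using \<rho> Fstar_le[OF y_dom[of k]] Suc.prems by (intro mult_right_mono) auto
  finally show ?case using Suc by simp
qed simp

text \<open>The decrease of the final tensor step cannot exceed the gap, so the step length
  satisfies \<open>lam * r powr q\<close> \<le> gap. The gradient is of order
  \<open>lam * r powr (q - 1)\<close>, and eliminating r leaves lam^(1/q) times the gap to the power
  (q-1)/q.\<close>

lemma gradient_bound:
  assumes k: "k < N"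
  shows "dual_norm E B (\<lambda>h. grad F (u (Suc k)) h + g (Suc k) h)
     \<le> (q + 1) * lam powr (1 / q) * (\<rho> ^ k * (\<delta> * R powr q)) powr ((q - 1) / q)"
proof -
  define r where "r = nrm (u (Suc k) - y (Suc k))"
  have yE: "y (Suc k) \<in> E" using y_dom[OF k] dom_E by simp
  note est = tensor_step_estimate[OF step[OF k] yE, folded r_def]
  have uE: "u (Suc k) \<in> E" using est(1) dom_E by simp
  have r0: "0 \<le> r" using yE uE by (simp add: r_def)
  have q: "2 \<le> q" by (rule q_ge)
  define G where "G = \<rho> ^ k * (\<delta> * R powr q)"
  have G0: "0 \<le> G" using \<rho> \<delta> by (simp add: G_def)
  have "1 * (lam * r powr q) \<le> (q - 1) * (lam * r powr q)" using q lam_pos by (intro mult_right_mono) auto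
  also have "\<dots> \<le> Ft (y (Suc k)) - Ft (u (Suc k))"
    using est(4) est(5)[OF y_dom[OF k]] by (simp add: mult.assoc)
  also have "\<dots> \<le> G" using gap_bound[OF k] Fstar_le[OF est(1)] by (simp add: G_def)
  finally have rq: "r powr q \<le> G / lam" using lam_pos by (simp add: pos_le_divide_eq mult.commute)
  have "r powr (q - 1) = (r powr q) powr ((q - 1) / q)" using q by (simp add: powr_powr)
  also have "\<dots> \<le> (G / lam) powr ((q - 1) / q)" using rq q by (intro powr_mono2) auto
  finally have 1: "r powr (q - 1) \<le> (G / lam) powr ((q - 1) / q)" .
  have "dual_norm E B (\<lambda>h. grad F (u (Suc k)) h + g (Suc k) h) \<le> (q + 1) * lam * r powr (q - 1)"
  proof (rule dual_norm_le[OF est(2)])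
    show "grad F (u (Suc k)) h + g (Suc k) h \<le> (q + 1) * lam * r powr (q - 1) * nrm h" if "h \<in> E" for h
      using est(3)[OF that] by simp
  qed (use q lam_pos in auto)
  also have "\<dots> \<le> (q + 1) * lam * (G / lam) powr ((q - 1) / q)"
    using 1 q lam_pos by (intro mult_left_mono) auto
  also have "\<dots> = (q + 1) * (lam powr (1 / q)) * G powr ((q - 1) / q)"
  proof -
    have "lam = lam powr (1 / q) * lam powr ((q - 1) / q)"
      using q lam_pos by (simp flip: powr_add add_divide_distrib)
    then have "lam / lam powr ((q - 1) / q) = lam powr (1 / q)"
      using lam_pos by (metis nonzero_mult_div_cancel_right powr_eq_0_iff less_irrefl)
    moreover have "(q + 1) * lam * (G / lam) powr ((q - 1) / q) = (q + 1) * (lam / lam powr ((q - 1) / q)) * G powr ((q - 1) / q)"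
      using G0 lam_pos by (simp add: powr_divide)
    ultimately show ?thesis by (simp only:)
  qed
  finally show ?thesis by (simp add: G_def)
qed

text \<open>The value at \<open>u\<close> is at most that after the first restart. Minimality of
  \<open>xs\<close> cancels the original objective from this comparison and leaves the regularizer
  at \<open>u\<close> below 2 \<delta>/q R^q, so the distance to \<open>x0\<close> is at most 2 R.
  The prescribed \<delta> makes \<delta> (2R)^(q-1) equal to \<epsilon>/2.\<close>

lemma gradient_transfer:
  assumes k: "k < N" and \<delta>_eq: "\<delta> = \<epsilon> / (2 powr q * R powr (q - 1))"
    and small: "dual_norm E B (\<lambda>h. grad F (u (Suc k)) h + g (Suc k) h) \<le> \<epsilon> / 2"
  shows "dual_norm E B (\<lambda>h. grad f (u (Suc k)) h + g (Suc k) h) \<le> \<epsilon>"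
proof -
  have q: "2 \<le> q" by (rule q_ge)
  define x where "x = u (Suc k)"
  have yE: "y (Suc k) \<in> E" using y_dom[OF k] dom_E by simp
  note est = tensor_step_estimate[OF step[OF k] yE]
  have xE: "x \<in> E" using est(1) dom_E by (simp add: x_def)
  have "\<epsilon> = \<delta> * (2 powr q * R powr (q - 1))" using R by (simp add: \<delta>_eq)
  then have \<epsilon>: "0 < \<epsilon>" using \<delta> R by simp
  have "0 \<le> (q - 1) * lam * nrm (u (Suc k) - y (Suc k)) powr q" using q lam_pos by simp
  then have "Ft x \<le> Ft (y (Suc k))"
    using est(4) est(5)[OF y_dom[OF k]] unfolding x_def by linarith
  also have "\<dots> \<le> f xs + real_of_ereal (\<phi> xs) + 2 * (\<delta> / q * R powr q)"
    using gap_antimono[OF k] first_gap k by linarith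
  finally have "\<delta> / q * nrm (x - x0) powr q \<le> 2 * (\<delta> / q * R powr q)"
    using Ft_lower[OF est(1)] unfolding x_def by linarith
  then have "\<delta> / q * nrm (x - x0) powr q \<le> \<delta> / q * (2 * R powr q)" by (simp only: mult.left_commute)
  then have "nrm (x - x0) powr q \<le> 2 powr 1 * R powr q" using \<delta> q by (simp add: mult_le_cancel_left divide_le_cancel)
  also have "\<dots> \<le> 2 powr q * R powr q" using q by (intro mult_right_mono powr_mono) auto
  also have "\<dots> = (2 * R) powr q" using R by (simp add: powr_mult)
  finally have nx: "nrm (x - x0) \<le> 2 * R"
    using powr_less_mono2[of q "2 * R" "nrm (x - x0)"] q R by (force simp: not_le[symmetric])
  have "\<delta> * nrm (x - x0) powr (q - 1) \<le> \<delta> * (2 * R) powr (q - 1)"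
    using \<delta> nx q xE x0 by (intro mult_left_mono powr_mono2) auto
  also have "\<dots> = \<epsilon> / 2"
  proof -
    have "(2 :: real) powr q = 2 * 2 powr (q - 1)" using powr_add[of 2 1 "q - 1"] by simp
    then show ?thesis using R by (simp add: \<delta>_eq powr_mult)
  qed
  finally have half: "\<delta> * nrm (x - x0) powr (q - 1) \<le> \<epsilon> / 2" .
  have g_lin: "linear_functional_on E (\<lambda>h. grad f x h + g (Suc k) h)"
  proof -
    have "linear (g (Suc k))" using step[OF k] by (simp add: tensor_step_def subdiff_def)
    then show ?thesis using linear_functional_on_grad_f[OF xE]
      by (simp add: linear_functional_on_def linear_add linear_scale distrib_left)
  qed
  have "dual_norm E B (\<lambda>h. grad f x h + g (Suc k) h) \<le> \<epsilon>"
  proof (rule dual_norm_le[OF g_lin])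
    fix h assume h: "h \<in> E"
    have "\<bar>grad F x h + g (Suc k) h\<bar> \<le> \<epsilon> / 2 * nrm h"
      using dual_norm_bound[OF est(2) h] mult_right_mono[OF small nrm_nonneg[OF h]] by (simp add: x_def)
    moreover have "\<bar>\<delta> * nrm (x - x0) powr (q - 2) * B (x - x0) h\<bar> \<le> \<epsilon> / 2 * nrm h"
    proof -
      have "\<bar>\<delta> * nrm (x - x0) powr (q - 2) * B (x - x0) h\<bar> = \<delta> * (nrm (x - x0) powr (q - 2) * \<bar>B (x - x0) h\<bar>)"
        using \<delta> by (simp add: abs_mult)
      also have "\<dots> \<le> \<delta> * (nrm (x - x0) powr (q - 2) * (nrm (x - x0) * nrm h))"
        using \<delta> B_cauchy_schwarz[of "x - x0" h] xE x0 h by (intro mult_left_mono) auto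
      also have "nrm (x - x0) powr (q - 2) * (nrm (x - x0) * nrm h) = nrm (x - x0) powr (q - 1) * nrm h"
        using xE x0 q powr_add[of "nrm (x - x0)" "q - 2" 1] by (cases "nrm (x - x0) = 0") auto
      also have "\<delta> * (nrm (x - x0) powr (q - 1) * nrm h) \<le> \<epsilon> / 2 * nrm h"
        using mult_right_mono[OF half nrm_nonneg[OF h]] by (simp add: mult.assoc)
      finally show ?thesis .
    qed
    moreover have "a + c \<le> X + X" if "\<bar>b + c\<bar> \<le> X" "\<bar>t\<bar> \<le> X" "b = a + t" for a b c t X :: real
      using that by linarith
    ultimately have "grad f x h + g (Suc k) h \<le> \<epsilon> / 2 * nrm h + \<epsilon> / 2 * nrm h"
      using grad_F[OF xE h] by blast
    then show "grad f x h + g (Suc k) h \<le> \<epsilon> * nrm h" by simp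
  qed (use \<epsilon> in simp)
  then show ?thesis by (simp add: x_def)
qed

end

end

section \<open>Iteration count\<close>

lemma real_nat_ceiling_le: "real (nat \<lceil>x\<rceil>) \<le> \<bar>x\<bar> + 1"
  by linarith

text \<open>Arithmetic of real numbers only, so that \<open>C\<close> is fixed before any space or
  function is given. \<open>n\<close> is a number of restarts after which the bound on the gradient
  falls below \<epsilon>/2. The lower bound 2 on the ratio makes its logarithm at least 1, which
  absorbs additive constants.\<close>

lemma iteration_count:
  fixes p :: nat and \<nu> Hf \<theta> q :: real
  assumes p: "2 \<le> p" and \<nu>: "0 \<le> \<nu>" "\<nu> \<le> 1" and "0 \<le> Hf" "0 \<le> \<theta>" and q_def: "q = real p + \<nu>"
  shows "\<exists>C. \<forall>R \<epsilon> \<delta>. 1 \<le> R \<longrightarrow> 0 < \<epsilon> \<longrightarrow> \<epsilon> < 1 \<longrightarrow> \<delta> = \<epsilon> / (2 powr q * R powr (q - 1)) \<longrightarrow>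
    2 \<le> R powr (q - 1) / \<epsilon> \<longrightarrow>
    (\<exists>n. real (Suc n * alg6_inner p \<nu> Hf \<theta> \<delta>)
           \<le> C * (log 2 (R powr (q - 1) / \<epsilon>) * (R powr (q - 1) / \<epsilon>) powr (1 / q)) \<and>
         (q + 1) * ((Hf + \<delta> / q * C_const p \<nu>) / fact (p - 1) + 3 * \<theta>) powr (1 / q)
           * ((1 / (1 + 2 powr (1 - q))) ^ n * (\<delta> * R powr q)) powr ((q - 1) / q) \<le> \<epsilon> / 2)"
proof -
  have q: "2 \<le> q" using p \<nu> by (simp add: q_def)
  have Cp: "0 < C_const p \<nu>" unfolding C_const_def using \<nu> by (intro mult_pos_pos prod_pos) auto
  \<comment> \<open>The coefficient \<open>lam\<close> depends on \<delta>; since \<delta>/q \<le>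
    1, replacing \<delta>/q by 1 gives an upper bound free of R and \<epsilon>. \<open>H\<close>
    below arises in the same way.\<close>
  define L where "L = (Hf + C_const p \<nu>) / fact (p - 1) + 3 * \<theta>"
  have L: "0 < L" unfolding L_def using assms Cp by (intro add_pos_nonneg divide_pos_pos add_nonneg_pos) auto
  define \<kappa> where "\<kappa> = 2 * (q + 1) * L powr (1 / q)"
  have \<kappa>: "0 < \<kappa>" using q L by (simp add: \<kappa>_def)
  \<comment> \<open>The decay rate of the restarts: \<tau> is minus the logarithm of the contraction
    factor.\<close>
  define \<tau> where "\<tau> = ln (1 + 2 powr (1 - q))"
  have \<tau>: "0 < \<tau>" unfolding \<tau>_def by (rule ln_gt_zero) simp
  define H where "H = real p * ((Hf + C_const p \<nu>) + 3 * \<theta> * fact (p - 1))"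
  define X1 where "X1 = 2 powr (4 * real p + \<nu> - 2) * q powr q / fact (p - 1) * H * 2 powr q"
  have H0: "0 \<le> H" unfolding H_def using assms Cp by simp
  have X10: "0 \<le> X1" unfolding X1_def using H0 by simp
  define C1 where "C1 = 2 + (2 * \<bar>ln \<kappa>\<bar> + 1) / \<tau>"
  define C2 where "C2 = 2 + X1 powr (1 / q)"
  have C1: "0 \<le> C1" using \<tau> by (simp add: C1_def)
  show ?thesis
  proof (intro exI[of _ "C1 * C2"] allI impI)
    fix R \<epsilon> \<delta> :: real
    assume R: "1 \<le> R" and \<epsilon>: "0 < \<epsilon>" "\<epsilon> < 1" and \<delta>: "\<delta> = \<epsilon> / (2 powr q * R powr (q - 1))"
      and Q2: "2 \<le> R powr (q - 1) / \<epsilon>"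
    define Q where "Q = R powr (q - 1) / \<epsilon>"
    have Q: "2 \<le> Q" using Q2 by (simp add: Q_def)
    have \<delta>0: "0 < \<delta>" using \<delta> R \<epsilon> by simp
    have \<delta>Q: "1 / \<delta> = 2 powr q * Q" using \<epsilon> by (simp add: \<delta> Q_def)
    have \<delta>q: "\<delta> / q \<le> 1"
    proof -
      have "1 * 1 \<le> 2 powr q * Q" using q Q by (intro mult_mono ge_one_powr_ge_zero) auto
      then have "\<delta> * 1 \<le> \<delta> * (2 powr q * Q)" using \<delta>0 by (intro mult_left_mono) auto
      then have "\<delta> \<le> 1" using \<delta>0 by (simp flip: \<delta>Q)
      then show ?thesis using q by (simp add: divide_le_eq)
    qed
    then have \<delta>C: "\<delta> / q * C_const p \<nu> \<le> C_const p \<nu>" using Cp by (intro mult_left_le_one_le) (use \<delta>0 q in auto)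
    define lg where "lg = log 2 Q"
    have lg: "1 \<le> lg" using Q by (simp add: lg_def le_log_iff)
    have lnQ: "0 \<le> ln Q" "ln Q \<le> lg"
    proof -
      show 0: "0 \<le> ln Q" using Q by simp
      have "ln Q * ln 2 \<le> ln Q * 1" using 0 ln2_le_25_over_36 by (intro mult_left_mono) auto
      then show "ln Q \<le> lg" by (simp add: lg_def log_def le_divide_eq)
    qed
    \<comment> \<open>The solution of exp(-Y) \<epsilon> R = (\<epsilon>/\<kappa>)^(q/(q-1)), with R
      expressed through Q and \<epsilon>. As \<open>n\<close> times \<tau> is at least Y, the gap
      after the restarts is small enough.\<close>
    define Y where "Y = q / (q - 1) * ln \<kappa> + ln Q / (q - 1)"
    define n where "n = nat \<lceil>Y / \<tau>\<rceil>"
    have "\<bar>Y\<bar> \<le> 2 * \<bar>ln \<kappa>\<bar> + ln Q"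
    proof -
      have "\<bar>Y\<bar> \<le> \<bar>q / (q - 1) * ln \<kappa>\<bar> + \<bar>ln Q / (q - 1)\<bar>" unfolding Y_def by (rule abs_triangle_ineq)
      also have "\<bar>q / (q - 1) * ln \<kappa>\<bar> = q / (q - 1) * \<bar>ln \<kappa>\<bar>" using q by (simp add: abs_mult)
      also have "q / (q - 1) * \<bar>ln \<kappa>\<bar> \<le> 2 * \<bar>ln \<kappa>\<bar>" using q by (intro mult_right_mono) (auto simp: divide_le_eq)
      also have "\<bar>ln Q / (q - 1)\<bar> = ln Q / (q - 1)" using lnQ q by simp
      also have "ln Q / (q - 1) \<le> ln Q / 1" using lnQ q by (intro divide_left_mono) auto
      finally show ?thesis by simp
    qed
    also have "\<dots> \<le> 2 * \<bar>ln \<kappa>\<bar> * lg + 1 * lg"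
      using lg lnQ mult_left_mono[OF lg, of "2 * \<bar>ln \<kappa>\<bar>"] by simp
    finally have "\<bar>Y\<bar> \<le> (2 * \<bar>ln \<kappa>\<bar> + 1) * lg" by (simp only: distrib_right)
    then have "\<bar>Y\<bar> / \<tau> \<le> (2 * \<bar>ln \<kappa>\<bar> + 1) * lg / \<tau>" using \<tau> by (intro divide_right_mono) auto
    moreover have "real n \<le> \<bar>Y\<bar> / \<tau> + 1"
      using real_nat_ceiling_le[of "Y / \<tau>"] \<tau> by (simp add: n_def)
    ultimately have n_le: "real (Suc n) \<le> C1 * lg"
      using lg by (simp add: C1_def distrib_right)
    have m_le: "real (alg6_inner p \<nu> Hf \<theta> \<delta>) \<le> C2 * Q powr (1 / q)"
    proof -
      define X where "X = 2 powr (4 * real p + \<nu> - 2) * q powr q * H_delta p \<nu> Hf \<theta> \<delta> / (\<delta> * fact (p - 1))"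
      have HH: "0 \<le> H_delta p \<nu> Hf \<theta> \<delta>" "H_delta p \<nu> Hf \<theta> \<delta> \<le> H"
        unfolding H_delta_def H_def q_def[symmetric] using assms \<delta>C \<delta>0 q Cp
        by (auto intro!: mult_left_mono mult_nonneg_nonneg add_nonneg_nonneg)
      have "X = 2 powr (4 * real p + \<nu> - 2) * q powr q / fact (p - 1) * H_delta p \<nu> Hf \<theta> \<delta> * (1 / \<delta>)"
        by (simp add: X_def)
      also have "\<dots> \<le> 2 powr (4 * real p + \<nu> - 2) * q powr q / fact (p - 1) * H * (1 / \<delta>)"
        using HH \<delta>0 by (intro mult_right_mono mult_left_mono) auto
      also have "\<dots> = X1 * Q" by (simp only: \<delta>Q X1_def mult.assoc)
      finally have X: "X \<le> X1 * Q" .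
      have X0: "0 \<le> X" unfolding X_def using HH \<delta>0 by simp
      have "alg6_inner p \<nu> Hf \<theta> \<delta> = 1 + nat \<lceil>X powr (1 / q)\<rceil>"
        by (simp add: alg6_inner_def X_def q_def)
      then have "real (alg6_inner p \<nu> Hf \<theta> \<delta>) \<le> 2 + X powr (1 / q)"
        using real_nat_ceiling_le[of "X powr (1 / q)"] abs_of_nonneg[OF powr_ge_zero, of X "1 / q"]
        by (simp only: of_nat_add of_nat_1)
      also have "\<dots> \<le> 2 * Q powr (1 / q) + (X1 * Q) powr (1 / q)"
        using X X0 Q q ge_one_powr_ge_zero[of Q "1 / q"] by (intro add_mono powr_mono2) auto
      also have "\<dots> = C2 * Q powr (1 / q)" using X10 Q by (simp add: C2_def powr_mult distrib_right)
      finally show ?thesis .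
    qed
    have bound: "real (Suc n * alg6_inner p \<nu> Hf \<theta> \<delta>) \<le> C1 * C2 * (lg * Q powr (1 / q))"
    proof -
      have "real (Suc n) * real (alg6_inner p \<nu> Hf \<theta> \<delta>) \<le> (C1 * lg) * (C2 * Q powr (1 / q))"
        using n_le m_le C1 lg by (intro mult_mono) auto
      then show ?thesis by (simp only: of_nat_mult mult_ac)
    qed
    define lam where "lam = (Hf + \<delta> / q * C_const p \<nu>) / fact (p - 1) + 3 * \<theta>"
    have lam: "0 \<le> lam" "lam \<le> L"
      unfolding lam_def L_def using assms \<delta>C \<delta>0 q Cp
      by (auto intro!: divide_right_mono add_nonneg_nonneg)
    define r where "r = 1 / (1 + 2 powr (1 - q))"
    have "(q + 1) * lam powr (1 / q) * (r ^ n * (\<delta> * R powr q)) powr ((q - 1) / q) \<le> \<epsilon> / 2"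
    proof -
      have "r = exp (- \<tau>)" by (simp add: r_def \<tau>_def exp_minus add_pos_pos inverse_eq_divide)
      then have "r ^ n = exp (real n * - \<tau>)" by (simp only: exp_of_nat_mult)
      also have "\<dots> \<le> exp (- Y)"
      proof -
        have "Y / \<tau> \<le> real n" unfolding n_def by (rule real_nat_ceiling_ge)
        then show ?thesis using \<tau> by (simp add: divide_le_eq)
      qed
      finally have rn: "r ^ n \<le> exp (- Y)" .
      have "\<delta> * R powr q \<le> \<epsilon> * R"
      proof -
        have "R powr q = R powr (q - 1) * R" using R powr_add[of R "q - 1" 1] by simp
        then have "\<delta> * R powr q = \<epsilon> * R / 2 powr q" using R by (simp add: \<delta>)
        also have "\<dots> \<le> \<epsilon> * R / 1" using \<epsilon> R q by (intro divide_left_mono ge_one_powr_ge_zero) auto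
        finally show ?thesis by simp
      qed
      then have "r ^ n * (\<delta> * R powr q) \<le> exp (- Y) * (\<epsilon> * R)"
        using rn \<delta>0 by (intro mult_mono[OF rn]) auto
      moreover have "0 \<le> r ^ n * (\<delta> * R powr q)"
        using \<delta>0 by (simp add: r_def add_nonneg_nonneg)
      ultimately have "(r ^ n * (\<delta> * R powr q)) powr ((q - 1) / q) \<le> (exp (- Y) * (\<epsilon> * R)) powr ((q - 1) / q)"
        using q by (intro powr_mono2) auto
      also have "\<dots> = \<epsilon> / \<kappa>"
      proof -
        have "ln (exp (- Y) * (\<epsilon> * R)) = - Y + (ln \<epsilon> + ln R)" using \<epsilon> R by (simp add: ln_mult)
        moreover have lnQ_eq: "ln Q = (q - 1) * ln R - ln \<epsilon>" using \<epsilon> R by (simp add: Q_def ln_div ln_powr)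
        have "(q - 1) * Y = q * ln \<kappa> + ln Q" using q by (simp add: Y_def distrib_left)
        then have "(q - 1) * (- Y + (ln \<epsilon> + ln R)) = q * (ln \<epsilon> - ln \<kappa>)"
          unfolding lnQ_eq by (simp add: algebra_simps)
        then have "(q - 1) / q * (- Y + (ln \<epsilon> + ln R)) = ln \<epsilon> - ln \<kappa>"
          using q by (simp add: divide_eq_eq mult.commute)
        ultimately show ?thesis using \<epsilon> R \<kappa> by (simp add: powr_def exp_diff)
      qed
      finally have 1: "(r ^ n * (\<delta> * R powr q)) powr ((q - 1) / q) \<le> \<epsilon> / \<kappa>" .
      have 2: "(q + 1) * lam powr (1 / q) \<le> \<kappa> / 2"
      proof -
        have "(q + 1) * lam powr (1 / q) \<le> (q + 1) * L powr (1 / q)"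
          using lam q by (intro mult_left_mono powr_mono2) auto
        also have "\<dots> = \<kappa> / 2" by (simp add: \<kappa>_def field_simps)
        finally show ?thesis .
      qed
      have "(q + 1) * lam powr (1 / q) * (r ^ n * (\<delta> * R powr q)) powr ((q - 1) / q) \<le> \<kappa> / 2 * (\<epsilon> / \<kappa>)"
        using 1 2 \<kappa> by (intro mult_mono) auto
      also have "\<dots> = \<epsilon> / 2" using \<kappa> by simp
      finally show ?thesis .
    qed
    with bound show "\<exists>n. real (Suc n * alg6_inner p \<nu> Hf \<theta> \<delta>)
           \<le> C1 * C2 * (log 2 (R powr (q - 1) / \<epsilon>) * (R powr (q - 1) / \<epsilon>) powr (1 / q)) \<and>
         (q + 1) * ((Hf + \<delta> / q * C_const p \<nu>) / fact (p - 1) + 3 * \<theta>) powr (1 / q)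
           * ((1 / (1 + 2 powr (1 - q))) ^ n * (\<delta> * R powr q)) powr ((q - 1) / q) \<le> \<epsilon> / 2"
      unfolding lg_def Q_def lam_def r_def by blast
  qed
qed

section \<open>Termination of the restarted method\<close>

context composite_problem_with_minimizer
begin

text \<open>An execution is unconstrained once the stopping test has succeeded, so the bounds apply
  only under the assumption that it has not. If it failed at all indices up to n + 1, the gradient
  bound for the last of them would contradict this. The first success is then positive, and all
  restarts leading to it were genuine.\<close>

lemma alg6_terminates:
  assumes exe: "alg6_execution E B p \<nu> Hf \<theta> f \<phi> x0 \<delta> \<epsilon> y u g"
    and \<delta>_eq: "\<delta> = \<epsilon> / (2 powr q * R powr (q - 1))"
    and n: "(q + 1) * lam powr (1 / q) * (\<rho> ^ n * (\<delta> * R powr q)) powr ((q - 1) / q) \<le> \<epsilon> / 2"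
  shows "\<exists>T\<le>Suc n. alg6_stop E B p \<nu> f x0 \<delta> \<epsilon> u g T \<and>
    (\<forall>j<T. \<not> alg6_stop E B p \<nu> f x0 \<delta> \<epsilon> u g j) \<and>
    dual_norm E B (\<lambda>h. grad f (u T) h + g T h) \<le> \<epsilon>"
proof -
  define stop where "stop = alg6_stop E B p \<nu> f x0 \<delta> \<epsilon> u g"
  have stop_iff: "stop k \<longleftrightarrow> 0 < k \<and> dual_norm E B (\<lambda>h. grad F (u k) h + g k h) \<le> \<epsilon> / 2" for k
    by (simp add: stop_def alg6_stop_def F_def)
  have y0: "y 0 = x0" using exe by (simp add: alg6_execution_def)
  have run: "accelerated (y k) inner_iters (y (Suc k))"
      "acceptable (y (Suc k)) (u (Suc k)) (g (Suc k))"
    if "\<And>j. j \<le> k \<Longrightarrow> \<not> stop j" for k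
    using exe that unfolding alg6_execution_def stop_def inner_iters_def by auto
  have ex: "\<exists>T\<le>Suc n. stop T"
  proof (rule ccontr)
    assume "\<not> ?thesis"
    then have no: "\<not> stop j" if "j \<le> Suc n" for j using that by blast
    have r: "accelerated (y k) inner_iters (y (Suc k))"
      "acceptable (y (Suc k)) (u (Suc k)) (g (Suc k))" if "k < Suc n" for k
      using that by (intro run no; simp)+
    have "dual_norm E B (\<lambda>h. grad F (u (Suc n)) h + g (Suc n) h) \<le> \<epsilon> / 2"
      using gradient_bound[of y "Suc n" u g n, OF y0 r] n by simp
    then have "stop (Suc n)" by (simp add: stop_iff)
    then show False using no by blast
  qed
  define T where "T = (LEAST T. stop T)"
  have T: "stop T" unfolding T_def using ex by (meson LeastI)
  have before: "\<not> stop j" if "j < T" for j using that unfolding T_def by (rule not_less_Least)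
  have Tn: "T \<le> Suc n" unfolding T_def using ex by (meson Least_le order_trans)
  obtain k where k: "T = Suc k" using T by (cases T) (auto simp: stop_iff)
  have r: "accelerated (y j) inner_iters (y (Suc j))"
      "acceptable (y (Suc j)) (u (Suc j)) (g (Suc j))" if "j < Suc k" for j
    using that k by (intro run before; simp)+
  have "dual_norm E B (\<lambda>h. grad F (u (Suc k)) h + g (Suc k) h) \<le> \<epsilon> / 2"
    using T k by (simp add: stop_iff)
  then have "dual_norm E B (\<lambda>h. grad f (u T) h + g T h) \<le> \<epsilon>"
    using gradient_transfer[of y "Suc k" u g k \<epsilon>, OF y0 r _ \<delta>_eq] k by simp
  with T Tn before show ?thesis unfolding stop_def by blast
qed

end

theorem corollary5p8:
  fixes p :: nat and \<nu> Hf \<theta> :: real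
  assumes "2 \<le> p" and "0 \<le> \<nu>" and "\<nu> \<le> 1" and "0 \<le> Hf" and "0 \<le> \<theta>"
  shows "\<exists>C M :: real.
    \<forall>(E :: 'a::real_normed_vector set) B f \<phi> x0 xs R \<epsilon> \<delta> y u g.
      subspace E \<longrightarrow> (\<exists>b. finite b \<and> E = span b) \<longrightarrow>
      pos_def_selfadjoint_on E B \<longrightarrow>
      convex_on E f \<longrightarrow> times_differentiable_on p f E \<longrightarrow>
      holder_const E B p \<nu> f = ennreal Hf \<longrightarrow>
      closed_convex_fun_on E \<phi> \<longrightarrow> rel_interior (eff_dom E \<phi>) \<noteq> {} \<longrightarrow>
      is_arg_min (\<lambda>x. ereal (f x) + \<phi> x) (\<lambda>x. x \<in> E) xs \<longrightarrow>
      x0 \<in> E \<longrightarrow> bnorm B (x0 - xs) \<le> R \<longrightarrow> 1 \<le> R \<longrightarrow>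
      0 < \<epsilon> \<longrightarrow> \<epsilon> < 1 \<longrightarrow>
      \<delta> = \<epsilon> / (2 powr (real p + \<nu>) * R powr (real p + \<nu> - 1)) \<longrightarrow>
      M \<le> R powr (real p + \<nu> - 1) / \<epsilon> \<longrightarrow>
      alg6_execution E B p \<nu> Hf \<theta> f \<phi> x0 \<delta> \<epsilon> y u g \<longrightarrow>
      (\<exists>T. alg6_stop E B p \<nu> f x0 \<delta> \<epsilon> u g T \<and>
           (\<forall>j<T. \<not> alg6_stop E B p \<nu> f x0 \<delta> \<epsilon> u g j) \<and>
           real (T * alg6_inner p \<nu> Hf \<theta> \<delta>)
             \<le> C * (log 2 (R powr (real p + \<nu> - 1) / \<epsilon>)
                  * (R powr (real p + \<nu> - 1) / \<epsilon>) powr (1 / (real p + \<nu>))) \<and>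
           dual_norm E B (\<lambda>h. grad f (u T) h + g T h) \<le> \<epsilon>)"
proof -
  \<comment> \<open>\<open>C\<close> comes from a statement about real numbers, so it depends
    neither on the space nor on the functions chosen afterwards; the threshold \<open>M\<close> is
    2.\<close>
  obtain C where C: "\<And>R \<epsilon> \<delta>. 1 \<le> R \<Longrightarrow> 0 < \<epsilon> \<Longrightarrow> \<epsilon> < 1 \<Longrightarrow> \<delta> = \<epsilon> / (2 powr (real p + \<nu>) * R powr (real p + \<nu> - 1)) \<Longrightarrow>
    2 \<le> R powr (real p + \<nu> - 1) / \<epsilon> \<Longrightarrow>
    \<exists>n. real (Suc n * alg6_inner p \<nu> Hf \<theta> \<delta>)
           \<le> C * (log 2 (R powr (real p + \<nu> - 1) / \<epsilon>) * (R powr (real p + \<nu> - 1) / \<epsilon>) powr (1 / (real p + \<nu>))) \<and>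
         (real p + \<nu> + 1) * ((Hf + \<delta> / (real p + \<nu>) * C_const p \<nu>) / fact (p - 1) + 3 * \<theta>) powr (1 / (real p + \<nu>))
           * ((1 / (1 + 2 powr (1 - (real p + \<nu>)))) ^ n * (\<delta> * R powr (real p + \<nu>))) powr ((real p + \<nu> - 1) / (real p + \<nu>)) \<le> \<epsilon> / 2"
    using iteration_count[OF assms refl] by blast
  show ?thesis
  proof (rule exI[of _ C], rule exI[of _ 2], intro allI impI)
    fix E :: "'a set" and B f \<phi> x0 xs y u g and R \<epsilon> \<delta> :: real
    assume E: "subspace E" "\<exists>b. finite b \<and> E = span b" "pos_def_selfadjoint_on E B"
      and f: "convex_on E f" "times_differentiable_on p f E" "holder_const E B p \<nu> f = ennreal Hf"
      and \<phi>: "closed_convex_fun_on E \<phi>" and ri: "rel_interior (eff_dom E \<phi>) \<noteq> {}"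
      and xs: "is_arg_min (\<lambda>x. ereal (f x) + \<phi> x) (\<lambda>x. x \<in> E) xs"
      and x0: "x0 \<in> E" and R: "bnorm B (x0 - xs) \<le> R" "1 \<le> R" and \<epsilon>: "0 < \<epsilon>" "\<epsilon> < 1"
      and \<delta>_eq: "\<delta> = \<epsilon> / (2 powr (real p + \<nu>) * R powr (real p + \<nu> - 1))"
      and Q: "2 \<le> R powr (real p + \<nu> - 1) / \<epsilon>"
      and exe: "alg6_execution E B p \<nu> Hf \<theta> f \<phi> x0 \<delta> \<epsilon> y u g"
    have \<delta>0: "0 < \<delta>" using \<delta>_eq \<epsilon> R by simp
    interpret composite_problem E B p \<nu> Hf \<theta> f \<phi> x0 \<delta>
      using assms E f \<phi> x0 \<delta>0 by unfold_locales (auto simp: closed_convex_fun_on_def)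
    \<comment> \<open>A point of finite value shows that the minimum is finite, which puts
      \<open>xs\<close> into the domain of \<phi>.\<close>
    obtain d where d: "d \<in> eff_dom E \<phi>" using ri by fastforce
    have xs_min: "xs \<in> E" "\<And>x. x \<in> E \<Longrightarrow> ereal (f xs) + \<phi> xs \<le> ereal (f x) + \<phi> x"
      using xs by (auto simp: is_arg_min_def not_less)
    have xs_dom: "xs \<in> eff_dom E \<phi>"
      using xs_min(2)[OF dom_E[OF d]] xs_min(1) d by (cases "\<phi> xs"; cases "\<phi> d") (auto simp: eff_dom_def)
    interpret composite_problem_with_minimizer E B p \<nu> Hf \<theta> f \<phi> x0 \<delta> xs R
    proof
      fix x assume x: "x \<in> eff_dom E \<phi>"
      have "ereal (f xs) + ereal (real_of_ereal (\<phi> xs)) \<le> ereal (f x) + ereal (real_of_ereal (\<phi> x))"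
        using xs_min(2)[OF dom_E[OF x]] \<phi>_real[OF x] \<phi>_real[OF xs_dom] by simp
      then show "f xs + real_of_ereal (\<phi> xs) \<le> f x + real_of_ereal (\<phi> x)" by simp
    qed (use xs_dom R in auto)
    obtain n where n: "real (Suc n * alg6_inner p \<nu> Hf \<theta> \<delta>)
           \<le> C * (log 2 (R powr (real p + \<nu> - 1) / \<epsilon>) * (R powr (real p + \<nu> - 1) / \<epsilon>) powr (1 / (real p + \<nu>)))"
      "(q + 1) * lam powr (1 / q) * (\<rho> ^ n * (\<delta> * R powr q)) powr ((q - 1) / q) \<le> \<epsilon> / 2"
      using C[OF R(2) \<epsilon> \<delta>_eq Q] unfolding lam_def \<rho>_def q_def by blast
    obtain T where T: "T \<le> Suc n" "alg6_stop E B p \<nu> f x0 \<delta> \<epsilon> u g T"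
      "\<forall>j<T. \<not> alg6_stop E B p \<nu> f x0 \<delta> \<epsilon> u g j"
      "dual_norm E B (\<lambda>h. grad f (u T) h + g T h) \<le> \<epsilon>"
      using alg6_terminates[OF exe _ n(2)] \<delta>_eq unfolding q_def by blast
    have "real (T * alg6_inner p \<nu> Hf \<theta> \<delta>) \<le> real (Suc n * alg6_inner p \<nu> Hf \<theta> \<delta>)"
      using T(1) by (intro of_nat_mono mult_le_mono1)
    with n(1) T show "\<exists>T. alg6_stop E B p \<nu> f x0 \<delta> \<epsilon> u g T \<and>
           (\<forall>j<T. \<not> alg6_stop E B p \<nu> f x0 \<delta> \<epsilon> u g j) \<and>
           real (T * alg6_inner p \<nu> Hf \<theta> \<delta>)
             \<le> C * (log 2 (R powr (real p + \<nu> - 1) / \<epsilon>)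
                  * (R powr (real p + \<nu> - 1) / \<epsilon>) powr (1 / (real p + \<nu>))) \<and>
           dual_norm E B (\<lambda>h. grad f (u T) h + g T h) \<le> \<epsilon>"
      by (meson order_trans)
  qed
qed

end
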